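(* There is a data structure for Dynamic Interval Scheduling on two machines that supports any sequence of $n$ insert/delete/query operations on intervals in $\tilde{O}(n^{1/2})$ amortized time per operation.
   Context: An interval is a pair $(s_i,f_i)$ of reals with $s_i<f_i$; endpoints of all intervals are assumed pairwise distinct. Two intervals are compatible if they are disjoint. Dynamic Interval Scheduling on two machines: maintain a set $S$ of intervals under insertions and deletions; a query asks for the maximum size of a subset of $S$ that can be partitioned into two classes, each consisting of pairwise compatible intervals. $\tilde{O}$ hides factors polylogarithmic in $n$. *)

theory Defs
  imports Complex_Main "HOL-Library.Landau_Symbols" "HOL-Library.Log_Nat"
begin

section \<open>Interval scheduling on two machines\<close>

type_synonym ival = "real \<times> real"

definition compatible :: "ival \<Rightarrow> ival \<Rightarrow> bool" where
  "compatible I J \<longleftrightarrow> {fst I..snd I} \<inter> {fst J..snd J} = {}"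

definition two_schedulable :: "ival set \<Rightarrow> bool" where
  "two_schedulable T \<longleftrightarrow>
     (\<exists>A B. T = A \<union> B \<and> A \<inter> B = {} \<and> pairwise compatible A \<and> pairwise compatible B)"

definition opt2 :: "ival set \<Rightarrow> nat" where
  "opt2 S = Max {card T |T. T \<subseteq> S \<and> two_schedulable T}"

datatype operation = Insert ival | Delete ival | Query

fun update :: "operation \<Rightarrow> ival set \<Rightarrow> ival set" where
  "update (Insert I) S = insert I S"
| "update (Delete I) S = S - {I}"
| "update Query S = S"

text \<open>Distinctness of endpoints is required among the intervals that are present simultaneously;
  a deleted interval may be inserted again.\<close>

fun admissible :: "operation \<Rightarrow> ival set \<Rightarrow> bool" where
  "admissible (Insert I) S \<longleftrightarrow>
     fst I < snd I \<and> (\<forall>J\<in>S. {fst I, snd I} \<inter> {fst J, snd J} = {})"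
| "admissible (Delete I) S \<longleftrightarrow> I \<in> S"
| "admissible Query S \<longleftrightarrow> True"

fun valid_ops :: "ival set \<Rightarrow> operation list \<Rightarrow> bool" where
  "valid_ops S [] \<longleftrightarrow> True"
| "valid_ops S (p # ps) \<longleftrightarrow> admissible p S \<and> valid_ops (update p S) ps"

fun answers :: "ival set \<Rightarrow> operation list \<Rightarrow> nat list" where
  "answers S [] = []"
| "answers S (p # ps) = (if p = Query then [opt2 S] else []) @ answers (update p S) ps"


section \<open>Machine model\<close>

text \<open>A random access machine under the logarithmic cost criterion: a natural number costs its
  bit length each time it is computed, read, or used as an address. Up to polylogarithmic factors
  this agrees with a unit-cost machine on words of logarithmically many bits, without fixing a word
  size. Real numbers are atomic: they can only be copied and compared, at unit cost.

  Registers are indexed by program constants; memory cells are addressed by computed numbers.\<close>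

record ram =
  nreg :: "nat \<Rightarrow> nat"
  nmem :: "nat \<Rightarrow> nat"
  rreg :: "nat \<Rightarrow> real"
  rmem :: "nat \<Rightarrow> real"

datatype nexp =
    NConst nat
  | NReg nat
  | NLoad nexp
  | Plus nexp nexp
  | Minus nexp nexp
  | Times nexp nexp
  | Divide nexp nexp

datatype rexp = RReg nat | RLoad nexp

datatype bexp =
    NLess nexp nexp
  | NEq nexp nexp
  | RLess rexp rexp
  | Not bexp
  | And bexp bexp

datatype com =
    Skip
  | NAssign nat nexp
  | NStore nexp nexp
  | RAssign nat rexp
  | RStore nexp rexp
  | Seq com com
  | If bexp com com
  | While bexp com

fun nval :: "nexp \<Rightarrow> ram \<Rightarrow> nat" where
  "nval (NConst n) \<sigma> = n"
| "nval (NReg i) \<sigma> = nreg \<sigma> i"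
| "nval (NLoad a) \<sigma> = nmem \<sigma> (nval a \<sigma>)"
| "nval (Plus a b) \<sigma> = nval a \<sigma> + nval b \<sigma>"
| "nval (Minus a b) \<sigma> = nval a \<sigma> - nval b \<sigma>"
| "nval (Times a b) \<sigma> = nval a \<sigma> * nval b \<sigma>"
| "nval (Divide a b) \<sigma> = nval a \<sigma> div nval b \<sigma>"

fun rval :: "rexp \<Rightarrow> ram \<Rightarrow> real" where
  "rval (RReg i) \<sigma> = rreg \<sigma> i"
| "rval (RLoad a) \<sigma> = rmem \<sigma> (nval a \<sigma>)"

fun bval :: "bexp \<Rightarrow> ram \<Rightarrow> bool" where
  "bval (NLess a b) \<sigma> \<longleftrightarrow> nval a \<sigma> < nval b \<sigma>"
| "bval (NEq a b) \<sigma> \<longleftrightarrow> nval a \<sigma> = nval b \<sigma>"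
| "bval (RLess x y) \<sigma> \<longleftrightarrow> rval x \<sigma> < rval y \<sigma>"
| "bval (Not b) \<sigma> \<longleftrightarrow> \<not> bval b \<sigma>"
| "bval (And b c) \<sigma> \<longleftrightarrow> bval b \<sigma> \<and> bval c \<sigma>"

definition size_cost :: "nat \<Rightarrow> nat" where
  "size_cost n = 1 + floorlog 2 n"

text \<open>Every node of an expression is charged the bit length of its value; this also charges
  for operands and addresses, since they are values of subexpressions.\<close>

fun ncost :: "nexp \<Rightarrow> ram \<Rightarrow> nat" where
  "ncost (NConst n) \<sigma> = size_cost n"
| "ncost (NReg i) \<sigma> = size_cost (nreg \<sigma> i)"
| "ncost (NLoad a) \<sigma> = ncost a \<sigma> + size_cost (nmem \<sigma> (nval a \<sigma>))"
| "ncost (Plus a b) \<sigma> = ncost a \<sigma> + ncost b \<sigma> + size_cost (nval a \<sigma> + nval b \<sigma>)"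
| "ncost (Minus a b) \<sigma> = ncost a \<sigma> + ncost b \<sigma> + size_cost (nval a \<sigma> - nval b \<sigma>)"
| "ncost (Times a b) \<sigma> = ncost a \<sigma> + ncost b \<sigma> + size_cost (nval a \<sigma> * nval b \<sigma>)"
| "ncost (Divide a b) \<sigma> = ncost a \<sigma> + ncost b \<sigma> + size_cost (nval a \<sigma> div nval b \<sigma>)"

fun rcost :: "rexp \<Rightarrow> ram \<Rightarrow> nat" where
  "rcost (RReg i) \<sigma> = 1"
| "rcost (RLoad a) \<sigma> = 1 + ncost a \<sigma>"

fun bcost :: "bexp \<Rightarrow> ram \<Rightarrow> nat" where
  "bcost (NLess a b) \<sigma> = 1 + ncost a \<sigma> + ncost b \<sigma>"
| "bcost (NEq a b) \<sigma> = 1 + ncost a \<sigma> + ncost b \<sigma>"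
| "bcost (RLess x y) \<sigma> = 1 + rcost x \<sigma> + rcost y \<sigma>"
| "bcost (Not b) \<sigma> = 1 + bcost b \<sigma>"
| "bcost (And b c) \<sigma> = 1 + bcost b \<sigma> + bcost c \<sigma>"

text \<open>\<open>exec c \<sigma> t \<sigma>'\<close>: started in \<open>\<sigma>\<close>, the program \<open>c\<close> terminates in \<open>\<sigma>'\<close> at total cost \<open>t\<close>.\<close>

inductive exec :: "com \<Rightarrow> ram \<Rightarrow> nat \<Rightarrow> ram \<Rightarrow> bool" where
  Skip: "exec Skip \<sigma> 1 \<sigma>"
| NAssign: "exec (NAssign i a) \<sigma> (1 + ncost a \<sigma>)
    (\<sigma>\<lparr>nreg := (nreg \<sigma>)(i := nval a \<sigma>)\<rparr>)"
| NStore: "exec (NStore a b) \<sigma> (1 + ncost a \<sigma> + ncost b \<sigma>)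
    (\<sigma>\<lparr>nmem := (nmem \<sigma>)(nval a \<sigma> := nval b \<sigma>)\<rparr>)"
| RAssign: "exec (RAssign i x) \<sigma> (1 + rcost x \<sigma>)
    (\<sigma>\<lparr>rreg := (rreg \<sigma>)(i := rval x \<sigma>)\<rparr>)"
| RStore: "exec (RStore a x) \<sigma> (1 + ncost a \<sigma> + rcost x \<sigma>)
    (\<sigma>\<lparr>rmem := (rmem \<sigma>)(nval a \<sigma> := rval x \<sigma>)\<rparr>)"
| Seq: "exec c \<sigma> t \<sigma>' \<Longrightarrow> exec d \<sigma>' u \<sigma>'' \<Longrightarrow> exec (Seq c d) \<sigma> (t + u) \<sigma>''"
| IfTrue: "bval b \<sigma> \<Longrightarrow> exec c \<sigma> t \<sigma>' \<Longrightarrow> exec (If b c d) \<sigma> (bcost b \<sigma> + t) \<sigma>'"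
| IfFalse: "\<not> bval b \<sigma> \<Longrightarrow> exec d \<sigma> t \<sigma>' \<Longrightarrow> exec (If b c d) \<sigma> (bcost b \<sigma> + t) \<sigma>'"
| WhileFalse: "\<not> bval b \<sigma> \<Longrightarrow> exec (While b c) \<sigma> (bcost b \<sigma>) \<sigma>"
| WhileTrue: "bval b \<sigma> \<Longrightarrow> exec c \<sigma> t \<sigma>' \<Longrightarrow> exec (While b c) \<sigma>' u \<sigma>'' \<Longrightarrow>
    exec (While b c) \<sigma> (bcost b \<sigma> + t + u) \<sigma>''"

inductive_cases SkipE: "exec Skip \<sigma> t \<sigma>'"
inductive_cases NAssignE: "exec (NAssign i a) \<sigma> t \<sigma>'"
inductive_cases NStoreE: "exec (NStore a b) \<sigma> t \<sigma>'"
inductive_cases RAssignE: "exec (RAssign i x) \<sigma> t \<sigma>'"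
inductive_cases RStoreE: "exec (RStore a x) \<sigma> t \<sigma>'"
inductive_cases SeqE: "exec (Seq c d) \<sigma> t \<sigma>'"
inductive_cases IfE: "exec (If b c d) \<sigma> t \<sigma>'"
inductive_cases WhileE: "exec (While b c) \<sigma> t \<sigma>'"

lemma exec_deterministic:
  "exec c \<sigma> t \<sigma>1 \<Longrightarrow> exec c \<sigma> u \<sigma>2 \<Longrightarrow> t = u \<and> \<sigma>1 = \<sigma>2"
proof (induction arbitrary: u \<sigma>2 rule: exec.induct)
  case (Seq c \<sigma> t \<sigma>' d v \<sigma>'')
  from Seq.prems show ?case
    by (rule SeqE) (use Seq.IH in metis)
next
  case (IfTrue b \<sigma> c t \<sigma>' d)
  from IfTrue.prems show ?case
    by (rule IfE) (use IfTrue.IH IfTrue.hyps in metis)+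
next
  case (IfFalse b \<sigma> d t \<sigma>' c)
  from IfFalse.prems show ?case
    by (rule IfE) (use IfFalse.IH IfFalse.hyps in metis)+
next
  case (WhileFalse b \<sigma> c)
  from WhileFalse.prems show ?case
    by (rule WhileE) (use WhileFalse.hyps in metis)+
next
  case (WhileTrue b \<sigma> c t \<sigma>' v \<sigma>'')
  from WhileTrue.prems show ?case
    by (rule WhileE) (use WhileTrue.IH WhileTrue.hyps in metis)+
qed (auto elim: SkipE NAssignE NStoreE RAssignE RStoreE)


section \<open>Data structures on the machine\<close>

text \<open>A data structure consists of one program per operation; the machine state persists between
  operations. The endpoints of an inserted or deleted interval are passed in the real registers 0
  and 1, and the answer to a query is returned in the numeric register 0. All registers and memory
  cells are initially zero, and the number of operations is not known to the programs.\<close>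

datatype data_structure = DS (ins_prog: com) (del_prog: com) (qry_prog: com)

definition initial :: ram where
  "initial = \<lparr>nreg = (\<lambda>_. 0), nmem = (\<lambda>_. 0), rreg = (\<lambda>_. 0), rmem = (\<lambda>_. 0)\<rparr>"

definition pass :: "ival \<Rightarrow> ram \<Rightarrow> ram" where
  "pass I \<sigma> = \<sigma>\<lparr>rreg := (rreg \<sigma>)(0 := fst I, 1 := snd I)\<rparr>"

text \<open>\<open>serve D \<sigma> ps t out\<close>: processing the operations \<open>ps\<close> one after the other from state \<open>\<sigma>\<close>
  has total cost \<open>t\<close> and yields the list \<open>out\<close> of query answers.\<close>

inductive serve :: "data_structure \<Rightarrow> ram \<Rightarrow> operation list \<Rightarrow> nat \<Rightarrow> nat list \<Rightarrow> bool"
  for D where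
  none: "serve D \<sigma> [] 0 []"
| ins: "exec (ins_prog D) (pass I \<sigma>) t \<sigma>' \<Longrightarrow> serve D \<sigma>' ps u out \<Longrightarrow>
    serve D \<sigma> (Insert I # ps) (t + u) out"
| del: "exec (del_prog D) (pass I \<sigma>) t \<sigma>' \<Longrightarrow> serve D \<sigma>' ps u out \<Longrightarrow>
    serve D \<sigma> (Delete I # ps) (t + u) out"
| qry: "exec (qry_prog D) \<sigma> t \<sigma>' \<Longrightarrow> serve D \<sigma>' ps u out \<Longrightarrow>
    serve D \<sigma> (Query # ps) (t + u) (nreg \<sigma>' 0 # out)"

definition supports_in_amortized :: "data_structure \<Rightarrow> (nat \<Rightarrow> real) \<Rightarrow> bool" where
  "supports_in_amortized D f \<longleftrightarrow>
     (\<forall>ps. valid_ops {} ps \<longrightarrow>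
        (\<exists>t. serve D initial ps t (answers {} ps) \<and> real t \<le> real (length ps) * f (length ps)))"

definition soft_O :: "(nat \<Rightarrow> real) \<Rightarrow> (nat \<Rightarrow> real) set" where
  "soft_O g = {f. \<exists>k::nat. f \<in> O(\<lambda>n. g n * ln (real n) ^ k)}"

end

theory Submission
  imports Defs "HOL-Library.Nat_Bijection"
begin

text \<open>Sweep the intervals by finishing time, keeping the last finishing times \<open>B \<le> A\<close> of the two machines:
  an interval goes to the machine of \<open>A\<close> if it starts after \<open>A\<close>, else to that of \<open>B\<close> if possible, and
  is discarded otherwise. This greedy schedule is optimal, and it is a fold over the sorted list.

  The list is cut into about \<open>q\<close> blocks of at most \<open>2 q\<close> intervals, where \<open>q\<close> is about the square root of
  the number of updates; every \<open>q\<close> updates \<open>q\<close> is incremented and the blocks are evened out. A query folds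
  block by block, so it suffices that a block of \<open>m\<close> intervals can be preprocessed in time \<open>O(m polylog m)\<close> such that it is
  crossed from an arbitrary state in polylogarithmic time.

  Let \<open>N a\<close> be the first interval of the block after \<open>a\<close> that starts after \<open>a\<close> finishes. While \<open>B\<close> is fixed,
  \<open>A\<close> follows \<open>N\<close>, until some \<open>j\<close> between \<open>a\<close> and \<open>N a\<close> starts after \<open>B\<close>; binary lifting with maxima of
  starting times along the paths of \<open>N\<close> finds this point. Then both machines are inside the block, at
  \<open>x < y < N x\<close>, and alternately follow \<open>N\<close> until \<open>N x = N y\<close>; binary lifting again. The next state
  \<open>(N x, x)\<close> depends on \<open>x\<close> only, so the rest of the fold can be tabulated, from right to left.\<close>

section \<open>Optimality of the greedy schedule\<close>

text \<open>A pair of indices inside a block takes quadratically many values, so the states cannot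
  all be tabulated. What saves the construction is that sorting by finishing time makes
  \<open>nxt\<close> monotone: the orbits of the two machines interleave and can only merge, and at
  the merge the later machine takes the common successor, so that one of the two indices is
  forgotten. Hence a table of linear size suffices, and the routine that fills it is the one that
  later crosses the block. The number of operations is unknown to the programs. Rounds of growing
  length use up about \<open>q * q / 2\<close> updates in total, which keeps \<open>q\<close> near
  the square root of twice the number of updates so far; the redistribution that ends a round does
  about \<open>q\<close> times the work of an ordinary update and is paid for by the updates of that
  round. Under logarithmic cost every stored number has to stay small. One exponent
  \<open>l\<close>, with all stored numbers at most \<open>2 ^ l\<close>, is fixed for an entire
  run; it exists only in the proof.\<close>

fun step :: "real \<times> real \<times> nat \<Rightarrow> ival \<Rightarrow> real \<times> real \<times> nat" where
  "step (A, B, c) (s, f) =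
     (if A \<le> s then (f, B, Suc c) else if B \<le> s then (f, A, Suc c) else (A, B, c))"

text \<open>\<open>best xs a b\<close> is the optimum when the machines are free from \<open>a\<close> and \<open>b\<close> on.\<close>

fun best :: "ival list \<Rightarrow> real \<Rightarrow> real \<Rightarrow> nat" where
  "best [] a b = 0"
| "best ((s, f) # xs) a b =
     max (best xs a b)
       (max (if a \<le> s then Suc (best xs f b) else 0) (if b \<le> s then Suc (best xs a f) else 0))"

lemma best_commute: "best xs a b = best xs b a"
proof (induction xs arbitrary: a b)
  case (Cons x xs)
  obtain s f where x: "x = (s, f)" by force
  show ?case
    by (simp add: x Cons.IH[of a b] Cons.IH[of a f] Cons.IH[of b f] max.commute max.left_commute)
qed simp

lemma best_antimono: "a \<le> a' \<Longrightarrow> b \<le> b' \<Longrightarrow> best xs a' b' \<le> best xs a b"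
proof (induction xs arbitrary: a b a' b')
  case (Cons x xs)
  obtain s f where x: "x = (s, f)" by force
  have 1: "best xs a' b' \<le> best xs a b" "best xs f b' \<le> best xs f b" "best xs a' f \<le> best xs a f"
    using Cons by auto
  then show ?case using Cons.prems by (auto simp: x intro: le_max_iff_disj[THEN iffD2])
qed simp

text \<open>Dropping the first interval that the machine free from \<open>a\<close> on accepts costs
  one. This interval finishes after \<open>f\<close>, so by antimonotonicity a machine free from
  \<open>f\<close> on does at least as well afterwards; \<open>a\<close> and \<open>f\<close> may
  come in either order.\<close>

lemma best_Lipschitz:
  "sorted_wrt (<) (f # map snd xs) \<Longrightarrow> best xs a b \<le> Suc (best xs f b)"
proof (induction xs arbitrary: a b)
  case (Cons x xs)
  obtain s' f' where x: "x = (s', f')" by force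
  from Cons.prems x have f: "f < f'" and IH: "\<And>a b. best xs a b \<le> Suc (best xs f b)"
    using Cons.IH by auto
  have "best xs f' b \<le> best xs f b" using f by (intro best_antimono) auto
  then show ?case using f IH[of a b] IH[of a f'] by (auto simp: x)
qed simp

text \<open>Delaying one machine costs at most one interval (\<open>best_Lipschitz\<close>), hence taking an interval is never
  worse than discarding it; and it is best to leave the earlier machine free (\<open>best_antimono\<close>).\<close>

lemma greedy_best:
  "sorted_wrt (<) (map snd xs) \<Longrightarrow> \<forall>x\<in>set xs. fst x < snd x \<and> a \<le> snd x \<Longrightarrow> b \<le> a \<Longrightarrow>
    snd (snd (foldl step (a, b, c) xs)) = c + best xs a b"
proof (induction xs arbitrary: a b c)
  case (Cons x xs)
  obtain s f where x: "x = (s, f)" by force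
  have sf: "s < f" "a \<le> f" and sorted: "sorted_wrt (<) (map snd xs)"
    and later: "\<forall>x\<in>set xs. fst x < snd x \<and> f \<le> snd x"
    using Cons.prems by (auto simp: x less_imp_le)
  have lip: "best xs a b \<le> Suc (best xs f b)" for a b
    using Cons.prems by (intro best_Lipschitz) (auto simp: x)
  consider "a \<le> s" | "b \<le> s" "s < a" | "s < b" by linarith
  then show ?case
  proof cases
    case 1
    then have "best xs a f \<le> best xs f b"
      using Cons.prems sf best_antimono[of f f b a xs] best_commute[of xs a f] by auto
    moreover have "snd (snd (foldl step (f, b, Suc c) xs)) = Suc c + best xs f b"
      using 1 Cons.prems sf by (intro Cons.IH sorted later) auto
    ultimately show ?thesis using 1 Cons.prems lip[of a b] by (auto simp: x)
  next
    case 2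
    have "best xs a b \<le> Suc (best xs a f)"
      using lip[of b a] by (simp add: best_commute)
    moreover have "snd (snd (foldl step (f, a, Suc c) xs)) = Suc c + best xs f a"
      using sf by (intro Cons.IH sorted later) auto
    ultimately show ?thesis using 2 by (auto simp: x best_commute[of xs f a])
  next
    case 3
    then show ?thesis using Cons by (auto simp: x)
  qed
qed simp

lemma best_upper:
  "sorted_wrt (<) (map snd xs) \<Longrightarrow> \<forall>x\<in>set xs. fst x < snd x \<Longrightarrow>
    A \<inter> B = {} \<Longrightarrow> A \<union> B \<subseteq> set xs \<Longrightarrow> pairwise compatible A \<Longrightarrow> pairwise compatible B \<Longrightarrow>
    \<forall>x\<in>A. a \<le> fst x \<Longrightarrow> \<forall>x\<in>B. b \<le> fst x \<Longrightarrow> card (A \<union> B) \<le> best xs a b"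
proof (induction xs arbitrary: A B a b)
  case (Cons x xs)
  obtain s f where x: "x = (s, f)" by force
  have sorted: "sorted_wrt (<) (map snd xs)" and less: "\<forall>x\<in>set xs. fst x < snd x"
    and later: "\<forall>y\<in>set xs. f < snd y" and sf: "s < f"
    using Cons.prems by (auto simp: x)
  have after: "\<forall>y\<in>C - {x}. f \<le> fst y" if "x \<in> C" "pairwise compatible C" "C \<subseteq> set (x # xs)" for C
  proof
    fix y assume y: "y \<in> C - {x}"
    then have "compatible x y" "y \<in> set xs" using that by (auto simp: pairwise_def)
    then have "{s..f} \<inter> {fst y..snd y} = {}" "f < snd y" using later by (auto simp: compatible_def x)
    \<comment> \<open>The larger of the two starting times would be a common point if
      \<open>y\<close> started before \<open>f\<close>, because \<open>y\<close> finishes after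
      \<open>f\<close>.\<close>
    then have "max s (fst y) \<notin> {s..f} \<inter> {fst y..snd y}" by auto
    with \<open>f < snd y\<close> sf less \<open>y \<in> set xs\<close> show "f \<le> fst y" by (auto simp: max_def split: if_splits)
  qed
  have fin: "finite (A \<union> B)" using Cons.prems finite_subset by blast
  note IH = Cons.IH[OF sorted less]
  have pw: "pairwise compatible (C - {x})" if "pairwise compatible C" for C
    using that by (rule pairwise_subset) auto
  consider "x \<in> A" | "x \<in> B" | "x \<notin> A \<union> B" by blast
  then show ?case
  proof cases
    case 1
    have "card ((A - {x}) \<union> B) \<le> best xs f b"
      using Cons.prems 1 by (intro IH after pw) auto
    moreover have "A \<union> B = insert x ((A - {x}) \<union> B)" "x \<notin> (A - {x}) \<union> B"
      using 1 Cons.prems(3) by auto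
    ultimately have "card (A \<union> B) \<le> Suc (best xs f b)"
      using fin by (metis card_insert_disjoint finite_insert Suc_le_mono)
    then show ?thesis using Cons.prems 1 by (auto simp: x)
  next
    case 2
    have "card (A \<union> (B - {x})) \<le> best xs a f"
      using Cons.prems 2 by (intro IH after pw) auto
    moreover have "A \<union> B = insert x (A \<union> (B - {x}))" "x \<notin> A \<union> (B - {x})"
      using 2 Cons.prems(3) by auto
    ultimately have "card (A \<union> B) \<le> Suc (best xs a f)"
      using fin by (metis card_insert_disjoint finite_insert Suc_le_mono)
    then show ?thesis using Cons.prems 2 by (auto simp: x)
  next
    case 3
    then have "card (A \<union> B) \<le> best xs a b" using Cons.prems by (intro IH) auto
    then show ?thesis by (auto simp: x)
  qed
qed simp

definition distinct_ends :: "ival set \<Rightarrow> bool" where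
  "distinct_ends S \<longleftrightarrow> (\<forall>I\<in>S. \<forall>J\<in>S. I \<noteq> J \<longrightarrow> {fst I, snd I} \<inter> {fst J, snd J} = {})"

text \<open>\<open>best\<close> lets an interval start exactly when a machine becomes free, whereas
  compatible intervals are disjoint as closed intervals. Distinct endpoints make the inequality
  between two intervals strict.\<close>

lemma best_attained:
  "sorted_wrt (<) (map snd xs) \<Longrightarrow> \<forall>x\<in>set xs. fst x < snd x \<Longrightarrow> distinct_ends (set xs) \<Longrightarrow>
    \<exists>A B. A \<inter> B = {} \<and> A \<union> B \<subseteq> set xs \<and> pairwise compatible A \<and> pairwise compatible B \<and>
      (\<forall>x\<in>A. a \<le> fst x) \<and> (\<forall>x\<in>B. b \<le> fst x) \<and> card (A \<union> B) = best xs a b"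
proof (induction xs arbitrary: a b)
  case Nil
  then show ?case by (intro exI[of _ "{}"]) auto
next
  case (Cons x xs)
  obtain s f where x: "x = (s, f)" by force
  have later: "\<forall>y\<in>set xs. f < snd y" and sf: "s < f" and x_new: "x \<notin> set xs"
    using Cons.prems by (auto simp: x)
  have IH: "\<exists>A B. A \<inter> B = {} \<and> A \<union> B \<subseteq> set xs \<and> pairwise compatible A \<and> pairwise compatible B \<and>
      (\<forall>x\<in>A. a \<le> fst x) \<and> (\<forall>x\<in>B. b \<le> fst x) \<and> card (A \<union> B) = best xs a b" for a b
    using Cons.prems by (intro Cons.IH) (auto simp: distinct_ends_def)
  have add: "pairwise compatible (insert x C)"
    if "pairwise compatible C" "C \<subseteq> set xs" "\<forall>y\<in>C. f \<le> fst y" for C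
  proof -
    have "f < fst y" if "y \<in> C" for y
    proof -
      have "y \<in> set xs" "y \<noteq> x" using that \<open>C \<subseteq> set xs\<close> x_new by auto
      then have "f \<noteq> fst y" using Cons.prems(3) by (auto simp: distinct_ends_def x)
      then show ?thesis using that \<open>\<forall>y\<in>C. f \<le> fst y\<close> by fastforce
    qed
    then show ?thesis
      using that(1) by (fastforce simp: pairwise_insert compatible_def x)
  qed
  consider "best (x # xs) a b = best xs a b"
    | "a \<le> s" "best (x # xs) a b = Suc (best xs f b)"
    | "b \<le> s" "best (x # xs) a b = Suc (best xs a f)"
  proof -
    define u v where "u = (if a \<le> s then Suc (best xs f b) else 0)"
      and "v = (if b \<le> s then Suc (best xs a f) else 0)"
    have "best (x # xs) a b = max (best xs a b) (max u v)" by (simp add: x u_def v_def)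
    \<comment> \<open>A maximum of zero is already \<open>best xs a b\<close>, so the default value
      \<open>0\<close> of an infeasible branch can be excluded from the other two cases.\<close>
    then have "best (x # xs) a b = best xs a b \<or> best (x # xs) a b = u \<and> u \<noteq> 0 \<or>
        best (x # xs) a b = v \<and> v \<noteq> 0"
      by (auto simp: max_def)
    then show ?thesis using that unfolding u_def v_def by presburger
  qed
  then show ?case
  proof cases
    case 1
    then show ?thesis using IH[of a b] by (metis set_subset_Cons subset_trans)
  next
    case 2
    obtain A B where AB: "A \<inter> B = {}" "A \<union> B \<subseteq> set xs" "pairwise compatible A"
      "pairwise compatible B" "\<forall>x\<in>A. f \<le> fst x" "\<forall>x\<in>B. b \<le> fst x" "card (A \<union> B) = best xs f b"
      using IH[of f b] by blast
    have "card (insert x A \<union> B) = Suc (best xs f b)"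
      using AB x_new finite_subset[OF AB(2)] by (auto simp: card_insert_if)
    moreover have "\<forall>y\<in>insert x A. a \<le> fst y" using AB 2 sf by (auto simp: x)
    ultimately show ?thesis using 2 AB x_new add[of A]
      by (intro exI[of _ "insert x A"] exI[of _ B]) auto
  next
    case 3
    obtain A B where AB: "A \<inter> B = {}" "A \<union> B \<subseteq> set xs" "pairwise compatible A"
      "pairwise compatible B" "\<forall>x\<in>A. a \<le> fst x" "\<forall>x\<in>B. f \<le> fst x" "card (A \<union> B) = best xs a f"
      using IH[of a f] by blast
    have "card (A \<union> insert x B) = Suc (best xs a f)"
      using AB x_new finite_subset[OF AB(2)] by (auto simp: card_insert_if)
    moreover have "\<forall>y\<in>insert x B. b \<le> fst y" using AB 3 sf by (auto simp: x)
    ultimately show ?thesis using 3 AB x_new add[of B]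
      by (intro exI[of _ A] exI[of _ "insert x B"]) auto
  qed
qed

theorem greedy_opt2:
  assumes "sorted_wrt (<) (map snd xs)" "\<forall>x\<in>set xs. fst x < snd x" "distinct_ends (set xs)"
    and "\<forall>x\<in>set xs. r \<le> fst x"
  shows "snd (snd (foldl step (r, r, 0) xs)) = opt2 (set xs)"
proof -
  have "snd (snd (foldl step (r, r, 0) xs)) = best xs r r"
    using assms by (subst greedy_best) fastforce+
  moreover have "opt2 (set xs) = best xs r r"
    unfolding opt2_def
  proof (rule Max_eqI)
    have "{card T |T. T \<subseteq> set xs \<and> two_schedulable T} \<subseteq> card ` Pow (set xs)" by auto
    then show "finite {card T |T. T \<subseteq> set xs \<and> two_schedulable T}"
      by (rule finite_subset) simp
  next
    fix n assume "n \<in> {card T |T. T \<subseteq> set xs \<and> two_schedulable T}"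
    then obtain A B where AB: "n = card (A \<union> B)" "A \<union> B \<subseteq> set xs" "A \<inter> B = {}"
      "pairwise compatible A" "pairwise compatible B"
      by (auto simp: two_schedulable_def)
    show "n \<le> best xs r r" unfolding AB(1)
      using AB assms by (intro best_upper) auto
  next
    obtain A B where "A \<inter> B = {}" "A \<union> B \<subseteq> set xs" "pairwise compatible A"
      "pairwise compatible B" "card (A \<union> B) = best xs r r"
      using best_attained[OF assms(1-3), of r r] by blast
    then show "best xs r r \<in> {card T |T. T \<subseteq> set xs \<and> two_schedulable T}"
      by (smt (verit, best) mem_Collect_eq two_schedulable_def)
  qed
  ultimately show ?thesis by simp
qed

section \<open>Reasoning about programs and their cost\<close>

text \<open>If all stored numbers are at most \<open>2 ^ l\<close>, the value of an expression \<open>e\<close> is at most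
  \<open>2 ^ (Suc l * vexp e)\<close>, so that its cost is linear in \<open>l\<close>.\<close>

fun vexp :: "nexp \<Rightarrow> nat" where
  "vexp (NConst n) = Suc n"
| "vexp (NReg i) = 1"
| "vexp (NLoad a) = 1"
| "vexp (Plus a b) = vexp a + vexp b"
| "vexp (Minus a b) = vexp a"
| "vexp (Times a b) = vexp a + vexp b"
| "vexp (Divide a b) = vexp a"

text \<open>Each node contributes \<open>vexp e + 2\<close>, the factor in
  \<open>size_cost_le\<close>; a load has \<open>vexp\<close> equal to 1, whence the 3.\<close>

fun necost :: "nexp \<Rightarrow> nat" where
  "necost (NLoad a) = necost a + 3"
| "necost (Plus a b) = necost a + necost b + (vexp a + vexp b + 2)"
| "necost (Minus a b) = necost a + necost b + (vexp a + 2)"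
| "necost (Times a b) = necost a + necost b + (vexp a + vexp b + 2)"
| "necost (Divide a b) = necost a + necost b + (vexp a + 2)"
| "necost a = vexp a + 2"

fun recost :: "rexp \<Rightarrow> nat" where
  "recost (RReg i) = 1"
| "recost (RLoad a) = 1 + necost a"

fun becost :: "bexp \<Rightarrow> nat" where
  "becost (NLess a b) = 1 + necost a + necost b"
| "becost (NEq a b) = 1 + necost a + necost b"
| "becost (RLess x y) = 1 + recost x + recost y"
| "becost (Not b) = 1 + becost b"
| "becost (And b c) = 1 + becost b + becost c"

fun ccost :: "com \<Rightarrow> nat" where
  "ccost Skip = 1"
| "ccost (NAssign i a) = 1 + necost a"
| "ccost (NStore a b) = 1 + necost a + necost b"
| "ccost (RAssign i x) = 1 + recost x"
| "ccost (RStore a x) = 1 + necost a + recost x"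
| "ccost (Seq c d) = ccost c + ccost d"
| "ccost (If b c d) = becost b + ccost c + ccost d"
| "ccost (While b c) = becost b + ccost c"

definition bnd :: "nat \<Rightarrow> ram \<Rightarrow> bool" where
  "bnd l \<sigma> \<longleftrightarrow> (\<forall>i. nreg \<sigma> i \<le> 2 ^ l) \<and> (\<forall>a. nmem \<sigma> a \<le> 2 ^ l)"

lemma vexp_pos: "0 < vexp e"
  by (induction e) auto

lemma nval_le: "bnd l \<sigma> \<Longrightarrow> nval e \<sigma> \<le> 2 ^ (Suc l * vexp e)"
proof (induction e)
  case (NConst n)
  have "n \<le> 2 ^ n" by (simp add: less_imp_le)
  also have "\<dots> \<le> 2 ^ (Suc l * Suc n)" by (rule power_increasing) auto
  finally show ?case by simp
next
  case (NReg i)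
  then show ?case using le_trans[of _ "2 ^ l" "2 ^ Suc l"] by (simp add: bnd_def del: power_Suc)
next
  case (NLoad a)
  then show ?case using le_trans[of _ "2 ^ l" "2 ^ Suc l"] by (simp add: bnd_def del: power_Suc)
next
  case (Plus a b)
  \<comment> \<open>\<open>Suc l\<close> instead of \<open>l\<close> in the exponent makes every
    bound at least 2. Then a sum is at most the product, so exponents add for \<open>Plus\<close>
    just as for \<open>Times\<close>.\<close>
  have two: "(2::nat) \<le> 2 ^ (Suc l * vexp e)" for e
    using vexp_pos[of e] power_increasing[of 1 "Suc l * vexp e" "2::nat"] by simp
  have add: "x + y \<le> x * y" if "2 \<le> x" "2 \<le> y" for x y :: nat
  proof -
    have "x * 2 \<le> x * y" "2 * y \<le> x * y" using that by auto
    then show ?thesis by linarith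
  qed
  have "nval (Plus a b) \<sigma> \<le> 2 ^ (Suc l * vexp a) + 2 ^ (Suc l * vexp b)"
    using Plus by (simp add: add_mono)
  also have "\<dots> \<le> 2 ^ (Suc l * vexp a) * 2 ^ (Suc l * vexp b)" by (rule add[OF two two])
  finally show ?case by (simp add: power_add[symmetric] distrib_left add_ac)
next
  case (Minus a b)
  then show ?case using diff_le_self le_trans by (metis nval.simps(5) vexp.simps(5))
next
  case (Times a b)
  then have "nval (Times a b) \<sigma> \<le> 2 ^ (Suc l * vexp a) * 2 ^ (Suc l * vexp b)"
    by (simp add: mult_mono)
  then show ?case by (simp add: power_add[symmetric] distrib_left add_ac)
next
  case (Divide a b)
  then show ?case using div_le_dividend le_trans by (metis nval.simps(7) vexp.simps(7))
qed

lemma size_cost_le: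
  assumes "n \<le> 2 ^ (Suc l * v)"
  shows "size_cost n \<le> (v + 2) * Suc l"
proof -
  have "floorlog 2 n \<le> floorlog 2 (2 ^ (Suc l * v))"
    by (rule floorlog_mono[OF assms])
  also have "floorlog 2 (2 ^ u) = Suc u" for u :: nat
    by (simp add: floorlog_def)
  finally show ?thesis by (simp add: size_cost_def algebra_simps)
qed

lemma ncost_le:
  assumes "bnd l \<sigma>"
  shows "ncost e \<sigma> \<le> necost e * Suc l"
proof -
  have sz: "size_cost (nval e \<sigma>) \<le> (vexp e + 2) * Suc l" for e
    by (rule size_cost_le[OF nval_le[OF assms]])
  show ?thesis
  proof (induction e)
    case (NConst n)
    show ?case using sz[of "NConst n"] by simp
  next
    case (NReg i)
    show ?case using sz[of "NReg i"] by simp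
  next
    case (NLoad a)
    then show ?case using sz[of "NLoad a"] by (simp add: algebra_simps)
  next
    case (Plus a b)
    then show ?case using sz[of "Plus a b"] by (simp add: algebra_simps)
  next
    case (Minus a b)
    then show ?case using sz[of "Minus a b"] by (simp add: algebra_simps)
  next
    case (Times a b)
    then show ?case using sz[of "Times a b"] by (simp add: algebra_simps)
  next
    case (Divide a b)
    then show ?case using sz[of "Divide a b"] by (simp add: algebra_simps)
  qed
qed

lemma rcost_le: "bnd l \<sigma> \<Longrightarrow> rcost x \<sigma> \<le> recost x * Suc l"
proof (cases x)
  case (RLoad a)
  then show "bnd l \<sigma> \<Longrightarrow> ?thesis" using ncost_le[of l \<sigma> a] by simp
qed simp

lemma bcost_le:
  assumes "bnd l \<sigma>"
  shows "bcost b \<sigma> \<le> becost b * Suc l"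
proof (induction b)
  case (NLess a b)
  then show ?case using ncost_le[OF assms, of a] ncost_le[OF assms, of b] by (simp add: algebra_simps)
next
  case (NEq a b)
  then show ?case using ncost_le[OF assms, of a] ncost_le[OF assms, of b] by (simp add: algebra_simps)
next
  case (RLess a b)
  then show ?case using rcost_le[OF assms, of a] rcost_le[OF assms, of b] by (simp add: algebra_simps)
qed (auto simp: algebra_simps)

text \<open>Both memories are organised as arrays: cell \<open>(k, a)\<close> of array \<open>v\<close> of block \<open>i\<close> has the following
  address, whose bit length is linear in those of the indices.\<close>

definition addr :: "nat \<Rightarrow> nat \<Rightarrow> nat \<Rightarrow> nat \<Rightarrow> nat" where
  "addr v i k a = prod_encode (prod_encode (v, i), prod_encode (k, a))"

lemma addr_inject [simp]:
  "addr v i k a = addr v' i' k' a' \<longleftrightarrow> v = v' \<and> i = i' \<and> k = k' \<and> a = a'"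
  by (auto simp: addr_def prod_encode_eq)

text \<open>The Cantor pairing, written so that it agrees with \<open>prod_encode\<close>. Its value
  is quadratic in the arguments, so its bit length is linear in theirs.\<close>

definition pair_exp :: "nexp \<Rightarrow> nexp \<Rightarrow> nexp" where
  "pair_exp a b =
     Plus (Divide (Times (Plus a b) (Plus (Plus a b) (NConst 1))) (NConst 2)) a"

lemma nval_pair_exp [simp]: "nval (pair_exp a b) \<sigma> = prod_encode (nval a \<sigma>, nval b \<sigma>)"
  by (simp add: pair_exp_def prod_encode_def triangle_def)

definition adr :: "nat \<Rightarrow> nexp \<Rightarrow> nexp \<Rightarrow> nexp \<Rightarrow> nexp" where
  "adr v i k a = pair_exp (pair_exp (NConst v) i) (pair_exp k a)"

lemma nval_adr [simp]: "nval (adr v i k a) \<sigma> = addr v (nval i \<sigma>) (nval k \<sigma>) (nval a \<sigma>)"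
  by (simp add: adr_def addr_def)

text \<open>Injectivity here is syntactic: the array number can be read off the address expression,
  on which \<open>ids\<close> and \<open>in_block\<close> rely.\<close>

lemma adr_inject [simp]:
  "adr v i k a = adr v' i' k' a' \<longleftrightarrow> v = v' \<and> i = i' \<and> k = k' \<and> a = a'"
  by (auto simp: adr_def pair_exp_def)

text \<open>Values that are merely copied or decreased remain bounded; only sums and products have to be checked.\<close>

fun safe :: "nat \<Rightarrow> nexp \<Rightarrow> ram \<Rightarrow> bool" where
  "safe l (NConst n) \<sigma> \<longleftrightarrow> n \<le> 2 ^ l"
| "safe l (NReg i) \<sigma> \<longleftrightarrow> True"
| "safe l (NLoad a) \<sigma> \<longleftrightarrow> True"
| "safe l (Minus a b) \<sigma> \<longleftrightarrow> safe l a \<sigma>"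
| "safe l (Divide a b) \<sigma> \<longleftrightarrow> safe l a \<sigma>"
| "safe l a \<sigma> \<longleftrightarrow> nval a \<sigma> \<le> 2 ^ l"

lemma safe_nval: "bnd l \<sigma> \<Longrightarrow> safe l a \<sigma> \<Longrightarrow> nval a \<sigma> \<le> 2 ^ l"
proof (induction l a \<sigma> rule: safe.induct)
  case (4 l a b \<sigma>)
  then show ?case using diff_le_self le_trans by (metis nval.simps(5) safe.simps(4))
next
  case (5 l a b \<sigma>)
  then show ?case using div_le_dividend le_trans by (metis nval.simps(7) safe.simps(5))
qed (auto simp: bnd_def)

section \<open>Frame conditions read off the syntax of programs\<close>

fun nwr :: "com \<Rightarrow> nat set" where
  "nwr (NAssign i a) = {i}"
| "nwr (Seq c d) = nwr c \<union> nwr d"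
| "nwr (If b c d) = nwr c \<union> nwr d"
| "nwr (While b c) = nwr c"
| "nwr c = {}"

fun rwr :: "com \<Rightarrow> nat set" where
  "rwr (RAssign i a) = {i}"
| "rwr (Seq c d) = rwr c \<union> rwr d"
| "rwr (If b c d) = rwr c \<union> rwr d"
| "rwr (While b c) = rwr c"
| "rwr c = {}"

text \<open>An address expression of any other shape counts as touching every array, so the frame
  condition is sound for all programs.\<close>

definition ids :: "nexp \<Rightarrow> nat set" where
  "ids a = {v. (\<exists>i k x. a = adr v i k x) \<or> \<not> (\<exists>v i k x. a = adr v i k x)}"

lemma ids_adr [simp]: "ids (adr v i k x) = {v}"
  by (auto simp: ids_def)

fun nst :: "com \<Rightarrow> nat set" where
  "nst (NStore a e) = ids a"
| "nst (Seq c d) = nst c \<union> nst d"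
| "nst (If b c d) = nst c \<union> nst d"
| "nst (While b c) = nst c"
| "nst c = {}"

fun rst :: "com \<Rightarrow> nat set" where
  "rst (RStore a e) = ids a"
| "rst (Seq c d) = rst c \<union> rst d"
| "rst (If b c d) = rst c \<union> rst d"
| "rst (While b c) = rst c"
| "rst c = {}"

text \<open>Register 6 holds the number of the block that is worked on.\<close>

definition in_block :: "nexp \<Rightarrow> bool" where
  "in_block a \<longleftrightarrow> (\<exists>v k x. a = adr v (NReg 6) k x)"

lemma in_block_adr [simp]: "in_block (adr v i k x) \<longleftrightarrow> i = NReg 6"
  by (auto simp: in_block_def)

fun local :: "com \<Rightarrow> bool" where
  "local (NAssign i a) \<longleftrightarrow> i \<noteq> 6"
| "local (NStore a e) \<longleftrightarrow> in_block a"
| "local (RStore a e) \<longleftrightarrow> in_block a"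
| "local (Seq c d) \<longleftrightarrow> local c \<and> local d"
| "local (If b c d) \<longleftrightarrow> local c \<and> local d"
| "local (While b c) \<longleftrightarrow> local c"
| "local c \<longleftrightarrow> True"

definition unch :: "com \<Rightarrow> ram \<Rightarrow> ram \<Rightarrow> bool" where
  "unch c \<sigma> \<sigma>' \<longleftrightarrow> (\<forall>i. i \<notin> nwr c \<longrightarrow> nreg \<sigma>' i = nreg \<sigma> i) \<and> (\<forall>i. i \<notin> rwr c \<longrightarrow> rreg \<sigma>' i = rreg \<sigma> i) \<and>
    (\<forall>v i k a. v \<notin> nst c \<or> local c \<and> i \<noteq> nreg \<sigma> 6 \<longrightarrow> nmem \<sigma>' (addr v i k a) = nmem \<sigma> (addr v i k a)) \<and>
    (\<forall>v i k a. v \<notin> rst c \<or> local c \<and> i \<noteq> nreg \<sigma> 6 \<longrightarrow> rmem \<sigma>' (addr v i k a) = rmem \<sigma> (addr v i k a))"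

lemma local_nwr: "local c \<Longrightarrow> 6 \<notin> nwr c"
  by (induction c) auto

lemma unch_refl: "unch c \<sigma> \<sigma>"
  by (simp add: unch_def)

text \<open>Locality refers to the block number in the initial state; \<open>local_nwr\<close> keeps
  register 6 fixed, so both halves speak of the same block.\<close>

lemma unch_trans: "unch c \<sigma> \<sigma>' \<Longrightarrow> unch c \<sigma>' \<sigma>'' \<Longrightarrow> unch c \<sigma> \<sigma>''"
  unfolding unch_def by (metis local_nwr)

lemma unch_mono:
  "unch c \<sigma> \<sigma>' \<Longrightarrow> nwr c \<subseteq> nwr d \<Longrightarrow> rwr c \<subseteq> rwr d \<Longrightarrow> nst c \<subseteq> nst d \<Longrightarrow> rst c \<subseteq> rst d \<Longrightarrow>
    (local d \<longrightarrow> local c) \<Longrightarrow> unch d \<sigma> \<sigma>'"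
  unfolding unch_def by blast

lemma addr_frame:
  assumes "v \<notin> ids a \<or> in_block a \<and> i \<noteq> nreg \<sigma> 6"
  shows "addr v i k x \<noteq> nval a \<sigma>"
  using assms by (auto simp: ids_def in_block_def)

lemma exec_unch: "exec c \<sigma> t \<sigma>' \<Longrightarrow> unch c \<sigma> \<sigma>'"
proof (induction rule: exec.induct)
  case (NStore a b \<sigma>)
  then show ?case using addr_frame[of _ a _ \<sigma>] by (simp add: unch_def)
next
  case (RStore a b \<sigma>)
  then show ?case using addr_frame[of _ a _ \<sigma>] by (simp add: unch_def)
next
  case (Seq c \<sigma> t \<sigma>' d u \<sigma>'')
  have "unch (Seq c d) \<sigma> \<sigma>'" "unch (Seq c d) \<sigma>' \<sigma>''"
    using Seq.IH by (auto elim!: unch_mono)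
  then show ?case by (rule unch_trans)
next
  case (WhileTrue b \<sigma> c t \<sigma>' u \<sigma>'')
  have "unch (While b c) \<sigma> \<sigma>'" using WhileTrue.IH(1) by (auto elim!: unch_mono)
  then show ?case using WhileTrue.IH(2) by (rule unch_trans)
qed (auto simp: unch_def)

text \<open>Loops multiply the iteration bound \<open>B\<close>, whereas sequencing only adds up the program sizes
  \<^const>\<open>ccost\<close>. So the cost of a program of fixed size is governed by a product of loop bounds.\<close>

definition ok :: "nat \<Rightarrow> nat \<Rightarrow> com \<Rightarrow> ram \<Rightarrow> (ram \<Rightarrow> bool) \<Rightarrow> bool" where
  "ok l B c \<sigma> Q \<longleftrightarrow> (bnd l \<sigma> \<longrightarrow> 0 < B \<longrightarrow>
     (\<exists>t \<sigma>'. exec c \<sigma> t \<sigma>' \<and> t \<le> ccost c * B * Suc l \<and> bnd l \<sigma>' \<and> Q \<sigma>'))"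

section \<open>Rules for correctness together with cost\<close>

lemma ok_prim:
  assumes "bnd l \<sigma> \<Longrightarrow> \<exists>t \<sigma>'. exec c \<sigma> t \<sigma>' \<and> t \<le> ccost c * Suc l \<and> bnd l \<sigma>' \<and> Q \<sigma>'"
  shows "ok l B c \<sigma> Q"
  unfolding ok_def
proof (intro impI)
  assume "bnd l \<sigma>" "0 < B"
  then obtain t \<sigma>' where *: "exec c \<sigma> t \<sigma>'" "t \<le> ccost c * Suc l" "bnd l \<sigma>'" "Q \<sigma>'"
    using assms by blast
  have "ccost c * 1 * Suc l \<le> ccost c * B * Suc l"
    using \<open>0 < B\<close> by (intro mult_le_mono) auto
  with * show "\<exists>t \<sigma>'. exec c \<sigma> t \<sigma>' \<and> t \<le> ccost c * B * Suc l \<and> bnd l \<sigma>' \<and> Q \<sigma>'"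
    by (metis le_trans mult.right_neutral)
qed

lemma ok_Skip: "Q \<sigma> \<Longrightarrow> ok l B Skip \<sigma> Q"
  by (rule ok_prim) (intro exI[of _ 1] exI[of _ \<sigma>] conjI exec.Skip, simp_all)

lemma ok_atomic:
  assumes "exec c \<sigma> t \<sigma>'" "bnd l \<sigma> \<Longrightarrow> t \<le> ccost c * Suc l" "bnd l \<sigma> \<Longrightarrow> bnd l \<sigma>'" "Q \<sigma>'"
  shows "ok l B c \<sigma> Q"
  by (rule ok_prim) (use assms in blast)

lemma ok_NAssign:
  assumes "safe l a \<sigma>" "Q (\<sigma>\<lparr>nreg := (nreg \<sigma>)(i := nval a \<sigma>)\<rparr>)"
  shows "ok l B (NAssign i a) \<sigma> Q"
  by (rule ok_atomic[OF exec.NAssign])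
    (use assms ncost_le[of l \<sigma> a] safe_nval[of l \<sigma> a] in \<open>auto simp: bnd_def\<close>)

lemma ok_NStore:
  assumes "safe l e \<sigma>" "Q (\<sigma>\<lparr>nmem := (nmem \<sigma>)(nval a \<sigma> := nval e \<sigma>)\<rparr>)"
  shows "ok l B (NStore a e) \<sigma> Q"
  by (rule ok_atomic[OF exec.NStore])
    (use assms ncost_le[of l \<sigma> a] ncost_le[of l \<sigma> e] safe_nval[of l \<sigma> e] in
      \<open>auto simp: bnd_def add_mult_distrib\<close>)

lemma ok_RAssign:
  assumes "Q (\<sigma>\<lparr>rreg := (rreg \<sigma>)(i := rval x \<sigma>)\<rparr>)"
  shows "ok l B (RAssign i x) \<sigma> Q"
  by (rule ok_atomic[OF exec.RAssign]) (use assms rcost_le[of l \<sigma> x] in \<open>auto simp: bnd_def\<close>)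

lemma ok_RStore:
  assumes "Q (\<sigma>\<lparr>rmem := (rmem \<sigma>)(nval a \<sigma> := rval x \<sigma>)\<rparr>)"
  shows "ok l B (RStore a x) \<sigma> Q"
  by (rule ok_atomic[OF exec.RStore])
    (use assms ncost_le[of l \<sigma> a] rcost_le[of l \<sigma> x] in \<open>auto simp: bnd_def add_mult_distrib\<close>)

lemma ok_Seq:
  assumes "ok l B c \<sigma> (\<lambda>\<sigma>'. ok l B d \<sigma>' Q)"
  shows "ok l B (Seq c d) \<sigma> Q"
  unfolding ok_def
proof (intro impI)
  assume "bnd l \<sigma>" "0 < B"
  then obtain t \<sigma>' u \<sigma>'' where "exec c \<sigma> t \<sigma>'" "t \<le> ccost c * B * Suc l" "exec d \<sigma>' u \<sigma>''"
    "u \<le> ccost d * B * Suc l" "bnd l \<sigma>''" "Q \<sigma>''"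
    using assms unfolding ok_def by metis
  then show "\<exists>t \<sigma>'. exec (Seq c d) \<sigma> t \<sigma>' \<and> t \<le> ccost (Seq c d) * B * Suc l \<and> bnd l \<sigma>' \<and> Q \<sigma>'"
    by (intro exI[of _ "t + u"] exI[of _ \<sigma>'']) (auto intro: exec.Seq simp: add_mult_distrib)
qed

lemma bcost_bound: "bnd l \<sigma> \<Longrightarrow> 0 < B \<Longrightarrow> bcost b \<sigma> \<le> becost b * B * Suc l"
proof -
  assume b: "bnd l \<sigma>" and B: "0 < B"
  have "bcost b \<sigma> \<le> becost b * 1 * Suc l" using bcost_le[OF b, of b] by simp
  also have "\<dots> \<le> becost b * B * Suc l" using B by (intro mult_le_mono) auto
  finally show ?thesis .
qed

lemma ok_If:
  assumes "bval b \<sigma> \<Longrightarrow> ok l B c \<sigma> Q" "\<not> bval b \<sigma> \<Longrightarrow> ok l B d \<sigma> Q"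
  shows "ok l B (If b c d) \<sigma> Q"
  unfolding ok_def
proof (intro impI)
  assume *: "bnd l \<sigma>" "0 < B"
  note bc = bcost_bound[OF *, of b]
  show "\<exists>t \<sigma>'. exec (If b c d) \<sigma> t \<sigma>' \<and> t \<le> ccost (If b c d) * B * Suc l \<and> bnd l \<sigma>' \<and> Q \<sigma>'"
  proof (cases "bval b \<sigma>")
    case True
    then obtain t \<sigma>' where "exec c \<sigma> t \<sigma>'" "t \<le> ccost c * B * Suc l" "bnd l \<sigma>'" "Q \<sigma>'"
      using assms(1) * unfolding ok_def by metis
    moreover from this have "bcost b \<sigma> + t \<le> ccost (If b c d) * B * Suc l"
      using bc by (simp add: add_mult_distrib)
    ultimately show ?thesis using True exec.IfTrue by blast
  next
    case False
    then obtain t \<sigma>' where "exec d \<sigma> t \<sigma>'" "t \<le> ccost d * B * Suc l" "bnd l \<sigma>'" "Q \<sigma>'"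
      using assms(2) * unfolding ok_def by metis
    moreover from this have "bcost b \<sigma> + t \<le> ccost (If b c d) * B * Suc l"
      using bc by (simp add: add_mult_distrib)
    ultimately show ?thesis using False exec.IfFalse by blast
  qed
qed

text \<open>This rule also delivers the frame condition of the program, so a specification has to
  mention only what changes.\<close>

lemma ok_conseq:
  assumes "ok l B' c \<sigma> Q'" "0 < B'" "B' \<le> B" "\<And>\<sigma>'. Q' \<sigma>' \<Longrightarrow> unch c \<sigma> \<sigma>' \<Longrightarrow> Q \<sigma>'"
  shows "ok l B c \<sigma> Q"
  unfolding ok_def
proof (intro impI)
  assume "bnd l \<sigma>" "0 < B"
  then obtain t \<sigma>' where *: "exec c \<sigma> t \<sigma>'" "t \<le> ccost c * B' * Suc l" "bnd l \<sigma>'" "Q' \<sigma>'"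
    using assms(1,2) unfolding ok_def by metis
  have "ccost c * B' * Suc l \<le> ccost c * B * Suc l"
    using assms(3) by (intro mult_le_mono) auto
  with * have "t \<le> ccost c * B * Suc l" by linarith
  with * assms(4)[OF *(4) exec_unch[OF *(1)]]
  show "\<exists>t \<sigma>'. exec c \<sigma> t \<sigma>' \<and> t \<le> ccost c * B * Suc l \<and> bnd l \<sigma>' \<and> Q \<sigma>'" by blast
qed

text \<open>The number \<open>n\<close> of remaining iterations is part of the invariant and drops
  by exactly one, so a loop multiplies the budget \<open>B'\<close> of its body by at most
  \<open>Suc n\<close>, the extra one paying for the final test. Frame conditions relate each
  iteration to the state before the loop.\<close>

lemma ok_While:
  assumes init: "I n \<sigma>"
    and body: "\<And>n \<sigma>'. I n \<sigma>' \<Longrightarrow> unch (While b c) \<sigma> \<sigma>' \<Longrightarrow> bval b \<sigma>' \<Longrightarrow>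
      \<exists>n'. n = Suc n' \<and> ok l B' c \<sigma>' (I n')"
    and exit: "\<And>n \<sigma>'. I n \<sigma>' \<Longrightarrow> unch (While b c) \<sigma> \<sigma>' \<Longrightarrow> \<not> bval b \<sigma>' \<Longrightarrow> Q \<sigma>'"
    and B: "0 < B'" "Suc n * B' \<le> B"
  shows "ok l B (While b c) \<sigma> Q"
  unfolding ok_def
proof (intro impI)
  assume bnd: "bnd l \<sigma>"
  have "I n \<sigma>' \<Longrightarrow> unch (While b c) \<sigma> \<sigma>' \<Longrightarrow> bnd l \<sigma>' \<Longrightarrow> \<exists>t \<sigma>''. exec (While b c) \<sigma>' t \<sigma>'' \<and>
      t \<le> ccost (While b c) * (Suc n * B') * Suc l \<and> bnd l \<sigma>'' \<and> Q \<sigma>''" for \<sigma>'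
  proof (induction n arbitrary: \<sigma>')
    case 0
    then have nb: "\<not> bval b \<sigma>'" using body by blast
    have "bcost b \<sigma>' \<le> ccost (While b c) * (Suc 0 * B') * Suc l"
      using bcost_bound[OF 0(3) B(1), of b] by (simp add: add_mult_distrib)
    then show ?case using exec.WhileFalse[OF nb] exit[OF 0(1,2) nb] 0(3) by blast
  next
    case (Suc n)
    show ?case
    proof (cases "bval b \<sigma>'")
      case False
      have "bcost b \<sigma>' \<le> ccost (While b c) * (Suc (Suc n) * B') * Suc l"
        by (rule le_trans[OF bcost_bound[OF Suc.prems(3) B(1), of b]], intro mult_le_mono) auto
      then show ?thesis using exec.WhileFalse[OF False] exit[OF Suc.prems(1,2) False] Suc.prems(3) by blast
    next
      case True
      then have "ok l B' c \<sigma>' (I n)" using body[OF Suc.prems(1,2)] by auto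
      then obtain t \<sigma>1 where 1: "exec c \<sigma>' t \<sigma>1" "t \<le> ccost c * B' * Suc l" "bnd l \<sigma>1" "I n \<sigma>1"
        using Suc.prems(3) B(1) unfolding ok_def by blast
      have "unch (While b c) \<sigma>' \<sigma>1" using exec_unch[OF 1(1)] by (auto elim!: unch_mono)
      then have "unch (While b c) \<sigma> \<sigma>1" using Suc.prems(2) unch_trans by blast
      then obtain u \<sigma>2 where 2: "exec (While b c) \<sigma>1 u \<sigma>2"
        "u \<le> ccost (While b c) * (Suc n * B') * Suc l" "bnd l \<sigma>2" "Q \<sigma>2"
        using Suc.IH[OF 1(4) _ 1(3)] by blast
      have "bcost b \<sigma>' + t + u \<le> ccost (While b c) * (Suc (Suc n) * B') * Suc l"
        using bcost_bound[OF Suc.prems(3) B(1), of b] 1(2) 2(2) by (simp add: algebra_simps)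
      then show ?thesis using exec.WhileTrue[OF True 1(1) 2(1)] 2(3,4) by blast
    qed
  qed
  then obtain t \<sigma>'' where *: "exec (While b c) \<sigma> t \<sigma>''"
      "t \<le> ccost (While b c) * (Suc n * B') * Suc l" "bnd l \<sigma>''" "Q \<sigma>''"
    using init unch_refl bnd by blast
  have "ccost (While b c) * (Suc n * B') * Suc l \<le> ccost (While b c) * B * Suc l"
    using B(2) by (intro mult_le_mono) auto
  with * show "\<exists>t \<sigma>'. exec (While b c) \<sigma> t \<sigma>' \<and> t \<le> ccost (While b c) * B * Suc l \<and> bnd l \<sigma>' \<and> Q \<sigma>'"
    using le_trans by blast
qed

section \<open>The greedy schedule inside a block\<close>

definition rest :: "(nat \<Rightarrow> real) \<Rightarrow> (nat \<Rightarrow> real) \<Rightarrow> nat \<Rightarrow> nat \<Rightarrow> real \<times> real \<times> nat \<Rightarrow> real \<times> real \<times> nat" where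
  "rest s f m j st = foldl step st (map (\<lambda>i. (s i, f i)) [j..<m])"

text \<open>The index \<open>m\<close> is an absorbing end marker, so that \<open>nxt\<close> can be
  iterated without side conditions.\<close>

definition nxt :: "(nat \<Rightarrow> real) \<Rightarrow> (nat \<Rightarrow> real) \<Rightarrow> nat \<Rightarrow> nat \<Rightarrow> nat" where
  "nxt s f m j = (if j < m then LEAST i. j < i \<and> (m \<le> i \<or> f j \<le> s i) else m)"

lemma step_count: "step (A, B, c + c') x = (let (A', B', d) = step (A, B, c) x in (A', B', d + c'))"
  by (cases x) auto

text \<open>The counter does not influence the decisions. Hence results can be tabulated for the
  initial counter 0 and added to any other counter later.\<close>

lemma foldl_step_count:
  "foldl step (A, B, c + c') xs = (let (A', B', d) = foldl step (A, B, c) xs in (A', B', d + c'))"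
proof (induction xs arbitrary: A B c)
  case (Cons x xs)
  obtain A' B' d where "step (A, B, c) x = (A', B', d)" by (cases "step (A, B, c) x")
  then show ?case by (simp add: step_count[of A B c c'] Cons)
qed simp

lemma foldl_step_le: "snd (snd (foldl step (A, B, c) xs)) \<le> c + length xs"
proof (induction xs arbitrary: A B c)
  case (Cons x xs)
  obtain s f where x: "x = (s, f)" by force
  show ?case
    using Cons.IH[of f B "Suc c"] Cons.IH[of f A "Suc c"] Cons.IH[of A B c] by (simp add: x)
qed simp

lemma foldl_step_ge: "c \<le> snd (snd (foldl step (A, B, c) xs))"
  using foldl_step_count[of A B 0 c xs] by (auto split: prod.splits)

lemma rest_count: "rest s f m j (A, B, 0) = (A', B', d) \<Longrightarrow> rest s f m j (A, B, c) = (A', B', c + d)"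
  using foldl_step_count[of A B 0 c] by (simp add: rest_def add.commute)

lemma rest_le: "snd (snd (rest s f m j (A, B, c))) \<le> c + (m - j)"
  using foldl_step_le[of A B c "map (\<lambda>i. (s i, f i)) [j..<m]"] by (simp add: rest_def)

text \<open>Together with \<open>rest_le\<close> this bounds intermediate counters, and hence the
  number of rounds already passed, by the length of the block.\<close>

lemma rest_ge: "c \<le> snd (snd (rest s f m j (A, B, c)))"
  by (simp add: rest_def foldl_step_ge)

lemma rest_step: "j < m \<Longrightarrow> rest s f m j st = rest s f m (Suc j) (step st (s j, f j))"
  by (simp add: rest_def upt_conv_Cons)

lemma rest_skip:
  assumes "j \<le> k" "k \<le> m" "B \<le> A" "\<And>i. j \<le> i \<Longrightarrow> i < k \<Longrightarrow> s i < B"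
  shows "rest s f m j (A, B, c) = rest s f m k (A, B, c)"
  using assms
proof (induction k rule: dec_induct)
  case (step k)
  then have "s k < B" "rest s f m j (A, B, c) = rest s f m k (A, B, c)" by auto
  moreover have "rest s f m k (A, B, c) = rest s f m (Suc k) (A, B, c)"
    using step.prems \<open>s k < B\<close> by (simp add: rest_step)
  ultimately show ?case by simp
qed simp

lemma rest_end: "rest s f m m st = st"
  by (simp add: rest_def)

lemma nxt_gt: "j < m \<Longrightarrow> j < nxt s f m j"
  and nxt_le: "nxt s f m j \<le> m"
  and nxt_ge: "nxt s f m j < m \<Longrightarrow> f j \<le> s (nxt s f m j)"
  and nxt_between: "j < i \<Longrightarrow> i < nxt s f m j \<Longrightarrow> s i < f j"
proof -
  have *: "j < m \<Longrightarrow> j < nxt s f m j \<and> (m \<le> nxt s f m j \<or> f j \<le> s (nxt s f m j))"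
    unfolding nxt_def by (simp, rule LeastI_ex) blast
  then show "j < m \<Longrightarrow> j < nxt s f m j" by blast
  show le: "nxt s f m j \<le> m" unfolding nxt_def by (auto intro: Least_le)
  show "nxt s f m j < m \<Longrightarrow> f j \<le> s (nxt s f m j)"
    using * by (cases "j < m") (auto simp: nxt_def)
  assume i: "j < i" "i < nxt s f m j"
  then have "j < m" "i < m" using le by auto
  then have "\<not> (j < i \<and> (m \<le> i \<or> f j \<le> s i))"
    using i by (intro not_less_Least) (simp add: nxt_def)
  with i \<open>i < m\<close> show "s i < f j" by auto
qed

lemma nxt_m [simp]: "nxt s f m m = m"
  by (simp add: nxt_def)

lemma nxt_eqI:
  assumes "j < i" "i \<le> m" "\<And>k. j < k \<Longrightarrow> k < i \<Longrightarrow> s k < f j" "i < m \<Longrightarrow> f j \<le> s i"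
  shows "nxt s f m j = i"
proof -
  have "\<not> i < nxt s f m j"
    using assms nxt_between[of j i s f m] nxt_le[of s f m j] by fastforce
  moreover have "\<not> nxt s f m j < i"
    using assms nxt_gt[of j m s f] nxt_ge[of s f m j] by fastforce
  ultimately show ?thesis by simp
qed

section \<open>Iterated jumps towards the end of a block\<close>

locale jumps =
  fixes g :: "nat \<Rightarrow> nat" and m :: nat
  assumes gt: "i < m \<Longrightarrow> i < g i" and le: "g i \<le> m" and fixed: "g m = m"
begin

lemma iter_le: "a \<le> m \<Longrightarrow> (g ^^ n) a \<le> m"
  by (cases n) (auto simp: le)

lemma iter_end: "(g ^^ n) m = m"
  by (induction n) (auto simp: fixed)

lemma iter_ge: "a \<le> m \<Longrightarrow> min m (a + n) \<le> (g ^^ n) a"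
proof (induction n)
  case (Suc n)
  then have *: "min m (a + n) \<le> (g ^^ n) a" by simp
  show ?case
  proof (cases "(g ^^ n) a < m")
    case True
    then show ?thesis using * gt[OF True] by simp
  next
    case False
    then have "(g ^^ n) a = m" using iter_le[OF Suc.prems, of n] by simp
    then show ?thesis by (simp add: fixed)
  qed
qed simp

lemma iter_mono: "n \<le> n' \<Longrightarrow> a \<le> m \<Longrightarrow> (g ^^ n) a \<le> (g ^^ n') a"
proof (induction n' rule: dec_induct)
  case (step n')
  have "(g ^^ n') a \<le> g ((g ^^ n') a)"
    using iter_le[OF step.prems, of n'] gt[of "(g ^^ n') a"] fixed by (cases "(g ^^ n') a = m") auto
  then show ?case using step by simp
qed simp

end

lemma jumps_Suc: "jumps (\<lambda>i. min m (Suc i)) m"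
  by unfold_locales auto

lemma jumps_nxt: "jumps (nxt s f m) m"
  by unfold_locales (auto simp: nxt_gt nxt_le)

lemma min_Suc_iter: "((\<lambda>i. min m (Suc i)) ^^ n) a = (if n = 0 then a else min m (a + n))"
  by (induction n) auto

section \<open>Phases of the greedy schedule on sorted intervals\<close>

locale block =
  fixes s f :: "nat \<Rightarrow> real" and m :: nat
  assumes incr: "i < j \<Longrightarrow> j < m \<Longrightarrow> f i < f j"
begin

abbreviation "N \<equiv> nxt s f m"
abbreviation "G \<equiv> rest s f m"

sublocale jumps N m
  by (rule jumps_nxt)

text \<open>If \<open>N j\<close> came before \<open>N i\<close> for \<open>i < j\<close>, it would
  lie between \<open>i\<close> and \<open>N i\<close> and so start before \<open>f i\<close>; but it
  does not start before \<open>f j\<close>, which is larger.\<close>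

lemma nxt_mono: "i \<le> j \<Longrightarrow> j \<le> m \<Longrightarrow> N i \<le> N j"
proof (cases "i < j \<and> j < m")
  case True
  assume "i \<le> j" "j \<le> m"
  show ?thesis
  proof (rule ccontr)
    assume "\<not> N i \<le> N j"
    then have "N j < N i" "N j < m" using nxt_le[of s f m i] by auto
    moreover have "i < N j" using nxt_gt[of j m s f] True by simp
    ultimately have "s (N j) < f i" "f j \<le> s (N j)" using nxt_between nxt_ge by blast+
    then show False using incr[of i j] True by simp
  qed
next
  case False
  assume "i \<le> j" "j \<le> m"
  with False have "i = j \<or> j = m" by auto
  then show ?thesis using nxt_le[of s f m i] by auto
qed

lemma nxt_iter_mono: "i \<le> j \<Longrightarrow> j \<le> m \<Longrightarrow> (N ^^ n) i \<le> (N ^^ n) j"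
  by (induction n) (auto intro: nxt_mono iter_le)

text \<open>The point where the machine that is free from \<open>b\<close> on takes over.\<close>

definition crossed :: "nat \<Rightarrow> real \<Rightarrow> bool" where
  "crossed a b \<longleftrightarrow> (\<exists>i. a < i \<and> i < N a \<and> b \<le> s i)"

text \<open>As long as nothing is crossed, the intervals between \<open>x\<close> and
  \<open>N x\<close> start before \<open>b\<close>, the smaller of the two finishing times, and are
  discarded; \<open>N x\<close> does not start before \<open>f x\<close> and extends the machine of
  \<open>x\<close>.\<close>

lemma rest_follow:
  assumes "a < m" "b \<le> f a" "(N ^^ n) a < m" "\<And>t. t < n \<Longrightarrow> \<not> crossed ((N ^^ t) a) b"
  shows "G (Suc a) (f a, b, c) = G (Suc ((N ^^ n) a)) (f ((N ^^ n) a), b, c + n)"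
  using assms
proof (induction n)
  case (Suc n)
  define x where "x = (N ^^ n) a"
  have N: "N x < m" using Suc.prems by (simp add: x_def)
  then have xm: "x < m" using nxt_gt[of x m s f] nxt_m[of s f m] iter_le[of a n] Suc.prems(1)
    by (cases "x = m") (auto simp: x_def)
  have IH: "G (Suc a) (f a, b, c) = G (Suc x) (f x, b, c + n)"
    using Suc xm by (auto simp: x_def)
  have "a \<le> x" using iter_mono[of 0 n a] Suc.prems by (simp add: x_def)
  then have b: "b \<le> f x" using incr[of a x] xm Suc.prems(2) by (cases "a = x") auto
  have *: "s i < b" if "x < i" "i < N x" for i
    using Suc.prems(4)[of n] that by (fastforce simp: x_def crossed_def)
  have "G (Suc x) (f x, b, c + n) = G (N x) (f x, b, c + n)"
    using nxt_gt[OF xm, of s f] N b * by (intro rest_skip) auto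
  also have "\<dots> = G (Suc (N x)) (f (N x), b, Suc (c + n))"
    using N nxt_ge[of s f m x] by (simp add: rest_step)
  finally show ?case using IH by (simp add: x_def)
qed simp

lemma rest_cross:
  assumes "a < j" "j < m" "b \<le> f a" "b \<le> s j" "s j < f a" "\<And>i. a < i \<Longrightarrow> i < j \<Longrightarrow> s i < b"
  shows "G (Suc a) (f a, b, c) = G (Suc j) (f j, f a, Suc c)"
proof -
  have "G (Suc a) (f a, b, c) = G j (f a, b, c)" using assms by (intro rest_skip) auto
  then show ?thesis using assms by (simp add: rest_step)
qed

lemma rest_none:
  assumes "a < m" "b \<le> A" "\<And>i. a < i \<Longrightarrow> i < m \<Longrightarrow> s i < b"
  shows "G (Suc a) (A, b, c) = (A, b, c)"
  using rest_skip[of "Suc a" m m b A s f c] assms by (simp add: rest_end)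

text \<open>\<open>N x\<close> does not start before \<open>f x\<close>, but being strictly between
  \<open>y\<close> and \<open>N y\<close> it starts before \<open>f y\<close>. So the earlier
  machine takes it, and the two machines exchange roles.\<close>

lemma half_round:
  assumes "x < y" "y < N x" "N x \<noteq> N y"
  shows "G (Suc y) (f y, f x, c) = G (Suc (N x)) (f (N x), f y, Suc c)" "N x < N y"
proof -
  have ym: "y < m" using assms nxt_le[of s f m x] by simp
  show lt: "N x < N y" using nxt_mono[of x y] assms ym by simp
  have fxy: "f x < f y" using incr assms ym by simp
  have Nx: "N x < m" using lt nxt_le[of s f m y] by simp
  have "s (N x) < f y" using nxt_between[of y "N x" s f m] assms lt by simp
  moreover have "f x \<le> s (N x)" using nxt_ge Nx by simp
  ultimately show "G (Suc y) (f y, f x, c) = G (Suc (N x)) (f (N x), f y, Suc c)"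
    using rest_skip[of "Suc y" "N x" m "f x" "f y" s f c] assms Nx fxy nxt_between[of x _ s f m]
    by (simp add: rest_step)
qed

text \<open>The common successor starts before neither finishing time, so the later machine, that of
  \<open>y\<close>, takes it. This is where \<open>y\<close> disappears from the state.\<close>

lemma meet:
  assumes "x < y" "y < N x" "N x = N y"
  shows "G (Suc y) (f y, f x, c) =
    (if N x < m then G (Suc (N x)) (f (N x), f x, Suc c) else (f y, f x, c))"
proof -
  have ym: "y < m" using assms nxt_le[of s f m x] by simp
  have fxy: "f x < f y" using incr assms ym by simp
  have "G (Suc y) (f y, f x, c) = G (N x) (f y, f x, c)"
    using assms nxt_le[of s f m x] fxy nxt_between[of x _ s f m] by (intro rest_skip) auto
  moreover have "f y \<le> s (N x)" if "N x < m" using nxt_ge[of s f m y] assms that by simp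
  ultimately show ?thesis
    using nxt_le[of s f m x] by (auto simp: rest_step rest_end not_less)
qed

text \<open>The machines have not met within \<open>n\<close> rounds, each of which moves both of them along \<open>N\<close>.\<close>

definition apart :: "nat \<Rightarrow> nat \<Rightarrow> nat \<Rightarrow> bool" where
  "apart x y n \<longleftrightarrow> (N ^^ n) x < (N ^^ n) y \<and> (N ^^ n) y < (N ^^ Suc n) x"

text \<open>Monotone iterates preserve weak inequalities, so a strict inequality that has failed
  once fails in all later rounds.\<close>

lemma apart_antimono:
  assumes "apart x y n'" "n \<le> n'" "x \<le> m" "y \<le> m"
  shows "apart x y n"
proof -
  have split: "(N ^^ n') z = (N ^^ (n' - n)) ((N ^^ n) z)" for z
    using assms(2) funpow_add[of "n' - n" n N] by (metis comp_apply le_add_diff_inverse2)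
  have split': "(N ^^ Suc n') x = (N ^^ (n' - n)) ((N ^^ Suc n) x)"
    using assms(2) funpow_add[of "n' - n" "Suc n" N]
    by (metis comp_apply add_Suc_right le_add_diff_inverse2)
  then show ?thesis
    using assms(1) nxt_iter_mono[of "(N ^^ n) y" "(N ^^ n) x" "n' - n"]
      nxt_iter_mono[of "(N ^^ Suc n) x" "(N ^^ n) y" "n' - n"]
      iter_le[OF assms(3), of n] iter_le[OF assms(4), of n]
    unfolding apart_def split split' by (meson leD leI)
qed

lemma rest_rounds:
  assumes "apart x y n" "x < m" "y < m"
  shows "G (Suc y) (f y, f x, c) = G (Suc ((N ^^ n) y)) (f ((N ^^ n) y), f ((N ^^ n) x), c + 2 * n)"
  using assms(1)
proof (induction n)
  case (Suc n)
  define x' y' where "x' = (N ^^ n) x" and "y' = (N ^^ n) y"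
  have "apart x y n" using Suc.prems apart_antimono[of x y "Suc n" n] assms(2,3) by simp
  then have *: "x' < y'" "y' < N x'" and
    IH: "G (Suc y) (f y, f x, c) = G (Suc y') (f y', f x', c + 2 * n)"
    using Suc.IH by (auto simp: apart_def x'_def y'_def)
  have **: "N x' < N y'" "N y' < N (N x')"
    using Suc.prems by (auto simp: apart_def x'_def y'_def)
  \<comment> \<open>A round consists of two half rounds, from \<open>x', y'\<close> and then from
    \<open>y', N x'\<close>; hence the counter grows by 2.\<close>
  show ?case
    using IH half_round(1)[of x' y' "c + 2 * n"] half_round(1)[of y' "N x'" "Suc (c + 2 * n)"] * **
    by (simp add: x'_def y'_def)
qed simp

end

text \<open>A finite set of weights is kept as its maximum \<open>x\<close> together with a flag \<open>z\<close> that is zero if the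
  set is empty. The predicate \<open>\<phi> b\<close> says that some weight is at least \<open>b\<close>.\<close>

definition rep :: "nat \<Rightarrow> real \<Rightarrow> (real \<Rightarrow> bool) \<Rightarrow> bool" where
  "rep z x \<phi> \<longleftrightarrow> (\<forall>b. \<phi> b \<longleftrightarrow> z \<noteq> 0 \<and> b \<le> x)"

lemma rep_cong: "rep z x \<phi> \<Longrightarrow> (\<And>b. \<phi> b \<longleftrightarrow> \<psi> b) \<Longrightarrow> rep z x \<psi>"
  by (simp add: rep_def)

text \<open>The condition is literally the test in the programs: the second maximum is chosen unless
  its set is empty or a nonempty first set has a larger maximum.\<close>

lemma rep_join:
  assumes "rep z x \<phi>" "rep z' x' \<psi>" "\<And>b. \<chi> b \<longleftrightarrow> \<phi> b \<or> \<psi> b"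
  shows "z' \<noteq> 0 \<and> \<not> (z \<noteq> 0 \<and> x' < x) \<Longrightarrow> rep z' x' \<chi>"
    and "\<not> (z' \<noteq> 0 \<and> \<not> (z \<noteq> 0 \<and> x' < x)) \<Longrightarrow> rep z x \<chi>"
  using assms by (force simp: rep_def)+

section \<open>Programs for a single block\<close>

text \<open>Arrays of a block in the numeric memory: 0 length; 1, 2 jumps along the successor function and
  flags for the weights; 3, 4 likewise for \<open>nxt\<close>; 5 number of intervals scheduled from \<open>(N x, x)\<close> on.
  In the real memory: 0, 1 starting and finishing times; 2, 3 maximal weights for the two jump tables;
  4, 5 final state from \<open>(N x, x)\<close> on; 6, 7 scratch space of the redistribution (block 0 only).

  Numeric registers: 0 number of intervals scheduled; 1 index of the last block; 2 \<open>q\<close>; 3, 4 \<open>K\<close> and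
  \<open>2 ^ K - 1\<close> for the height \<open>K\<close> of the jump tables (minus one so that zero is correct initially);
  5 updates since the last redistribution; 6 current block; the others are temporary.
  Real registers: 2 lower bound for all starting times; 3, 4 the state \<open>A\<close>, \<open>B\<close>.\<close>

notation Seq (infixr ";;" 60)

abbreviation "nm \<sigma> v i k a \<equiv> nmem \<sigma> (addr v i k a)"
abbreviation "rm \<sigma> v i k a \<equiv> rmem \<sigma> (addr v i k a)"
abbreviation "len \<sigma> i \<equiv> nm \<sigma> 0 i 0 0"
abbreviation "start \<sigma> i \<equiv> (\<lambda>j. rm \<sigma> 0 i 0 j)"
abbreviation "fin \<sigma> i \<equiv> (\<lambda>j. rm \<sigma> 1 i 0 j)"

abbreviation "LD v k a \<equiv> NLoad (adr v (NReg 6) k a)"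
abbreviation "RLD v k a \<equiv> RLoad (adr v (NReg 6) k a)"
abbreviation "ST v k a e \<equiv> NStore (adr v (NReg 6) k a) e"
abbreviation "RST v k a e \<equiv> RStore (adr v (NReg 6) k a) e"
abbreviation "LEN \<equiv> LD 0 (NConst 0) (NConst 0)"

lemmas ok_intros = ok_Seq ok_NAssign ok_NStore ok_RAssign ok_RStore ok_If ok_Skip

text \<open>\<open>w a\<close> is the weight of the step from \<open>a\<close> to \<open>g a\<close>; a cell holds the \<open>2 ^ k\<close>-fold jump from \<open>a\<close> and
  the maximal weight of the steps skipped by it.\<close>

definition cell :: "ram \<Rightarrow> nat \<Rightarrow> nat \<Rightarrow> nat \<Rightarrow> nat \<Rightarrow> nat \<Rightarrow> (nat \<Rightarrow> nat) \<Rightarrow> (nat \<Rightarrow> real \<Rightarrow> bool) \<Rightarrow>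
    nat \<Rightarrow> nat \<Rightarrow> bool" where
  "cell \<sigma> i u z x m g w k a \<longleftrightarrow> nm \<sigma> u i k a = (g ^^ (2 ^ k)) a \<and>
     ((g ^^ (2 ^ k)) a < m \<longrightarrow> rep (nm \<sigma> z i k a) (rm \<sigma> x i k a) (\<lambda>b. \<exists>t<2^k. w ((g ^^ t) a) b))"

definition table where
  "table \<sigma> i u z x m g w K \<longleftrightarrow> (\<forall>k\<le>K. \<forall>a\<le>m. cell \<sigma> i u z x m g w k a)"

section \<open>Binary lifting along a jump table\<close>

definition lift_body :: "nat \<Rightarrow> nat \<Rightarrow> nat \<Rightarrow> com" where
  "lift_body u z x =
      NAssign 8 (Minus (NReg 8) (NConst 1));;
      NAssign 9 (Divide (NReg 9) (NConst 2));;
      If (And (NLess (LD u (NReg 8) (NReg 7)) LEN)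
              (Not (And (Not (NEq (LD z (NReg 8) (NReg 7)) (NConst 0)))
                        (Not (RLess (RLD x (NReg 8) (NReg 7)) (RReg 4))))))
        (If (And (Not (NEq (LD z (NReg 8) (NReg 7)) (NConst 0)))
                 (Not (And (Not (NEq (NReg 14) (NConst 0))) (RLess (RLD x (NReg 8) (NReg 7)) (RReg 5)))))
           (NAssign 14 (LD z (NReg 8) (NReg 7));; RAssign 5 (RLD x (NReg 8) (NReg 7)))
           Skip;;
         NAssign 7 (LD u (NReg 8) (NReg 7));;
         NAssign 10 (Plus (NReg 10) (NReg 9)))
        Skip"

definition lift_loop :: "nat \<Rightarrow> nat \<Rightarrow> nat \<Rightarrow> com" where
  "lift_loop u z x = While (NLess (NConst 0) (NReg 8)) (lift_body u z x)"

text \<open>Register 7 is the position, 8 and 9 are \<open>k\<close> and \<open>2 ^ k\<close>, 10 is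
  the number of steps made, 14 and real 5 hold the maximal weight passed, and real 4 is the
  threshold. The number of steps counts scheduled intervals; the maximum is needed for building the
  table of \<open>nxt\<close>.\<close>

definition lift :: "nat \<Rightarrow> nat \<Rightarrow> nat \<Rightarrow> com" where
  "lift u z x =
    NAssign 8 (NReg 3);; NAssign 9 (Plus (NReg 4) (NConst 1));;
    NAssign 10 (NConst 0);; NAssign 14 (NConst 0);; lift_loop u z x"

lemma lift_frame [simp]:
  "nwr (lift_loop u z x) = {7, 8, 9, 10, 14}" "rwr (lift_loop u z x) = {5}"
  "nst (lift_loop u z x) = {}" "rst (lift_loop u z x) = {}" "local (lift_loop u z x)"
  "nwr (lift u z x) = {7, 8, 9, 10, 14}" "rwr (lift u z x) = {5}"
  "nst (lift u z x) = {}" "rst (lift u z x) = {}" "local (lift u z x)"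
  by (auto simp: lift_def lift_loop_def lift_body_def)

definition lifted :: "(nat \<Rightarrow> nat) \<Rightarrow> (nat \<Rightarrow> real \<Rightarrow> bool) \<Rightarrow> nat \<Rightarrow> nat \<Rightarrow> real \<Rightarrow>
    nat \<Rightarrow> nat \<Rightarrow> nat \<Rightarrow> real \<Rightarrow> bool" where
  "lifted g w m a0 b n a fl acc \<longleftrightarrow> a = (g ^^ n) a0 \<and> a < m \<and> (\<forall>t<n. \<not> w ((g ^^ t) a0) b) \<and>
     rep fl acc (\<lambda>b. \<exists>t<n. w ((g ^^ t) a0) b)"

definition can_lift :: "(nat \<Rightarrow> nat) \<Rightarrow> (nat \<Rightarrow> real \<Rightarrow> bool) \<Rightarrow> nat \<Rightarrow> real \<Rightarrow> nat \<Rightarrow> nat \<Rightarrow> bool" where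
  "can_lift g w m b a n \<longleftrightarrow> (g ^^ n) a < m \<and> (\<forall>t<n. \<not> w ((g ^^ t) a) b)"

lemma ex_less_add: "(\<exists>t<n + k. P t) \<longleftrightarrow> (\<exists>t<n. P t) \<or> (\<exists>t<k. P (t + n :: nat))"
proof (intro iffI; (elim disjE)?)
  assume "\<exists>t<n + k. P t"
  then obtain t where t: "t < n + k" "P t" by blast
  show "(\<exists>t<n. P t) \<or> (\<exists>t<k. P (t + n))"
  proof (cases "t < n")
    case False
    then have "t - n < k" "P ((t - n) + n)" using t by auto
    then show ?thesis by blast
  qed (use t in blast)
next
  assume "\<exists>t<k. P (t + n)"
  then show "\<exists>t<n + k. P t" by (metis add.commute add_less_mono1)
qed (auto intro: trans_less_add1)

lemma lifted_jump:
  assumes "lifted g w m a0 b n a fl acc" "(g ^^ k) a < m" "rep z x (\<lambda>b. \<exists>t<k. w ((g ^^ t) a) b)"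
    and "\<not> (z \<noteq> 0 \<and> b \<le> x)"
  shows "z \<noteq> 0 \<and> \<not> (fl \<noteq> 0 \<and> x < acc) \<Longrightarrow> lifted g w m a0 b (n + k) ((g ^^ k) a) z x"
    and "\<not> (z \<noteq> 0 \<and> \<not> (fl \<noteq> 0 \<and> x < acc)) \<Longrightarrow> lifted g w m a0 b (n + k) ((g ^^ k) a) fl acc"
proof -
  have a: "a = (g ^^ n) a0" using assms by (simp add: lifted_def)
  have it: "(g ^^ (t + n)) a0 = (g ^^ t) a" for t by (simp add: a funpow_add)
  have "\<not> (\<exists>t<k. w ((g ^^ t) a) b)" using assms(3,4) unfolding rep_def by blast
  then have none: "\<not> (\<exists>t<n + k. w ((g ^^ t) a0) b)"
    using assms(1) unfolding ex_less_add it by (auto simp: lifted_def)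
  have ex: "(\<exists>t<n + k. w ((g ^^ t) a0) b) \<longleftrightarrow> (\<exists>t<n. w ((g ^^ t) a0) b) \<or> (\<exists>t<k. w ((g ^^ t) a) b)" for b
    unfolding ex_less_add it ..
  have rep: "rep fl acc (\<lambda>b. \<exists>t<n. w ((g ^^ t) a0) b)" using assms(1) by (simp add: lifted_def)
  note join = rep_join[OF rep assms(3) ex]
  show "z \<noteq> 0 \<and> \<not> (fl \<noteq> 0 \<and> x < acc) \<Longrightarrow> lifted g w m a0 b (n + k) ((g ^^ k) a) z x"
    and "\<not> (z \<noteq> 0 \<and> \<not> (fl \<noteq> 0 \<and> x < acc)) \<Longrightarrow> lifted g w m a0 b (n + k) ((g ^^ k) a) fl acc"
    using join none assms(2) it[of k] by (auto simp: lifted_def add.commute)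
qed

context
  fixes l :: nat and \<sigma> :: ram and i m K :: nat
  assumes i: "nreg \<sigma> 6 = i" and m: "len \<sigma> i = m"
    and K: "nreg \<sigma> 3 = K" "nreg \<sigma> 4 = 2 ^ K - 1" "m \<le> 2 ^ K" "K < l"
begin

text \<open>Descent over exponents: initially no jump of length \<open>2 ^ K \<ge> m\<close> stays
  inside the block, and each level needs at most one jump, so that at exponent 0 not even a single
  step is possible.\<close>

lemma lift_ok:
  assumes g: "jumps g m" and table: "table \<sigma> i u z x m g w K"
    and a0: "nreg \<sigma> 7 = a0" "a0 < m" and b: "rreg \<sigma> 4 = b"
  shows "ok l (Suc K) (lift u z x) \<sigma> (\<lambda>\<sigma>'. \<exists>n a fl acc. nreg \<sigma>' 7 = a \<and> nreg \<sigma>' 10 = n \<and>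
    nreg \<sigma>' 14 = fl \<and> rreg \<sigma>' 5 = acc \<and> lifted g w m a0 b n a fl acc \<and> (g a = m \<or> w a b))"
proof -
  interpret jumps g m by (rule g)
  have Kl: "(2::nat) ^ K < 2 ^ l" using K(4) by simp
  define I where "I k \<sigma>' \<longleftrightarrow> (\<exists>n a fl acc. nreg \<sigma>' 8 = k \<and> nreg \<sigma>' 9 = 2 ^ k \<and> k \<le> K \<and>
    nreg \<sigma>' 7 = a \<and> nreg \<sigma>' 10 = n \<and> nreg \<sigma>' 14 = fl \<and> rreg \<sigma>' 5 = acc \<and>
    lifted g w m a0 b n a fl acc \<and> \<not> can_lift g w m b a (2 ^ k))" for k and \<sigma>' :: ram
  have no: "\<not> can_lift g w m b a0 (2 ^ K)"
    using iter_ge[of a0 "2 ^ K"] a0 K(3) by (simp add: can_lift_def)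
  have loop: "ok l (Suc K) (lift_loop u z x) \<sigma>1 (\<lambda>\<sigma>'. \<exists>n a fl acc. nreg \<sigma>' 7 = a \<and> nreg \<sigma>' 10 = n \<and>
      nreg \<sigma>' 14 = fl \<and> rreg \<sigma>' 5 = acc \<and> lifted g w m a0 b n a fl acc \<and> (g a = m \<or> w a b))"
    if \<sigma>1: "nreg \<sigma>1 8 = K" "nreg \<sigma>1 9 = 2 ^ K" "nreg \<sigma>1 7 = a0" "nreg \<sigma>1 10 = 0" "nreg \<sigma>1 14 = 0"
      "nreg \<sigma>1 6 = i" "rreg \<sigma>1 4 = b" "nmem \<sigma>1 = nmem \<sigma>" "rmem \<sigma>1 = rmem \<sigma>" for \<sigma>1
    unfolding lift_loop_def
  proof (rule ok_While[where I = I and n = K and B' = 1])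
    show "I K \<sigma>1" using \<sigma>1 no a0 by (auto simp: I_def lifted_def rep_def)
  next
    fix k \<sigma>' assume I: "I k \<sigma>'"
      and u: "unch (While (NLess (NConst 0) (NReg 8)) (lift_body u z x)) \<sigma>1 \<sigma>'"
    have fr [simp]: "nreg \<sigma>' 6 = i" "rreg \<sigma>' 4 = b" "nm \<sigma>' v i k a = nm \<sigma> v i k a"
      "rm \<sigma>' v i k a = rm \<sigma> v i k a" for v k a
      using u \<sigma>1 by (auto simp: unch_def lift_body_def)
    obtain n a fl acc where *: "nreg \<sigma>' 8 = k" "nreg \<sigma>' 9 = 2 ^ k" "k \<le> K" "nreg \<sigma>' 7 = a"
      "nreg \<sigma>' 10 = n" "nreg \<sigma>' 14 = fl" "rreg \<sigma>' 5 = acc" "lifted g w m a0 b n a fl acc"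
      "\<not> can_lift g w m b a (2 ^ k)" using I by (auto simp: I_def)
    have am: "a < m" using * by (simp add: lifted_def)
    {
      assume "\<not> bval (NLess (NConst 0) (NReg 8)) \<sigma>'"
      then have "\<not> can_lift g w m b a 1" using * by simp
      then have "g a = m \<or> w a b" using le[of a] by (auto simp: can_lift_def)
      then show "\<exists>n a fl acc. nreg \<sigma>' 7 = a \<and> nreg \<sigma>' 10 = n \<and>
          nreg \<sigma>' 14 = fl \<and> rreg \<sigma>' 5 = acc \<and> lifted g w m a0 b n a fl acc \<and> (g a = m \<or> w a b)"
        using * by blast
    }
    assume "bval (NLess (NConst 0) (NReg 8)) \<sigma>'"
    then obtain k' where k': "k = Suc k'" using * by (cases k) auto
    define j where "j = (g ^^ (2 ^ k')) a"
    define zv xv where "zv = nm \<sigma> z i k' a" and "xv = rm \<sigma> x i k' a"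
    have uv: "nm \<sigma> u i k' a = j" and rep: "j < m \<Longrightarrow> rep zv xv (\<lambda>b. \<exists>t<2^k'. w ((g ^^ t) a) b)"
      using table * k' am by (auto simp: table_def cell_def zv_def xv_def j_def)
    have can: "can_lift g w m b a (2 ^ k') \<longleftrightarrow> j < m \<and> \<not> (zv \<noteq> 0 \<and> b \<le> xv)"
      using rep unfolding can_lift_def j_def[symmetric] rep_def by blast
    \<comment> \<open>Two successive feasible jumps of length \<open>2 ^ k'\<close> would form a
      feasible jump of length \<open>2 ^ k\<close>, which the invariant excludes.\<close>
    have stop: "\<not> can_lift g w m b j (2 ^ k')" if "can_lift g w m b a (2 ^ k')"
    proof
      assume c: "can_lift g w m b j (2 ^ k')"
      have "(g ^^ (2 ^ k)) a = (g ^^ (2 ^ k')) j"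
        by (simp add: k' j_def mult_2 funpow_add)
      moreover have "\<not> (\<exists>t<2 ^ k' + 2 ^ k'. w ((g ^^ t) a) b)"
        unfolding ex_less_add using that c by (auto simp: can_lift_def j_def funpow_add)
      then have "\<forall>t<2 ^ k. \<not> w ((g ^^ t) a) b" by (auto simp: k' mult_2)
      ultimately have "can_lift g w m b a (2 ^ k)" using c by (simp add: can_lift_def)
      with * show False by simp
    qed
    have jump: "lifted g w m a0 b (n + 2 ^ k') j zv xv"
      if "j < m" "\<not> (zv \<noteq> 0 \<and> b \<le> xv)" "zv \<noteq> 0 \<and> \<not> (fl \<noteq> 0 \<and> xv < acc)"
      using lifted_jump(1)[OF *(8) _ rep that(2,3)] that(1) by (simp add: j_def)
    have jump': "lifted g w m a0 b (n + 2 ^ k') j fl acc"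
      if "j < m" "\<not> (zv \<noteq> 0 \<and> b \<le> xv)" "\<not> (zv \<noteq> 0 \<and> \<not> (fl \<noteq> 0 \<and> xv < acc))"
      using lifted_jump(2)[OF *(8) _ rep that(2,3)] that(1) by (simp add: j_def)
    \<comment> \<open>Every step moves right by at least one index, so the number of steps stays
      below \<open>m\<close>.\<close>
    have bound: "n + 2 ^ k' \<le> 2 ^ l" if "j < m"
    proof -
      have "j = (g ^^ (n + 2 ^ k')) a0"
        using *(8) funpow_add[of "2 ^ k'" n g] by (simp add: lifted_def j_def add.commute)
      then have "a0 + (n + 2 ^ k') < m"
        using that iter_ge[of a0 "n + 2 ^ k'"] a0 by (auto simp: min_def split: if_splits)
      then show ?thesis using K(3) Kl by linarith
    qed
    show "\<exists>k'. k = Suc k' \<and> ok l 1 (lift_body u z x) \<sigma>' (I k')"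
      apply (rule exI[of _ k'], rule conjI, rule k')
      unfolding lift_body_def
      apply (intro ok_intros)
      using * k' uv m jump jump' bound can stop
      by (auto simp: I_def zv_def[symmetric] xv_def[symmetric] not_less)
  qed (use K in auto)
  show ?thesis
    unfolding lift_def
    apply (intro ok_intros)
    apply (simp_all add: K less_imp_le[OF K(4)])
    apply (rule ok_conseq[OF loop])
    using a0 b by (auto simp: i K)
qed

end

section \<open>Search for the round in which the two machines meet\<close>

definition meet_body :: com where
  "meet_body =
    NAssign 8 (Minus (NReg 8) (NConst 1));;
    NAssign 9 (Divide (NReg 9) (NConst 2));;
    If (And (Not (NEq (LD 3 (NReg 8) (NReg 11)) (LD 3 (NReg 8) (NReg 12))))
            (Not (NEq (LD 3 (NReg 8) (NReg 12)) (LD 3 (NReg 8) (LD 3 (NConst 0) (NReg 11))))))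
      (NAssign 11 (LD 3 (NReg 8) (NReg 11));;
       NAssign 12 (LD 3 (NReg 8) (NReg 12));;
       NAssign 0 (Plus (NReg 0) (Times (NConst 2) (NReg 9))))
      Skip"

definition meet_loop :: com where
  "meet_loop = While (NLess (NConst 0) (NReg 8)) meet_body"

text \<open>When no full round is left, the successors agree either at once or after one half round.
  The second branch performs this half round, which turns \<open>x, y\<close> into
  \<open>y, N x\<close>.\<close>

definition meet_com :: com where
  "meet_com =
    NAssign 8 (NReg 3);; NAssign 9 (Plus (NReg 4) (NConst 1));; meet_loop;;
    If (NEq (LD 3 (NConst 0) (NReg 11)) (LD 3 (NConst 0) (NReg 12)))
      Skip
      (NAssign 15 (NReg 11);; NAssign 11 (NReg 12);; NAssign 12 (LD 3 (NConst 0) (NReg 15));;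
       NAssign 0 (Plus (NReg 0) (NConst 1)))"

lemma meet_frame [simp]:
  "nwr meet_loop = {0, 8, 9, 11, 12}" "rwr meet_loop = {}"
  "nst meet_loop = {}" "rst meet_loop = {}" "local meet_loop"
  "nwr meet_com = {0, 8, 9, 11, 12, 15}" "rwr meet_com = {}"
  "nst meet_com = {}" "rst meet_com = {}" "local meet_com"
  by (auto simp: meet_com_def meet_loop_def meet_body_def)

context block
begin

lemma apart_0: "apart x y 0 \<longleftrightarrow> x < y \<and> y < N x"
  by (simp add: apart_def)

text \<open>Each round schedules two intervals behind \<open>y\<close>, and only
  \<open>m - Suc y\<close> are left. This rules out \<open>2 ^ K\<close> rounds and also keeps the
  counter in register 0 small.\<close>

lemma apart_bound: "apart x y n \<Longrightarrow> x < m \<Longrightarrow> y < m \<Longrightarrow> y + 2 * n < m"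
proof (induction n)
  case (Suc n)
  have "(N ^^ Suc n) y < m"
    using Suc.prems iter_le[of x "Suc (Suc n)"] by (auto simp: apart_def)
  moreover have "c + 2 * k \<le> c + (m - Suc y)" if "apart x y k" for c k
  proof -
    have "c + 2 * k \<le> snd (snd (G (Suc ((N ^^ k) y)) (f ((N ^^ k) y), f ((N ^^ k) x), c + 2 * k)))"
      by (rule rest_ge)
    also have "\<dots> \<le> c + (m - Suc y)"
      unfolding rest_rounds[OF that Suc.prems(2,3), symmetric] by (rule rest_le)
    finally show ?thesis .
  qed
  from this[OF Suc.prems(1), of 0] show ?case using Suc.prems by auto
qed simp

text \<open>Monotonicity already provides the weak inequalities, so two equality tests between table
  cells decide the question.\<close>

lemma apart_iff:
  assumes "apart x y 0" "x < m" "y < m"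
  shows "apart x y n \<longleftrightarrow> (N ^^ n) x \<noteq> (N ^^ n) y \<and> (N ^^ n) y \<noteq> (N ^^ n) (N x)"
proof -
  have "(N ^^ n) x \<le> (N ^^ n) y" "(N ^^ n) y \<le> (N ^^ n) (N x)"
    using assms nxt_le[of s f m x] by (auto intro!: nxt_iter_mono simp: apart_0)
  then show ?thesis by (auto simp: apart_def funpow_swap1)
qed

end

context
  fixes l :: nat and \<sigma> :: ram and i m K :: nat and s f :: "nat \<Rightarrow> real"
  assumes i: "nreg \<sigma> 6 = i" and K: "nreg \<sigma> 3 = K" "nreg \<sigma> 4 = 2 ^ K - 1" "m \<le> 2 ^ K" "K < l"
    and b: "block f m"
begin

interpretation block s f m by (rule b)

text \<open>The conclusion \<open>x \<le> x1\<close> matters during preprocessing: at that time only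
  the entries to the right of the current index have been computed.\<close>

lemma meet_ok:
  assumes table: "table \<sigma> i 3 z x' m N w K"
    and xy: "nreg \<sigma> 11 = x" "nreg \<sigma> 12 = y" "apart x y 0" "y < m" and c: "nreg \<sigma> 0 = c" "c + m \<le> 2 ^ l"
  shows "ok l (Suc K) meet_com \<sigma> (\<lambda>\<sigma>'. \<exists>x1 y1 c1. nreg \<sigma>' 11 = x1 \<and> nreg \<sigma>' 12 = y1 \<and> nreg \<sigma>' 0 = c1 \<and>
    x \<le> x1 \<and> x1 < y1 \<and> y1 < N x1 \<and> N x1 = N y1 \<and>
    G (Suc y) (f y, f x, c) = G (Suc y1) (f y1, f x1, c1))"
proof -
  have Kl: "(2::nat) ^ K < 2 ^ l" using K(4) by simp
  have xm: "x < m" using xy by (simp add: apart_0)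
  define I where "I k \<sigma>' \<longleftrightarrow> (\<exists>n. nreg \<sigma>' 8 = k \<and> nreg \<sigma>' 9 = 2 ^ k \<and> k \<le> K \<and>
    nreg \<sigma>' 11 = (N ^^ n) x \<and> nreg \<sigma>' 12 = (N ^^ n) y \<and> nreg \<sigma>' 0 = c + 2 * n \<and>
    apart x y n \<and> \<not> apart x y (n + 2 ^ k))" for k and \<sigma>' :: ram
  have no: "\<not> apart x y (2 ^ K)"
  proof
    assume "apart x y (2 ^ K)"
    then have "y + 2 * 2 ^ K < m" using apart_bound xm xy by blast
    then show False using K(3) by simp
  qed
  have loop: "ok l (Suc K) meet_loop \<sigma>1 (I 0)"
    if \<sigma>1: "nreg \<sigma>1 8 = K" "nreg \<sigma>1 9 = 2 ^ K" "nreg \<sigma>1 11 = x" "nreg \<sigma>1 12 = y" "nreg \<sigma>1 0 = c"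
      "nreg \<sigma>1 6 = i" "nmem \<sigma>1 = nmem \<sigma>" for \<sigma>1
    unfolding meet_loop_def
  proof (rule ok_While[where I = I and n = K and B' = 1])
    show "I K \<sigma>1" using \<sigma>1 no xy by (auto simp: I_def intro: exI[of _ 0])
  next
    fix k \<sigma>' assume I: "I k \<sigma>'"
      and u: "unch (While (NLess (NConst 0) (NReg 8)) meet_body) \<sigma>1 \<sigma>'"
    have fr [simp]: "nreg \<sigma>' 6 = i" "nm \<sigma>' v i k a = nm \<sigma> v i k a" for v k a
      using u \<sigma>1 by (auto simp: unch_def meet_body_def)
    obtain n where *: "nreg \<sigma>' 8 = k" "nreg \<sigma>' 9 = 2 ^ k" "k \<le> K" "nreg \<sigma>' 11 = (N ^^ n) x"
      "nreg \<sigma>' 12 = (N ^^ n) y" "nreg \<sigma>' 0 = c + 2 * n" "apart x y n" "\<not> apart x y (n + 2 ^ k)"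
      using I by (auto simp: I_def)
    {
      assume "\<not> bval (NLess (NConst 0) (NReg 8)) \<sigma>'"
      then show "I 0 \<sigma>'" using I by (auto simp: I_def)
    }
    assume "bval (NLess (NConst 0) (NReg 8)) \<sigma>'"
    then obtain k' where k': "k = Suc k'" using * by (cases k) auto
    define x1 y1 where "x1 = (N ^^ n) x" and "y1 = (N ^^ n) y"
    have 0: "apart x1 y1 0" using *(7) by (simp add: apart_def x1_def y1_def)
    have lt: "x1 < m" "y1 < m" "N x1 \<le> m"
      using 0 nxt_le[of s f m x1] by (auto simp: apart_0)
    have uv: "nm \<sigma> 3 i k' x1 = (N ^^ (2 ^ k')) x1" "nm \<sigma> 3 i k' y1 = (N ^^ (2 ^ k')) y1"
      "nm \<sigma> 3 i k' (N x1) = (N ^^ (2 ^ k')) (N x1)" "nm \<sigma> 3 i 0 x1 = N x1"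
      using table lt *(3) k' by (auto simp: table_def cell_def)
    have it: "(N ^^ (2 ^ k')) x1 = (N ^^ (n + 2 ^ k')) x" "(N ^^ (2 ^ k')) y1 = (N ^^ (n + 2 ^ k')) y"
      using funpow_add[of "2 ^ k'" n N] by (simp_all add: x1_def y1_def add.commute)
    have test: "(N ^^ (2 ^ k')) x1 \<noteq> (N ^^ (2 ^ k')) y1 \<and> (N ^^ (2 ^ k')) y1 \<noteq> (N ^^ (2 ^ k')) (N x1) \<longleftrightarrow>
        apart x y (n + 2 ^ k')"
      unfolding apart_iff[OF 0 lt(1,2), symmetric]
      using funpow_add[of "2 ^ k'" n N] funpow_add[of "Suc (2 ^ k')" n N]
      by (simp add: apart_def x1_def y1_def add.commute)
    have bound: "c + 2 * n + 2 * 2 ^ k' \<le> 2 ^ l" if "apart x y (n + 2 ^ k')"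
      using apart_bound[OF that xm xy(4)] c by simp
    have upper: "\<not> apart x y (n + 2 ^ k' + 2 ^ k')" using *(8) by (simp add: k' mult_2 add.assoc)
    show "\<exists>k'. k = Suc k' \<and> ok l 1 meet_body \<sigma>' (I k')"
      apply (rule exI[of _ k'], rule conjI, rule k')
      unfolding meet_body_def
      apply (intro ok_intros)
      using *(1-7) k' uv test[unfolded it] bound upper it
      by (auto simp: I_def x1_def[symmetric] y1_def[symmetric] intro: exI[of _ "n + 2 ^ k'"] exI[of _ n])
  qed (use K in auto)
  have finish: "ok l (Suc K) (If (NEq (LD 3 (NConst 0) (NReg 11)) (LD 3 (NConst 0) (NReg 12)))
      Skip
      (NAssign 15 (NReg 11);; NAssign 11 (NReg 12);; NAssign 12 (LD 3 (NConst 0) (NReg 15));;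
       NAssign 0 (Plus (NReg 0) (NConst 1)))) \<sigma>' (\<lambda>\<sigma>'. \<exists>x1 y1 c1. nreg \<sigma>' 11 = x1 \<and> nreg \<sigma>' 12 = y1 \<and> nreg \<sigma>' 0 = c1 \<and>
    x \<le> x1 \<and> x1 < y1 \<and> y1 < N x1 \<and> N x1 = N y1 \<and>
    G (Suc y) (f y, f x, c) = G (Suc y1) (f y1, f x1, c1))"
    if I: "I 0 \<sigma>'" and fr: "nreg \<sigma>' 6 = i" "\<And>v k a. nm \<sigma>' v i k a = nm \<sigma> v i k a" for \<sigma>'
  proof -
    obtain n where *: "nreg \<sigma>' 11 = (N ^^ n) x" "nreg \<sigma>' 12 = (N ^^ n) y" "nreg \<sigma>' 0 = c + 2 * n"
      "apart x y n" "\<not> apart x y (n + 1)"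
      using I by (auto simp: I_def)
    define x1 y1 where "x1 = (N ^^ n) x" and "y1 = (N ^^ n) y"
    have lt: "x1 < y1" "y1 < N x1" using *(4) by (auto simp: apart_def x1_def y1_def)
    then have m: "y1 < m" "N x1 \<le> m" using nxt_le[of s f m x1] by auto
    have uv: "nm \<sigma> 3 i 0 x1 = N x1" "nm \<sigma> 3 i 0 y1 = N y1"
      using table lt m by (auto simp: table_def cell_def)
    have G: "G (Suc y) (f y, f x, c) = G (Suc y1) (f y1, f x1, c + 2 * n)"
      using rest_rounds[OF *(4) xm xy(4)] by (simp add: x1_def y1_def)
    have x: "x \<le> x1" using iter_mono[of 0 n x] xm by (simp add: x1_def)
    \<comment> \<open>A further full round is impossible, so one of the two strict inequalities
      fails for the successors; if it is not the first, it is the second, which is the meeting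
      condition for \<open>y1, N x1\<close>.\<close>
    have half: "N y1 = N (N x1)" "y1 < N x1" "N x1 < N y1"
      "G (Suc y) (f y, f x, c) = G (Suc (N x1)) (f (N x1), f y1, Suc (c + 2 * n))" if "N x1 \<noteq> N y1"
    proof -
      have "\<not> apart x1 y1 1"
        using *(5) by (simp add: apart_def x1_def y1_def)
      then show "N y1 = N (N x1)"
        using apart_iff[of x1 y1 1] lt m that by (auto simp: apart_0)
    qed (use half_round[OF lt that] G lt in auto)
    have bound: "c + 2 * n + 1 \<le> 2 ^ l"
      using apart_bound[OF *(4) xm xy(4)] c by simp
    show ?thesis
      apply (intro ok_intros)
      using * fr uv lt x bound G half less_imp_le[OF lt(1)]
      by (auto simp: x1_def[symmetric] y1_def[symmetric])
  qed
  show ?thesis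
    unfolding meet_com_def
    apply (intro ok_intros)
       apply (simp_all add: K)
    using Kl apply simp
    apply (rule ok_conseq[OF loop])
    using xy c i K apply simp_all
    apply (rule finish[simplified])
    by (auto simp: unch_def)
qed

end

section \<open>Doubling of jump tables\<close>

definition level_body :: "nat \<Rightarrow> nat \<Rightarrow> nat \<Rightarrow> com" where
  "level_body u z x =
    NAssign 10 (LD u (Minus (NReg 8) (NConst 1)) (NReg 7));;
    ST u (NReg 8) (NReg 7) (LD u (Minus (NReg 8) (NConst 1)) (NReg 10));;
    If (And (Not (NEq (LD z (Minus (NReg 8) (NConst 1)) (NReg 10)) (NConst 0)))
          (Not (And (Not (NEq (LD z (Minus (NReg 8) (NConst 1)) (NReg 7)) (NConst 0)))
            (RLess (RLD x (Minus (NReg 8) (NConst 1)) (NReg 10)) (RLD x (Minus (NReg 8) (NConst 1)) (NReg 7))))))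
      (ST z (NReg 8) (NReg 7) (LD z (Minus (NReg 8) (NConst 1)) (NReg 10));;
       RST x (NReg 8) (NReg 7) (RLD x (Minus (NReg 8) (NConst 1)) (NReg 10)))
      (ST z (NReg 8) (NReg 7) (LD z (Minus (NReg 8) (NConst 1)) (NReg 7));;
       RST x (NReg 8) (NReg 7) (RLD x (Minus (NReg 8) (NConst 1)) (NReg 7)));;
    NAssign 7 (Plus (NReg 7) (NConst 1))"

definition level :: "nat \<Rightarrow> nat \<Rightarrow> nat \<Rightarrow> com" where
  "level u z x = While (Not (NLess LEN (NReg 7))) (level_body u z x)"

definition levels :: "nat \<Rightarrow> nat \<Rightarrow> nat \<Rightarrow> com" where
  "levels u z x =
    NAssign 8 (NConst 1);;
    While (Not (NLess (NReg 3) (NReg 8)))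
      (NAssign 7 (NConst 0);; level u z x;; NAssign 8 (Plus (NReg 8) (NConst 1)))"

lemma level_frame [simp]:
  "nwr (level_body u z x) = {7, 10}" "rwr (level_body u z x) = {}"
  "nst (level_body u z x) = {u, z}" "rst (level_body u z x) = {x}" "local (level_body u z x)"
  "nwr (level u z x) = {7, 10}" "rwr (level u z x) = {}"
  "nst (level u z x) = {u, z}" "rst (level u z x) = {x}" "local (level u z x)"
  "nwr (levels u z x) = {7, 8, 10}" "rwr (levels u z x) = {}"
  "nst (levels u z x) = {u, z}" "rst (levels u z x) = {x}" "local (levels u z x)"
  by (auto simp: level_body_def level_def levels_def)

lemma cell_reg [simp]:
  "cell (\<sigma>\<lparr>nreg := r\<rparr>) i u z x m g w k a = cell \<sigma> i u z x m g w k a"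
  "cell (\<sigma>\<lparr>rreg := q\<rparr>) i u z x m g w k a = cell \<sigma> i u z x m g w k a"
  by (simp_all add: cell_def)

lemma cell_Suc:
  assumes g: "jumps g m" and a: "a \<le> m" and j: "j = (g ^^ (2 ^ k)) a"
    and ca: "cell \<sigma> i u z x m g w k a" and cj: "cell \<sigma> i u z x m g w k j"
    and u': "nm \<sigma>' u i (Suc k) a = nm \<sigma> u i k j"
    and t: "nm \<sigma> z i k j \<noteq> 0 \<and> \<not> (nm \<sigma> z i k a \<noteq> 0 \<and> rm \<sigma> x i k j < rm \<sigma> x i k a) \<Longrightarrow>
      nm \<sigma>' z i (Suc k) a = nm \<sigma> z i k j \<and> rm \<sigma>' x i (Suc k) a = rm \<sigma> x i k j"
    and e: "\<not> (nm \<sigma> z i k j \<noteq> 0 \<and> \<not> (nm \<sigma> z i k a \<noteq> 0 \<and> rm \<sigma> x i k j < rm \<sigma> x i k a)) \<Longrightarrow>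
      nm \<sigma>' z i (Suc k) a = nm \<sigma> z i k a \<and> rm \<sigma>' x i (Suc k) a = rm \<sigma> x i k a"
  shows "cell \<sigma>' i u z x m g w (Suc k) a"
proof -
  interpret jumps g m by (rule g)
  have it: "(g ^^ (2 ^ Suc k)) a = (g ^^ (2 ^ k)) j"
    by (simp add: j mult_2 funpow_add)
  have "rep (nm \<sigma>' z i (Suc k) a) (rm \<sigma>' x i (Suc k) a) (\<lambda>b. \<exists>t<2 ^ Suc k. w ((g ^^ t) a) b)"
    if lt: "(g ^^ (2 ^ k)) j < m"
  proof -
    \<comment> \<open>The end marker is absorbing, so if the long jump ends inside the block, its
      first half does too and the maximum stored for that half is valid.\<close>
    have "j < m"
    proof (rule ccontr)
      assume "\<not> j < m"
      then have "j = m" using iter_le[OF a, of "2 ^ k"] j by simp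
      then show False using lt iter_end by simp
    qed
    then have ra: "rep (nm \<sigma> z i k a) (rm \<sigma> x i k a) (\<lambda>b. \<exists>t<2 ^ k. w ((g ^^ t) a) b)"
      using ca by (simp add: cell_def j)
    have rj: "rep (nm \<sigma> z i k j) (rm \<sigma> x i k j) (\<lambda>b. \<exists>t<2 ^ k. w ((g ^^ t) j) b)"
      using cj lt by (simp add: cell_def)
    have ex: "(\<exists>t<2 ^ Suc k. w ((g ^^ t) a) b) \<longleftrightarrow>
        (\<exists>t<2 ^ k. w ((g ^^ t) a) b) \<or> (\<exists>t<2 ^ k. w ((g ^^ t) j) b)" for b
      using ex_less_add[of "2 ^ k" "2 ^ k" "\<lambda>t. w ((g ^^ t) a) b"] by (simp add: j mult_2 funpow_add)
    show ?thesis
      by (cases "nm \<sigma> z i k j \<noteq> 0 \<and> \<not> (nm \<sigma> z i k a \<noteq> 0 \<and> rm \<sigma> x i k j < rm \<sigma> x i k a)")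
        (simp_all only: t e rep_join[OF ra rj ex] simp_thms)
  qed
  then show ?thesis using cj u' it by (simp add: cell_def)
qed

context
  fixes l :: nat and i m K :: nat
  assumes K: "m \<le> 2 ^ K" "K < l"
begin

lemma level_ok:
  assumes g: "jumps g m" and ne: "u \<noteq> z" "u \<noteq> 0" "z \<noteq> 0"
    and \<sigma>: "nreg \<sigma> 6 = i" "len \<sigma> i = m" "nreg \<sigma> 7 = 0" "nreg \<sigma> 8 = Suc k"
    and prev: "\<forall>k'\<le>k. \<forall>a\<le>m. cell \<sigma> i u z x m g w k' a"
  shows "ok l (m + 2) (level u z x) \<sigma> (\<lambda>\<sigma>'. \<forall>k'\<le>Suc k. \<forall>a\<le>m. cell \<sigma>' i u z x m g w k' a)"
  unfolding level_def
\<comment> \<open>Positions run through \<open>0, ..., m\<close> including the end marker, hence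
  \<open>Suc m\<close> iterations and the budget \<open>m + 2\<close>.\<close>
proof (rule ok_While[where n = "Suc m" and B' = 1 and I = "\<lambda>n \<sigma>'. n = Suc m - nreg \<sigma>' 7 \<and>
      (\<forall>k' a. (k' \<le> k \<and> a \<le> m) \<or> (k' = Suc k \<and> a < nreg \<sigma>' 7) \<longrightarrow> cell \<sigma>' i u z x m g w k' a)"])
  interpret jumps g m by (rule g)
  have Kl: "(2::nat) ^ K < 2 ^ l" using K(2) by simp
  fix n \<sigma>' assume I: "n = Suc m - nreg \<sigma>' 7 \<and> (\<forall>k' a. (k' \<le> k \<and> a \<le> m) \<or> (k' = Suc k \<and> a < nreg \<sigma>' 7) \<longrightarrow>
      cell \<sigma>' i u z x m g w k' a)"
    and u: "unch (While (Not (NLess LEN (NReg 7))) (level_body u z x)) \<sigma> \<sigma>'"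
  have fr: "nreg \<sigma>' 6 = i" "nreg \<sigma>' 8 = Suc k" "len \<sigma>' i = m" using u \<sigma> ne by (auto simp: unch_def)
  {
    assume "\<not> bval (Not (NLess LEN (NReg 7))) \<sigma>'"
    then show "\<forall>k'\<le>Suc k. \<forall>a\<le>m. cell \<sigma>' i u z x m g w k' a"
      using I fr by (auto simp: le_Suc_eq)
  }
  assume "bval (Not (NLess LEN (NReg 7))) \<sigma>'"
  then have am: "nreg \<sigma>' 7 \<le> m" using fr by simp
  define a where "a = nreg \<sigma>' 7"
  define j where "j = (g ^^ (2 ^ k)) a"
  have jm: "j \<le> m" using am iter_le by (simp add: j_def a_def)
  have ca: "cell \<sigma>' i u z x m g w k a" and cj: "cell \<sigma>' i u z x m g w k j"
    using I am jm by (auto simp: a_def)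
  have uj: "nm \<sigma>' u i k a = j" using ca by (simp add: cell_def j_def)
  have other: "cell \<tau> i u z x m g w k' a'"
    if "cell \<sigma>' i u z x m g w k' a'" "nm \<tau> u i k' a' = nm \<sigma>' u i k' a'"
      "nm \<tau> z i k' a' = nm \<sigma>' z i k' a'" "rm \<tau> x i k' a' = rm \<sigma>' x i k' a'" for \<tau> k' a'
    using that by (simp add: cell_def)
  have a1: "Suc a \<le> 2 ^ l" using am K(1) Kl unfolding a_def by linarith
  let ?later = "nm \<sigma>' z i k j \<noteq> 0 \<and> \<not> (nm \<sigma>' z i k a \<noteq> 0 \<and> rm \<sigma>' x i k j < rm \<sigma>' x i k a)"
  have "ok l 1 (level_body u z x) \<sigma>' (\<lambda>\<tau>. nreg \<tau> 7 = Suc a \<and> nm \<tau> u i (Suc k) a = nm \<sigma>' u i k j \<and>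
      (?later \<longrightarrow> nm \<tau> z i (Suc k) a = nm \<sigma>' z i k j \<and> rm \<tau> x i (Suc k) a = rm \<sigma>' x i k j) \<and>
      (\<not> ?later \<longrightarrow> nm \<tau> z i (Suc k) a = nm \<sigma>' z i k a \<and> rm \<tau> x i (Suc k) a = rm \<sigma>' x i k a) \<and>
      (\<forall>k' a'. (k', a') \<noteq> (Suc k, a) \<longrightarrow> nm \<tau> u i k' a' = nm \<sigma>' u i k' a' \<and>
        nm \<tau> z i k' a' = nm \<sigma>' z i k' a' \<and> rm \<tau> x i k' a' = rm \<sigma>' x i k' a'))"
    unfolding level_body_def
    apply (intro ok_intros)
    using fr uj a1 am ne by (auto simp: a_def[symmetric])
  then have "ok l 1 (level_body u z x) \<sigma>' (\<lambda>\<tau>. nreg \<tau> 7 = Suc a \<and> cell \<tau> i u z x m g w (Suc k) a \<and>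
      (\<forall>k' a'. (k', a') \<noteq> (Suc k, a) \<longrightarrow> cell \<sigma>' i u z x m g w k' a' \<longrightarrow> cell \<tau> i u z x m g w k' a'))"
  proof (rule ok_conseq)
    fix \<tau> :: ram assume A: "nreg \<tau> 7 = Suc a \<and> nm \<tau> u i (Suc k) a = nm \<sigma>' u i k j \<and>
      (?later \<longrightarrow> nm \<tau> z i (Suc k) a = nm \<sigma>' z i k j \<and> rm \<tau> x i (Suc k) a = rm \<sigma>' x i k j) \<and>
      (\<not> ?later \<longrightarrow> nm \<tau> z i (Suc k) a = nm \<sigma>' z i k a \<and> rm \<tau> x i (Suc k) a = rm \<sigma>' x i k a) \<and>
      (\<forall>k' a'. (k', a') \<noteq> (Suc k, a) \<longrightarrow> nm \<tau> u i k' a' = nm \<sigma>' u i k' a' \<and>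
        nm \<tau> z i k' a' = nm \<sigma>' z i k' a' \<and> rm \<tau> x i k' a' = rm \<sigma>' x i k' a')"
    then have \<tau>: "nreg \<tau> 7 = Suc a" "nm \<tau> u i (Suc k) a = nm \<sigma>' u i k j"
      "?later \<longrightarrow> nm \<tau> z i (Suc k) a = nm \<sigma>' z i k j \<and> rm \<tau> x i (Suc k) a = rm \<sigma>' x i k j"
      "\<not> ?later \<longrightarrow> nm \<tau> z i (Suc k) a = nm \<sigma>' z i k a \<and> rm \<tau> x i (Suc k) a = rm \<sigma>' x i k a"
      "\<forall>k' a'. (k', a') \<noteq> (Suc k, a) \<longrightarrow> nm \<tau> u i k' a' = nm \<sigma>' u i k' a' \<and>
        nm \<tau> z i k' a' = nm \<sigma>' z i k' a' \<and> rm \<tau> x i k' a' = rm \<sigma>' x i k' a'"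
      by blast+
    have "cell \<tau> i u z x m g w (Suc k) a"
      by (rule cell_Suc[OF g _ j_def ca cj \<tau>(2) \<tau>(3)[rule_format] \<tau>(4)[rule_format]])
        (use am in \<open>simp_all add: a_def\<close>)
    then show "nreg \<tau> 7 = Suc a \<and> cell \<tau> i u z x m g w (Suc k) a \<and>
      (\<forall>k' a'. (k', a') \<noteq> (Suc k, a) \<longrightarrow> cell \<sigma>' i u z x m g w k' a' \<longrightarrow> cell \<tau> i u z x m g w k' a')"
      using \<tau> other by simp
  qed simp_all
  then have "ok l 1 (level_body u z x) \<sigma>' (\<lambda>\<tau>. m - a = Suc m - nreg \<tau> 7 \<and>
      (\<forall>k' a'. (k' \<le> k \<and> a' \<le> m) \<or> (k' = Suc k \<and> a' < nreg \<tau> 7) \<longrightarrow> cell \<tau> i u z x m g w k' a'))"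
    by (rule ok_conseq) (use I in \<open>auto simp: a_def less_Suc_eq\<close>)
  then show "\<exists>n'. n = Suc n' \<and> ok l 1 (level_body u z x) \<sigma>' (\<lambda>\<tau>. n' = Suc m - nreg \<tau> 7 \<and>
      (\<forall>k' a. (k' \<le> k \<and> a \<le> m) \<or> (k' = Suc k \<and> a < nreg \<tau> 7) \<longrightarrow> cell \<tau> i u z x m g w k' a))"
    using I am by (intro exI[of _ "m - a"]) (auto simp: a_def)
qed (use \<sigma> prev in auto)

lemma levels_ok:
  assumes g: "jumps g m" and ne: "u \<noteq> z" "u \<noteq> 0" "z \<noteq> 0"
    and \<sigma>: "nreg \<sigma> 6 = i" "len \<sigma> i = m" "nreg \<sigma> 3 = K"
    and init: "\<forall>a\<le>m. cell \<sigma> i u z x m g w 0 a"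
  shows "ok l (Suc K * (m + 2)) (levels u z x) \<sigma> (\<lambda>\<sigma>'. table \<sigma>' i u z x m g w K)"
proof -
  have Kl: "(2::nat) ^ K < 2 ^ l" "K < 2 ^ K" using K(2) by auto
  have loop: "ok l (Suc K * (m + 2)) (While (Not (NLess (NReg 3) (NReg 8)))
      (NAssign 7 (NConst 0);; level u z x;; NAssign 8 (Plus (NReg 8) (NConst 1)))) \<sigma>1
      (\<lambda>\<sigma>'. table \<sigma>' i u z x m g w K)"
    if \<sigma>1: "nreg \<sigma>1 8 = 1" "nreg \<sigma>1 6 = i" "len \<sigma>1 i = m" "nreg \<sigma>1 3 = K"
      "\<forall>a\<le>m. cell \<sigma>1 i u z x m g w 0 a" for \<sigma>1
  proof (rule ok_While[where n = K and B' = "m + 2" and I = "\<lambda>n \<sigma>'. \<exists>k. n = K - k \<and> k \<le> K \<and>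
      nreg \<sigma>' 8 = Suc k \<and> (\<forall>k'\<le>k. \<forall>a\<le>m. cell \<sigma>' i u z x m g w k' a)"])
    fix n \<sigma>' assume I: "\<exists>k. n = K - k \<and> k \<le> K \<and>
        nreg \<sigma>' 8 = Suc k \<and> (\<forall>k'\<le>k. \<forall>a\<le>m. cell \<sigma>' i u z x m g w k' a)"
      and u: "unch (While (Not (NLess (NReg 3) (NReg 8)))
        (NAssign 7 (NConst 0);; level u z x;; NAssign 8 (Plus (NReg 8) (NConst 1)))) \<sigma>1 \<sigma>'"
    have fr: "nreg \<sigma>' 6 = i" "len \<sigma>' i = m" "nreg \<sigma>' 3 = K"
      using u \<sigma>1 ne by (auto simp: unch_def)
    obtain k where k: "n = K - k" "k \<le> K" "nreg \<sigma>' 8 = Suc k"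
      "\<forall>k'\<le>k. \<forall>a\<le>m. cell \<sigma>' i u z x m g w k' a" using I by auto
    {
      assume "\<not> bval (Not (NLess (NReg 3) (NReg 8))) \<sigma>'"
      then show "table \<sigma>' i u z x m g w K" using k fr by (simp add: table_def)
    }
    assume "bval (Not (NLess (NReg 3) (NReg 8))) \<sigma>'"
    then have kK: "Suc k \<le> K" using k fr by simp
    then have k2: "Suc (Suc k) \<le> 2 ^ l" using Kl by linarith
    show "\<exists>n'. n = Suc n' \<and> ok l (m + 2) (NAssign 7 (NConst 0);; level u z x;; NAssign 8 (Plus (NReg 8) (NConst 1)))
       \<sigma>' (\<lambda>\<sigma>'. \<exists>k. n' = K - k \<and> k \<le> K \<and> nreg \<sigma>' 8 = Suc k \<and>
         (\<forall>k'\<le>k. \<forall>a\<le>m. cell \<sigma>' i u z x m g w k' a))"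
      apply (rule exI[of _ "K - Suc k"], rule conjI)
      using k kK apply simp
      apply (intro ok_intros, simp)
      apply (rule ok_conseq[OF level_ok[OF g ne, where k = k and w = w]])
      using k fr apply simp_all
      apply (intro ok_intros)
      using kK k2 k(3) by (auto simp: unch_def intro!: exI[of _ "Suc k"])
  qed (use \<sigma>1 in auto)
  show ?thesis
    unfolding levels_def
    apply (intro ok_intros)
    using Kl apply simp
    apply (rule loop)
    using \<sigma> init by auto
qed

end

section \<open>Crossing a preprocessed block\<close>

definition env :: "nat \<Rightarrow> nat \<Rightarrow> nat \<Rightarrow> (nat \<Rightarrow> real) \<Rightarrow> (nat \<Rightarrow> real) \<Rightarrow> nat \<Rightarrow> ram \<Rightarrow> bool" where
  "env l K i s f m \<sigma> \<longleftrightarrow> nreg \<sigma> 6 = i \<and> nreg \<sigma> 3 = K \<and> nreg \<sigma> 4 = 2 ^ K - 1 \<and> len \<sigma> i = m \<and>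
     start \<sigma> i = s \<and> fin \<sigma> i = f \<and> m \<le> 2 ^ K \<and> K < l \<and> block f m"

definition succ_table :: "nat \<Rightarrow> nat \<Rightarrow> (nat \<Rightarrow> real) \<Rightarrow> nat \<Rightarrow> ram \<Rightarrow> bool" where
  "succ_table K i s m \<sigma> \<longleftrightarrow> table \<sigma> i 1 2 2 m (\<lambda>j. min m (Suc j)) (\<lambda>j b. b \<le> s j) K"

definition nxt_table :: "nat \<Rightarrow> nat \<Rightarrow> (nat \<Rightarrow> real) \<Rightarrow> (nat \<Rightarrow> real) \<Rightarrow> nat \<Rightarrow> ram \<Rightarrow> bool" where
  "nxt_table K i s f m \<sigma> \<longleftrightarrow> table \<sigma> i 3 4 3 m (nxt s f m) (block.crossed s f m) K"

text \<open>Nothing is recorded when \<open>N x = m\<close>: no further interval is scheduled then,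
  and the final state still depends on \<open>y\<close>; \<open>land\<close> handles this case
  directly.\<close>

definition entries :: "nat \<Rightarrow> (nat \<Rightarrow> real) \<Rightarrow> (nat \<Rightarrow> real) \<Rightarrow> nat \<Rightarrow> nat \<Rightarrow> ram \<Rightarrow> bool" where
  "entries i s f m j \<sigma> \<longleftrightarrow> (\<forall>x. j \<le> x \<and> x < m \<and> nxt s f m x < m \<longrightarrow>
     rest s f m (Suc (nxt s f m x)) (f (nxt s f m x), f x, 0) = (rm \<sigma> 4 i 0 x, rm \<sigma> 5 i 0 x, nm \<sigma> 5 i 0 x))"

lemma table_cong:
  assumes "\<And>k a. nm \<sigma>' u i k a = nm \<sigma> u i k a" "\<And>k a. nm \<sigma>' z i k a = nm \<sigma> z i k a"
    "\<And>k a. rm \<sigma>' x i k a = rm \<sigma> x i k a"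
  shows "table \<sigma>' i u z x m g w K = table \<sigma> i u z x m g w K"
  by (simp add: table_def cell_def assms)

lemma env_unch:
  assumes "unch c \<sigma> \<sigma>'" "{3, 4, 6} \<inter> nwr c = {}" "0 \<notin> nst c" "0 \<notin> rst c" "1 \<notin> rst c"
  shows "env l K i s f m \<sigma>' = env l K i s f m \<sigma>"
proof -
  have "nreg \<sigma>' 3 = nreg \<sigma> 3" "nreg \<sigma>' 4 = nreg \<sigma> 4" "nreg \<sigma>' 6 = nreg \<sigma> 6" "len \<sigma>' i = len \<sigma> i"
    "start \<sigma>' i = start \<sigma> i" "fin \<sigma>' i = fin \<sigma> i"
    using assms by (auto simp: unch_def)
  then show ?thesis by (simp add: env_def)
qed

lemma succ_table_unch:
  "unch c \<sigma> \<sigma>' \<Longrightarrow> {1, 2} \<inter> nst c = {} \<Longrightarrow> 2 \<notin> rst c \<Longrightarrow> succ_table K i s m \<sigma>' = succ_table K i s m \<sigma>"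
  unfolding succ_table_def by (rule table_cong) (auto simp: unch_def)

lemma nxt_table_unch:
  "unch c \<sigma> \<sigma>' \<Longrightarrow> {3, 4} \<inter> nst c = {} \<Longrightarrow> 3 \<notin> rst c \<Longrightarrow> nxt_table K i s f m \<sigma>' = nxt_table K i s f m \<sigma>"
  unfolding nxt_table_def by (rule table_cong) (auto simp: unch_def)

lemma entries_unch:
  "unch c \<sigma> \<sigma>' \<Longrightarrow> 5 \<notin> nst c \<Longrightarrow> {4, 5} \<inter> rst c = {} \<Longrightarrow> entries i s f m j \<sigma>' = entries i s f m j \<sigma>"
  by (simp add: entries_def unch_def)

lemma entries_mono: "entries i s f m j \<sigma> \<Longrightarrow> j \<le> j' \<Longrightarrow> entries i s f m j' \<sigma>"
  by (simp add: entries_def)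

lemma reg_simps [simp]:
  "p 3 = nreg \<sigma> 3 \<Longrightarrow> p 4 = nreg \<sigma> 4 \<Longrightarrow> p 6 = nreg \<sigma> 6 \<Longrightarrow>
    env l K i s f m (\<sigma>\<lparr>nreg := p\<rparr>) = env l K i s f m \<sigma>"
  "env l K i s f m (\<sigma>\<lparr>rreg := q\<rparr>) = env l K i s f m \<sigma>"
  "succ_table K i s m (\<sigma>\<lparr>nreg := p\<rparr>) = succ_table K i s m \<sigma>"
  "succ_table K i s m (\<sigma>\<lparr>rreg := q\<rparr>) = succ_table K i s m \<sigma>"
  "nxt_table K i s f m (\<sigma>\<lparr>nreg := p\<rparr>) = nxt_table K i s f m \<sigma>"
  "nxt_table K i s f m (\<sigma>\<lparr>rreg := q\<rparr>) = nxt_table K i s f m \<sigma>"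
  "entries i s f m j (\<sigma>\<lparr>nreg := p\<rparr>) = entries i s f m j \<sigma>"
  "entries i s f m j (\<sigma>\<lparr>rreg := q\<rparr>) = entries i s f m j \<sigma>"
  by (simp_all add: env_def succ_table_def nxt_table_def entries_def table_def)

abbreviation "seek \<equiv> lift 1 2 2"

text \<open>Lifting along the successor function searches for the first starting time at or above
  the threshold. As it never leaves the block, it may return the last index untested, so the callers
  compare once more.\<close>

lemma seek_ok:
  assumes "env l K i s f m \<sigma>" "succ_table K i s m \<sigma>" "nreg \<sigma> 7 = a0" "a0 < m" "rreg \<sigma> 4 = b"
  shows "ok l (Suc K) seek \<sigma> (\<lambda>\<sigma>'. \<exists>a. nreg \<sigma>' 7 = a \<and> a0 \<le> a \<and> a < m \<and>
    (\<forall>j. a0 \<le> j \<longrightarrow> j < a \<longrightarrow> s j < b) \<and> (Suc a = m \<or> b \<le> s a) \<and>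
    rep (nreg \<sigma>' 14) (rreg \<sigma>' 5) (\<lambda>b. \<exists>j. a0 \<le> j \<and> j < a \<and> b \<le> s j))"
proof (rule ok_conseq[OF lift_ok])
  show "jumps (\<lambda>j. min m (Suc j)) m" by (rule jumps_Suc)
  fix \<sigma>' :: ram
  assume "\<exists>n a fl acc. nreg \<sigma>' 7 = a \<and> nreg \<sigma>' 10 = n \<and> nreg \<sigma>' 14 = fl \<and> rreg \<sigma>' 5 = acc \<and>
    lifted (\<lambda>j. min m (Suc j)) (\<lambda>j b. b \<le> s j) m a0 b n a fl acc \<and> (min m (Suc a) = m \<or> b \<le> s a)"
  then obtain n a fl acc where *: "nreg \<sigma>' 7 = a" "nreg \<sigma>' 14 = fl" "rreg \<sigma>' 5 = acc"
    "lifted (\<lambda>j. min m (Suc j)) (\<lambda>j b. b \<le> s j) m a0 b n a fl acc" "min m (Suc a) = m \<or> b \<le> s a"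
    by blast
  have am: "a < m" and a: "a = a0 + n"
    using *(4) assms(4) by (auto simp: lifted_def min_Suc_iter split: if_splits)
  have it: "((\<lambda>j. min m (Suc j)) ^^ t) a0 = a0 + t" if "t < n" for t
    using that am a by (simp add: min_Suc_iter)
  have ex: "(\<exists>t<n. P (((\<lambda>j. min m (Suc j)) ^^ t) a0)) \<longleftrightarrow> (\<exists>j. a0 \<le> j \<and> j < a \<and> P j)" for P
  proof safe
    fix t assume "t < n" "P (((\<lambda>j. min m (Suc j)) ^^ t) a0)"
    then show "\<exists>j\<ge>a0. j < a \<and> P j" using it a by (intro exI[of _ "a0 + t"]) simp
  next
    fix j assume "a0 \<le> j" "j < a" "P j"
    then show "\<exists>t<n. P (((\<lambda>j. min m (Suc j)) ^^ t) a0)"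
      using it[of "j - a0"] a by (intro exI[of _ "j - a0"]) auto
  qed
  have "rep fl acc (\<lambda>b. \<exists>j. a0 \<le> j \<and> j < a \<and> b \<le> s j)"
  proof (rule rep_cong)
    show "rep fl acc (\<lambda>b. \<exists>t<n. b \<le> s (((\<lambda>j. min m (Suc j)) ^^ t) a0))"
      using *(4) by (simp add: lifted_def)
  qed (rule ex)
  moreover have "\<forall>j. a0 \<le> j \<longrightarrow> j < a \<longrightarrow> s j < b"
    using *(4) ex[of "\<lambda>j. b \<le> s j"] by (auto simp: lifted_def not_le)
  moreover have "Suc a = m \<or> b \<le> s a" using *(5) am by auto
  ultimately show "\<exists>a. nreg \<sigma>' 7 = a \<and> a0 \<le> a \<and> a < m \<and>
    (\<forall>j. a0 \<le> j \<longrightarrow> j < a \<longrightarrow> s j < b) \<and> (Suc a = m \<or> b \<le> s a) \<and>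
    rep (nreg \<sigma>' 14) (rreg \<sigma>' 5) (\<lambda>b. \<exists>j. a0 \<le> j \<and> j < a \<and> b \<le> s j)"
    using * am a by auto
qed (use assms in \<open>auto simp: env_def succ_table_def\<close>)

definition land :: com where
  "land =
    If (NLess (LD 3 (NConst 0) (NReg 11)) LEN)
      (RAssign 3 (RLD 4 (NConst 0) (NReg 11));; RAssign 4 (RLD 5 (NConst 0) (NReg 11));;
       NAssign 0 (Plus (NReg 0) (Plus (NConst 1) (LD 5 (NConst 0) (NReg 11)))))
      (RAssign 3 (RLD 1 (NConst 0) (NReg 12));; RAssign 4 (RLD 1 (NConst 0) (NReg 11)))"

definition switch :: com where
  "switch =
    If (Not (RLess (RLD 0 (NConst 0) (NReg 7)) (RReg 4)))
      (NAssign 0 (Plus (NReg 0) (NConst 1));; NAssign 12 (NReg 7);; meet_com;; land)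
      Skip"

definition follow :: com where
  "follow =
    NAssign 0 (Plus (NReg 0) (NReg 10));; NAssign 11 (NReg 7);;
    RAssign 3 (RLD 1 (NConst 0) (NReg 11));;
    If (NLess (Plus (NReg 7) (NConst 1)) LEN)
      (NAssign 7 (Plus (NReg 7) (NConst 1));; seek;; switch)
      Skip"

definition advance :: com where
  "advance = lift 3 4 3;; follow"

definition enter :: com where
  "enter =
    If (Not (RLess (RLD 0 (NConst 0) (NReg 7)) (RReg 4)))
      (NAssign 0 (Plus (NReg 0) (NConst 1));;
       If (RLess (RLD 0 (NConst 0) (NReg 7)) (RReg 3)) (RAssign 4 (RReg 3)) Skip;;
       advance)
      Skip"

definition cross :: com where
  "cross = If (NLess (NConst 0) LEN) (NAssign 7 (NConst 0);; seek;; enter) Skip"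

lemma cross_frame [simp]:
  "nwr land = {0}" "rwr land = {3, 4}" "nst land = {}" "rst land = {}" "local land"
  "nwr switch = {0, 8, 9, 11, 12, 15}" "rwr switch = {3, 4}" "nst switch = {}" "rst switch = {}"
    "local switch"
  "nwr advance = {0, 7, 8, 9, 10, 11, 12, 14, 15}" "rwr advance = {3, 4, 5}"
  "nst advance = {}" "rst advance = {}" "local advance"
  "nwr cross = {0, 7, 8, 9, 10, 11, 12, 14, 15}" "rwr cross = {3, 4, 5}"
  "nst cross = {}" "rst cross = {}" "local cross"
  by (auto simp: land_def switch_def follow_def advance_def enter_def cross_def)

context
  fixes l K i m :: nat and s f :: "nat \<Rightarrow> real"
begin

abbreviation "result st \<sigma> \<equiv> (rreg \<sigma> 3, rreg \<sigma> 4, nreg \<sigma> 0) = st"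

lemma land_ok:
  assumes "env l K i s f m \<sigma>" "nxt_table K i s f m \<sigma>" "entries i s f m x \<sigma>"
    and x: "nreg \<sigma> 11 = x" "nreg \<sigma> 12 = y" "x < y" "y < nxt s f m x" "nxt s f m x = nxt s f m y"
    and c: "snd (snd (rest s f m (Suc y) (f y, f x, nreg \<sigma> 0))) \<le> 2 ^ l"
  shows "ok l B land \<sigma> (result (rest s f m (Suc y) (f y, f x, nreg \<sigma> 0)))"
proof -
  define c0 where "c0 = nreg \<sigma> 0"
  interpret block s f m using assms(1) by (simp add: env_def)
  have m: "y < m" "x < m" using x nxt_le[of s f m x] by auto
  have N: "nm \<sigma> 3 i 0 x = N x"
    using assms(2) m by (auto simp: nxt_table_def table_def cell_def)
  have e: "nreg \<sigma> 6 = i" "len \<sigma> i = m" "\<And>j. rm \<sigma> 1 i 0 j = f j"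
    using assms(1) by (auto simp: env_def)
  have G: "G (Suc y) (f y, f x, c0) =
      (if N x < m then (rm \<sigma> 4 i 0 x, rm \<sigma> 5 i 0 x, Suc c0 + nm \<sigma> 5 i 0 x) else (f y, f x, c0))"
    using meet[OF x(3-5), of c0] assms(3) m rest_count[of s f m "Suc (N x)" "f (N x)" "f x" _ _ _ "Suc c0"]
    by (auto simp: entries_def)
  show ?thesis
    unfolding land_def
    apply (intro ok_intros)
    using e N x G c by (auto simp: c0_def[symmetric])
qed

text \<open>The entries are needed only from \<open>a\<close> on, so the same routine serves for
  queries and for filling that table from right to left. The time \<open>b\<close> is arbitrary: it
  may come from an earlier block.\<close>

lemma advance_ok:
  assumes env: "env l K i s f m \<sigma>" and tables: "succ_table K i s m \<sigma>" "nxt_table K i s f m \<sigma>"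
    and entries: "entries i s f m a \<sigma>"
    and a: "nreg \<sigma> 7 = a" "a < m" and b: "rreg \<sigma> 4 = b" "b \<le> f a" and c: "nreg \<sigma> 0 = c" "c + 2 * m \<le> 2 ^ l"
  shows "ok l (Suc K) advance \<sigma> (result (rest s f m (Suc a) (f a, b, c)))"
proof -
  interpret block s f m using env by (simp add: env_def)
  have K: "m \<le> 2 ^ K" "K < l" using env by (auto simp: env_def)
  have ml: "m < 2 ^ l" using K by (meson le_less_trans nat_power_less_imp_less power_strict_increasing one_less_numeral_iff semiring_norm(76))
  have total: "snd (snd (G (Suc a) (f a, b, c))) \<le> 2 ^ l"
    using rest_le[of s f m "Suc a" "f a" b c] c by linarith
  \<comment> \<open>The counter never decreases, so an intermediate value is at most the final
    one.\<close>
  have mid: "c' \<le> c + (m - Suc a)" if "G (Suc a) (f a, b, c) = G j (A, B, c')" for j A B c'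
    using rest_ge[of c' s f m j A B] rest_le[of s f m "Suc a" "f a" b c] that by simp
  have switch: "ok l (Suc K) switch \<sigma>' (result (G (Suc a) (f a, b, c)))"
    if "env l K i s f m \<sigma>'" "nxt_table K i s f m \<sigma>'" "entries i s f m a \<sigma>'"
      and x: "nreg \<sigma>' 11 = x" "a \<le> x" "x < m" and y: "nreg \<sigma>' 7 = y" "x < y" "y < m"
      and skip: "\<forall>j. Suc x \<le> j \<longrightarrow> j < y \<longrightarrow> s j < b" and last: "Suc y = m \<or> b \<le> s y"
      and stop: "N x = m \<or> crossed x b"
      and b': "rreg \<sigma>' 4 = b" "b \<le> f x" and A: "rreg \<sigma>' 3 = f x" and c': "nreg \<sigma>' 0 = c'"
      and eq: "G (Suc a) (f a, b, c) = G (Suc x) (f x, b, c')" for \<sigma>' x y c'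
  proof (cases "b \<le> s y")
    case False
    then have "\<forall>j. Suc x \<le> j \<longrightarrow> j < m \<longrightarrow> s j < b" using skip last by (auto simp: not_le less_Suc_eq)
    then have "G (Suc x) (f x, b, c') = (f x, b, c')" using rest_none x b' by simp
    then show ?thesis
      unfolding switch_def
      apply (intro ok_intros)
      using that False eq by (auto simp: env_def)
  next
    case True
    \<comment> \<open>Otherwise \<open>N x < m\<close>, so lifting stopped because of a crossing
      index below \<open>N x\<close>, and the search would have found that index before
      \<open>y\<close>.\<close>
    have lt: "y < N x"
    proof (rule ccontr)
      assume "\<not> y < N x"
      then have "N x < m" using y by simp
      then obtain j where j: "x < j" "j < N x" "b \<le> s j" using stop by (auto simp: crossed_def)
      then have "s j < b" using skip \<open>\<not> y < N x\<close> by simp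
      with j show False by simp
    qed
    then have eq': "G (Suc a) (f a, b, c) = G (Suc y) (f y, f x, Suc c')"
      using eq rest_cross[of x y b c'] y b' True nxt_between[of x y s f m] skip by simp
    have c1: "Suc c' \<le> 2 ^ l" "Suc c' + m \<le> 2 ^ l" using mid[OF eq'] c a(2) by linarith+
    have apart: "apart x y 0" using lt y by (simp add: apart_0)
    let ?\<sigma> = "\<sigma>'\<lparr>nreg := (nreg \<sigma>')(0 := Suc c', 12 := y)\<rparr>"
    have e: "env l K i s f m ?\<sigma>" "nxt_table K i s f m ?\<sigma>" "entries i s f m a ?\<sigma>"
      using that by (auto simp: env_def)
    have meet: "ok l (Suc K) (meet_com;; land) ?\<sigma> (result (G (Suc a) (f a, b, c)))"
    proof (rule ok_Seq, rule ok_conseq[OF meet_ok])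
      show "table ?\<sigma> i 3 4 3 m N crossed K" using e(2) by (simp add: nxt_table_def)
      fix \<tau> :: ram assume "\<exists>x1 y1 c1. nreg \<tau> 11 = x1 \<and> nreg \<tau> 12 = y1 \<and> nreg \<tau> 0 = c1 \<and>
        x \<le> x1 \<and> x1 < y1 \<and> y1 < N x1 \<and> N x1 = N y1 \<and>
        G (Suc y) (f y, f x, Suc c') = G (Suc y1) (f y1, f x1, c1)"
      then obtain x1 y1 c1 where *: "nreg \<tau> 11 = x1" "nreg \<tau> 12 = y1" "nreg \<tau> 0 = c1"
        "x \<le> x1" "x1 < y1" "y1 < N x1" "N x1 = N y1"
        "G (Suc y) (f y, f x, Suc c') = G (Suc y1) (f y1, f x1, c1)" by blast
      assume u: "unch meet_com ?\<sigma> \<tau>"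
      have "entries i s f m x1 \<tau>"
        using entries_unch[OF u] e(3) * x by (auto elim: entries_mono)
      then show "ok l (Suc K) land \<tau> (result (G (Suc a) (f a, b, c)))"
        using land_ok[of \<tau> x1 y1 "Suc K"] * env_unch[OF u] nxt_table_unch[OF u] e eq' total by simp
    qed (use that e K c1 apart in \<open>auto simp: env_def\<close>)
    show ?thesis
      unfolding switch_def
      apply (rule ok_If)
       apply (rule ok_Seq, rule ok_NAssign)
      using c1 c' apply simp
       apply (rule ok_Seq, rule ok_NAssign)
      using meet c' y that(1) True b' by (auto simp: env_def intro: ok_Skip)
  qed
  have tl: "ok l (Suc K) follow \<sigma>' (result (G (Suc a) (f a, b, c)))"
    if e: "env l K i s f m \<sigma>'" "succ_table K i s m \<sigma>'" "nxt_table K i s f m \<sigma>'" "entries i s f m a \<sigma>'"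
      and r: "nreg \<sigma>' 7 = x" "nreg \<sigma>' 10 = n" "nreg \<sigma>' 0 = c" "rreg \<sigma>' 4 = b"
      and lifted: "lifted N crossed m a b n x fl acc" and stop: "N x = m \<or> crossed x b"
    for \<sigma>' n x fl acc
  proof -
    have x: "x = (N ^^ n) a" "x < m" "\<forall>t<n. \<not> crossed ((N ^^ t) a) b"
      using lifted by (auto simp: lifted_def)
    have eq: "G (Suc a) (f a, b, c) = G (Suc x) (f x, b, c + n)"
      using rest_follow[OF a(2) b(2), of n c] x by simp
    have cn: "c + n \<le> 2 ^ l" using mid[OF eq] c by linarith
    have ax: "a \<le> x" using iter_mono[of 0 n a] a x by simp
    then have bx: "b \<le> f x" using incr[of a x] b(2) x(2) by (cases "a = x") auto
    let ?\<sigma> = "\<sigma>'\<lparr>rreg := (rreg \<sigma>')(3 := f x), nreg := (nreg \<sigma>')(0 := c + n, 11 := x, 7 := Suc x)\<rparr>"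
    have e': "env l K i s f m ?\<sigma>" "succ_table K i s m ?\<sigma>" "nxt_table K i s f m ?\<sigma>" "entries i s f m a ?\<sigma>"
      using e by (auto simp: env_def)
    have main: "ok l (Suc K) seek ?\<sigma> (\<lambda>\<tau>. ok l (Suc K) switch \<tau> (result (G (Suc a) (f a, b, c))))"
      if "Suc x < m"
    proof (rule ok_conseq[OF seek_ok[OF e'(1,2)]])
      fix \<tau> :: ram assume *: "\<exists>y. nreg \<tau> 7 = y \<and> Suc x \<le> y \<and> y < m \<and>
        (\<forall>j. Suc x \<le> j \<longrightarrow> j < y \<longrightarrow> s j < b) \<and> (Suc y = m \<or> b \<le> s y) \<and>
        rep (nreg \<tau> 14) (rreg \<tau> 5) (\<lambda>b. \<exists>j. Suc x \<le> j \<and> j < y \<and> b \<le> s j)"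
      assume u: "unch seek ?\<sigma> \<tau>"
      have "nreg \<tau> 11 = x" "rreg \<tau> 4 = b" "rreg \<tau> 3 = f x" "nreg \<tau> 0 = c + n"
        using u r by (auto simp: unch_def)
      moreover obtain y where "nreg \<tau> 7 = y" "Suc x \<le> y" "y < m"
        "\<forall>j. Suc x \<le> j \<longrightarrow> j < y \<longrightarrow> s j < b" "Suc y = m \<or> b \<le> s y"
        using * by blast
      ultimately show "ok l (Suc K) switch \<tau> (result (G (Suc a) (f a, b, c)))"
        by (intro switch[of \<tau> x y "c + n"])
          (use x(2) ax bx stop eq in \<open>simp_all add: e' env_unch[OF u] nxt_table_unch[OF u]
            entries_unch[OF u] del: reg_simps\<close>)
    qed (use r that in auto)
    have last: "G (Suc a) (f a, b, c) = (f x, b, c + n)" if "\<not> Suc x < m"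
    proof -
      have "Suc x = m" using that x(2) by simp
      then show ?thesis using eq by (simp add: rest_end)
    qed
    have fx: "rm \<sigma>' 1 i 0 x = f x" "nreg \<sigma>' 6 = i" "len \<sigma>' i = m" using e(1) by (auto simp: env_def)
    show ?thesis
      unfolding follow_def
      apply (intro ok_intros)
      using r cn fx last main ml by (auto)
  qed
  show ?thesis
    unfolding advance_def
  proof (rule ok_Seq, rule ok_conseq[OF lift_ok])
    show "table \<sigma> i 3 4 3 m N crossed K" using tables by (simp add: nxt_table_def)
    fix \<sigma>' :: ram assume *: "\<exists>n x fl acc. nreg \<sigma>' 7 = x \<and> nreg \<sigma>' 10 = n \<and> nreg \<sigma>' 14 = fl \<and> rreg \<sigma>' 5 = acc \<and>
      lifted N crossed m a b n x fl acc \<and> (N x = m \<or> crossed x b)"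
    assume u: "unch (lift 3 4 3) \<sigma> \<sigma>'"
    have "rreg \<sigma>' 4 = b" "nreg \<sigma>' 0 = c" using u b c by (auto simp: unch_def)
    moreover obtain n x fl acc where "nreg \<sigma>' 7 = x" "nreg \<sigma>' 10 = n"
      "lifted N crossed m a b n x fl acc" "N x = m \<or> crossed x b" using * by blast
    ultimately show "ok l (Suc K) follow \<sigma>' (result (G (Suc a) (f a, b, c)))"
      by (intro tl[of \<sigma>' x n fl acc])
        (simp_all add: env tables entries env_unch[OF u] nxt_table_unch[OF u] succ_table_unch[OF u]
          entries_unch[OF u] del: reg_simps)
  qed (use env a b jumps_nxt in \<open>auto simp: env_def\<close>)
qed

text \<open>Since \<open>B \<le> A\<close>, the first accepted interval is the first one that does
  not start before \<open>B\<close>. From then on the later machine is at an index of the block, and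
  \<open>A \<le> f 0\<close> keeps the two finishing times ordered.\<close>

lemma cross_ok:
  assumes env: "env l K i s f m \<sigma>" and tables: "succ_table K i s m \<sigma>" "nxt_table K i s f m \<sigma>"
    and entries: "entries i s f m 0 \<sigma>"
    and AB: "rreg \<sigma> 3 = A" "rreg \<sigma> 4 = B" "B \<le> A" "0 < m \<longrightarrow> A \<le> f 0" and c: "nreg \<sigma> 0 = c" "c + 2 * m < 2 ^ l"
  shows "ok l (Suc K) cross \<sigma> (result (rest s f m 0 (A, B, c)))"
proof (cases "m = 0")
  case True
  then show ?thesis
    unfolding cross_def
    apply (intro ok_If ok_Skip)
    using env AB c by (auto simp: env_def rest_def)
next
  case False
  interpret block s f m using env by (simp add: env_def)
  let ?\<sigma> = "\<sigma>\<lparr>nreg := (nreg \<sigma>)(7 := 0)\<rparr>"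
  have e': "env l K i s f m ?\<sigma>" "succ_table K i s m ?\<sigma>" "nxt_table K i s f m ?\<sigma>" "entries i s f m 0 ?\<sigma>"
    using env tables entries by (auto simp: env_def)
  have tl: "ok l (Suc K) enter \<sigma>' (result (G 0 (A, B, c)))"
    if e: "env l K i s f m \<sigma>'" "succ_table K i s m \<sigma>'" "nxt_table K i s f m \<sigma>'" "entries i s f m 0 \<sigma>'"
      and r: "nreg \<sigma>' 7 = a" "nreg \<sigma>' 0 = c" "rreg \<sigma>' 4 = B" "rreg \<sigma>' 3 = A" "a < m"
      "\<forall>j. 0 \<le> j \<longrightarrow> j < a \<longrightarrow> s j < B" "Suc a = m \<or> B \<le> s a" for \<sigma>' a
  proof -
    have sa: "rm \<sigma>' 0 i 0 a = s a" "nreg \<sigma>' 6 = i" using e(1) by (auto simp: env_def)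
    have skip: "G 0 (A, B, c) = G a (A, B, c)" using r AB by (intro rest_skip) auto
    have "f 0 \<le> f a" using incr[of 0 a] r(5) by (cases "a = 0") auto
    then have Af: "A \<le> f a" using AB False by simp
    \<comment> \<open>\<open>b\<close> is the finishing time of the machine that does not take
      interval \<open>a\<close>.\<close>
    define b where "b = (if s a < A then A else B)"
    have step: "G 0 (A, B, c) = (if B \<le> s a then G (Suc a) (f a, b, Suc c) else (A, B, c))"
    proof (cases "B \<le> s a")
      case False
      then have "Suc a = m" using r by auto
      then show ?thesis using skip r(5) False AB by (auto simp: rest_step rest_end)
    qed (use skip r(5) AB in \<open>auto simp: rest_step b_def\<close>)
    have bf: "b \<le> f a" using Af AB by (simp add: b_def)
    have ent: "entries i s f m a \<sigma>'" using e(4) by (simp add: entries_def)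
    show ?thesis
      unfolding enter_def
      apply (intro ok_intros)
      using e ent sa r c step Af AB(3) by (auto simp: b_def intro!: advance_ok)
  qed
  have "ok l (Suc K) seek ?\<sigma> (\<lambda>\<tau>. ok l (Suc K) enter \<tau> (result (G 0 (A, B, c))))"
  proof (rule ok_conseq[OF seek_ok[OF e'(1,2)]])
    fix \<tau> :: ram assume *: "\<exists>a. nreg \<tau> 7 = a \<and> 0 \<le> a \<and> a < m \<and>
      (\<forall>j. 0 \<le> j \<longrightarrow> j < a \<longrightarrow> s j < B) \<and> (Suc a = m \<or> B \<le> s a) \<and>
      rep (nreg \<tau> 14) (rreg \<tau> 5) (\<lambda>b. \<exists>j. 0 \<le> j \<and> j < a \<and> b \<le> s j)"
      and u: "unch seek ?\<sigma> \<tau>"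
    have "nreg \<tau> 0 = c" "rreg \<tau> 4 = B" "rreg \<tau> 3 = A" using u AB c by (auto simp: unch_def)
    moreover obtain a where "nreg \<tau> 7 = a" "a < m" "\<forall>j. 0 \<le> j \<longrightarrow> j < a \<longrightarrow> s j < B" "Suc a = m \<or> B \<le> s a"
      using * by blast
    ultimately show "ok l (Suc K) enter \<tau> (result (G 0 (A, B, c)))"
      by (intro tl[of \<tau> a])
        (simp_all add: e' env_unch[OF u] nxt_table_unch[OF u] succ_table_unch[OF u] entries_unch[OF u] del: reg_simps)
  qed (use AB False in auto)
  then show ?thesis
    unfolding cross_def
    apply (intro ok_intros)
    using False env by (simp_all add: env_def)
qed

end

section \<open>Preprocessing a block\<close>

definition succ_loop :: com where
  "succ_loop =
    While (NLess (NReg 7) LEN)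
      (ST 1 (NConst 0) (NReg 7) (Plus (NReg 7) (NConst 1));;
       ST 2 (NConst 0) (NReg 7) (NConst 1);;
       RST 2 (NConst 0) (NReg 7) (RLD 0 (NConst 0) (NReg 7));;
       NAssign 7 (Plus (NReg 7) (NConst 1)))"

definition init_succ :: com where
  "init_succ = NAssign 7 (NConst 0);; succ_loop;; ST 1 (NConst 0) (NReg 7) (NReg 7)"

definition find_nxt :: com where
  "find_nxt =
    NAssign 7 (Plus (NReg 13) (NConst 1));;
    If (NLess (NReg 7) LEN)
      (RAssign 4 (RLD 1 (NConst 0) (NReg 13));; seek;;
       If (RLess (RLD 0 (NConst 0) (NReg 7)) (RReg 4)) (NAssign 7 LEN) Skip)
      Skip"

definition nxt_body :: com where
  "nxt_body =
    find_nxt;;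
    ST 3 (NConst 0) (NReg 13) (NReg 7);;
    ST 4 (NConst 0) (NReg 13) (NReg 14);;
    RST 3 (NConst 0) (NReg 13) (RReg 5);;
    NAssign 13 (Plus (NReg 13) (NConst 1))"

definition nxt_loop :: com where
  "nxt_loop = While (NLess (NReg 13) LEN) nxt_body"

definition init_nxt :: com where
  "init_nxt = NAssign 13 (NConst 0);; nxt_loop;; ST 3 (NConst 0) (NReg 13) (NReg 13)"

definition entry_body :: com where
  "entry_body =
    NAssign 13 (Minus (NReg 13) (NConst 1));;
    NAssign 7 (LD 3 (NConst 0) (NReg 13));;
    If (NLess (NReg 7) LEN)
      (RAssign 4 (RLD 1 (NConst 0) (NReg 13));;
       NAssign 0 (NConst 0);;
       advance;;
       RST 4 (NConst 0) (NReg 13) (RReg 3);;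
       RST 5 (NConst 0) (NReg 13) (RReg 4);;
       ST 5 (NConst 0) (NReg 13) (NReg 0))
      Skip"

definition entry_loop :: com where
  "entry_loop = While (NLess (NConst 0) (NReg 13)) entry_body"

definition build :: com where
  "build =
    init_succ;; levels 1 2 2;; init_nxt;; levels 3 4 3;;
    NAssign 13 LEN;; entry_loop"

lemma build_frame [simp]:
  "nwr succ_loop = {7}" "rwr succ_loop = {}" "nst succ_loop = {1, 2}" "rst succ_loop = {2}" "local succ_loop"
  "nwr init_succ = {7}" "rwr init_succ = {}" "nst init_succ = {1, 2}" "rst init_succ = {2}" "local init_succ"
  "nwr find_nxt = {7, 8, 9, 10, 14}" "rwr find_nxt = {4, 5}" "nst find_nxt = {}" "rst find_nxt = {}"
    "local find_nxt"
  "nwr nxt_body = {7, 8, 9, 10, 13, 14}" "rwr nxt_body = {4, 5}" "nst nxt_body = {3, 4}" "rst nxt_body = {3}"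
    "local nxt_body"
  "nwr nxt_loop = {7, 8, 9, 10, 13, 14}" "rwr nxt_loop = {4, 5}" "nst nxt_loop = {3, 4}" "rst nxt_loop = {3}"
    "local nxt_loop"
  "nwr init_nxt = {7, 8, 9, 10, 13, 14}" "rwr init_nxt = {4, 5}" "nst init_nxt = {3, 4}" "rst init_nxt = {3}"
    "local init_nxt"
  "nwr entry_body = {0, 7, 8, 9, 10, 11, 12, 13, 14, 15}" "rwr entry_body = {3, 4, 5}" "nst entry_body = {5}"
    "rst entry_body = {4, 5}" "local entry_body"
  "nwr entry_loop = {0, 7, 8, 9, 10, 11, 12, 13, 14, 15}" "rwr entry_loop = {3, 4, 5}" "nst entry_loop = {5}"
    "rst entry_loop = {4, 5}" "local entry_loop"
  "nwr build = {0, 7, 8, 9, 10, 11, 12, 13, 14, 15}" "rwr build = {3, 4, 5}"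
  "nst build = {1, 2, 3, 4, 5}" "rst build = {2, 3, 4, 5}" "local build"
  by (auto simp: succ_loop_def init_succ_def find_nxt_def nxt_body_def nxt_loop_def init_nxt_def
      entry_body_def entry_loop_def build_def)

definition built :: "nat \<Rightarrow> nat \<Rightarrow> (nat \<Rightarrow> real) \<Rightarrow> (nat \<Rightarrow> real) \<Rightarrow> nat \<Rightarrow> ram \<Rightarrow> bool" where
  "built K i s f m \<sigma> \<longleftrightarrow> succ_table K i s m \<sigma> \<and> nxt_table K i s f m \<sigma> \<and> entries i s f m 0 \<sigma>"

context
  fixes l K i m :: nat and s f :: "nat \<Rightarrow> real"
begin

lemma env_bounds: "env l K i s f m \<sigma> \<Longrightarrow> Suc m \<le> 2 ^ l" "env l K i s f m \<sigma> \<Longrightarrow> 2 * m \<le> 2 ^ l"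
proof -
  assume "env l K i s f m \<sigma>"
  then have "m \<le> 2 ^ K" "K < l" by (auto simp: env_def)
  moreover from this have "(2::nat) ^ Suc K \<le> 2 ^ l" by (intro power_increasing) auto
  moreover have "(1::nat) \<le> 2 ^ K" by simp
  ultimately show "Suc m \<le> 2 ^ l" "2 * m \<le> 2 ^ l" unfolding power_Suc by linarith+
qed

lemma init_succ_ok:
  assumes env: "env l K i s f m \<sigma>"
  shows "ok l (Suc m) init_succ \<sigma>
    (\<lambda>\<sigma>'. \<forall>a\<le>m. cell \<sigma>' i 1 2 2 m (\<lambda>j. min m (Suc j)) (\<lambda>j b. b \<le> s j) 0 a)"
proof -
  note bounds = env_bounds[OF env]
  have loop: "ok l (Suc m) succ_loop (\<sigma>\<lparr>nreg := (nreg \<sigma>)(7 := 0)\<rparr>) (\<lambda>\<sigma>'. nreg \<sigma>' 7 = m \<and>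
      (\<forall>a<m. nm \<sigma>' 1 i 0 a = Suc a \<and> nm \<sigma>' 2 i 0 a = 1 \<and> rm \<sigma>' 2 i 0 a = s a))"
    unfolding succ_loop_def
  proof (rule ok_While[where n = m and B' = 1 and I = "\<lambda>n \<sigma>'. n = m - nreg \<sigma>' 7 \<and> nreg \<sigma>' 7 \<le> m \<and>
      (\<forall>a<nreg \<sigma>' 7. nm \<sigma>' 1 i 0 a = Suc a \<and> nm \<sigma>' 2 i 0 a = 1 \<and> rm \<sigma>' 2 i 0 a = s a)"], goal_cases)
    case (2 n \<sigma>')
    then have "env l K i s f m \<sigma>'" using env by (auto dest!: env_unch simp: env_def)
    then show ?case
      using 2 bounds
      apply (intro exI[of _ "n - 1"] conjI)
       apply (simp add: env_def)
      apply (intro ok_intros)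
      by (auto simp: env_def less_Suc_eq)
  next
    case (3 n \<sigma>')
    then have "env l K i s f m \<sigma>'" using env by (auto dest!: env_unch simp: env_def)
    then show ?case using 3 by (auto simp: env_def)
  qed auto
  show ?thesis
    unfolding init_succ_def
    apply (rule ok_Seq, rule ok_NAssign, simp)
    apply (rule ok_Seq, simp, rule ok_conseq[OF loop])
      apply simp_all
    apply (intro ok_intros)
    using env by (auto simp: cell_def rep_def env_def unch_def le_less)
qed

text \<open>The search for \<open>N j\<close> has threshold \<open>f j\<close> and passes exactly
  the indices strictly between \<open>j\<close> and \<open>N j\<close> when it succeeds. The maximum
  collected on the way is therefore the weight of the step from \<open>j\<close>. When it fails, the
  last index is missing from the maximum, but the weight of a step to \<open>m\<close> is never
  relied upon.\<close>

lemma find_nxt_ok: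
  assumes env: "env l K i s f m \<sigma>" "succ_table K i s m \<sigma>" and j: "nreg \<sigma> 13 = j" "j < m"
  shows "ok l (Suc K) find_nxt \<sigma> (\<lambda>\<sigma>'. nreg \<sigma>' 7 = nxt s f m j \<and>
    (nxt s f m j < m \<longrightarrow> rep (nreg \<sigma>' 14) (rreg \<sigma>' 5) (block.crossed s f m j)))"
proof -
  interpret block s f m using env by (simp add: env_def)
  note bounds = env_bounds[OF env(1)]
  have e: "nreg \<sigma> 6 = i" "len \<sigma> i = m" "\<And>j. rm \<sigma> 1 i 0 j = f j" using env by (auto simp: env_def)
  have last: "N j = m" if "\<not> Suc j < m" using that j nxt_gt[of j m s f] nxt_le[of s f m j] by simp
  have main: "ok l (Suc K) seek (\<sigma>\<lparr>nreg := (nreg \<sigma>)(7 := Suc j), rreg := (rreg \<sigma>)(4 := f j)\<rparr>)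
      (\<lambda>\<tau>. ok l (Suc K) (If (RLess (RLD 0 (NConst 0) (NReg 7)) (RReg 4)) (NAssign 7 LEN) Skip) \<tau>
        (\<lambda>\<sigma>'. nreg \<sigma>' 7 = N j \<and> (N j < m \<longrightarrow> rep (nreg \<sigma>' 14) (rreg \<sigma>' 5) (crossed j))))"
    if "Suc j < m"
  proof (rule ok_conseq[OF seek_ok])
    fix \<tau> :: ram
    assume *: "\<exists>a. nreg \<tau> 7 = a \<and> Suc j \<le> a \<and> a < m \<and>
      (\<forall>k. Suc j \<le> k \<longrightarrow> k < a \<longrightarrow> s k < f j) \<and> (Suc a = m \<or> f j \<le> s a) \<and>
      rep (nreg \<tau> 14) (rreg \<tau> 5) (\<lambda>b. \<exists>k. Suc j \<le> k \<and> k < a \<and> b \<le> s k)"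
      and u: "unch seek (\<sigma>\<lparr>nreg := (nreg \<sigma>)(7 := Suc j), rreg := (rreg \<sigma>)(4 := f j)\<rparr>) \<tau>"
    then obtain a where a: "nreg \<tau> 7 = a" "Suc j \<le> a" "a < m"
      "\<And>k. Suc j \<le> k \<Longrightarrow> k < a \<Longrightarrow> s k < f j" "Suc a = m \<or> f j \<le> s a"
      "rep (nreg \<tau> 14) (rreg \<tau> 5) (\<lambda>b. \<exists>k. Suc j \<le> k \<and> k < a \<and> b \<le> s k)" by blast
    have t: "nreg \<tau> 6 = i" "len \<tau> i = m" "rreg \<tau> 4 = f j" "rm \<tau> 0 i 0 a = s a"
      using u env by (auto simp: unch_def env_def)
    have hit: "N j = a" if "f j \<le> s a" using a that by (intro nxt_eqI) auto
    have miss: "N j = m" if "s a < f j"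
    proof (rule nxt_eqI)
      fix k assume "j < k" "k < m"
      then show "s k < f j" using a that by (cases "k = a") auto
    qed (use j in auto)
    have "rep (nreg \<tau> 14) (rreg \<tau> 5) (crossed j)" if "N j < m"
      using a(6)
    proof (rule rep_cong)
      have "N j = a" using hit miss that by fastforce
      then show "(\<exists>k\<ge>Suc j. k < a \<and> b \<le> s k) \<longleftrightarrow> crossed j b" for b by (auto simp: crossed_def Suc_le_eq)
    qed
    then show "ok l (Suc K) (If (RLess (RLD 0 (NConst 0) (NReg 7)) (RReg 4)) (NAssign 7 LEN) Skip) \<tau>
        (\<lambda>\<sigma>'. nreg \<sigma>' 7 = N j \<and> (N j < m \<longrightarrow> rep (nreg \<sigma>' 14) (rreg \<sigma>' 5) (crossed j)))"
      apply (intro ok_intros)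
      using t a(1) hit miss by (auto simp: not_less)
  qed (use env that in auto)
  show ?thesis
    unfolding find_nxt_def
    apply (intro ok_intros)
    using e j last main bounds by auto
qed

lemma init_nxt_ok:
  assumes env: "env l K i s f m \<sigma>" "succ_table K i s m \<sigma>"
  shows "ok l (Suc K * (m + 2)) init_nxt \<sigma> (\<lambda>\<sigma>'. \<forall>a\<le>m. cell \<sigma>' i 3 4 3 m (nxt s f m) (block.crossed s f m) 0 a)"
proof -
  interpret block s f m using env by (simp add: env_def)
  note bounds = env_bounds[OF env(1)]
  have B: "Suc m * Suc K \<le> Suc K * (m + 2)" by simp
  have cell: "cell \<tau> i 3 4 3 m N crossed 0 a \<longleftrightarrow>
      nm \<tau> 3 i 0 a = N a \<and> (N a < m \<longrightarrow> rep (nm \<tau> 4 i 0 a) (rm \<tau> 3 i 0 a) (crossed a))" for \<tau> a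
    by (simp add: cell_def)
  have loop: "ok l (Suc K * (m + 2)) nxt_loop (\<sigma>\<lparr>nreg := (nreg \<sigma>)(13 := 0)\<rparr>) (\<lambda>\<sigma>'. nreg \<sigma>' 13 = m \<and>
      (\<forall>a<m. cell \<sigma>' i 3 4 3 m N crossed 0 a))"
    unfolding nxt_loop_def
  proof (rule ok_While[where n = m and B' = "Suc K" and I = "\<lambda>n \<sigma>'. n = m - nreg \<sigma>' 13 \<and> nreg \<sigma>' 13 \<le> m \<and>
      (\<forall>a<nreg \<sigma>' 13. cell \<sigma>' i 3 4 3 m N crossed 0 a)"], goal_cases)
    case (2 n \<sigma>')
    have e: "env l K i s f m \<sigma>'" "succ_table K i s m \<sigma>'"
      using env env_unch[OF 2(2)] succ_table_unch[OF 2(2)] by auto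
    define j where "j = nreg \<sigma>' 13"
    have jm: "j < m" using 2(3) e by (simp add: env_def j_def)
    have "ok l (Suc K) nxt_body \<sigma>' (\<lambda>\<sigma>'. nreg \<sigma>' 13 = Suc j \<and> (\<forall>a<Suc j. cell \<sigma>' i 3 4 3 m N crossed 0 a))"
      unfolding nxt_body_def
    proof (rule ok_Seq, rule ok_conseq[OF find_nxt_ok[OF e j_def[symmetric] jm]], goal_cases)
      case (3 \<tau>)
      have "nreg \<tau> 6 = i" "nreg \<tau> 13 = j" using 3(2) e by (auto simp: unch_def env_def j_def)
      moreover have "\<forall>a<j. cell \<tau> i 3 4 3 m N crossed 0 a"
        using 2(1) 3(2) by (auto simp: cell unch_def j_def)
      ultimately show ?case
        apply (intro ok_intros)
        using 3(1) jm bounds by (auto simp: cell less_Suc_eq)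
    qed auto
    then show ?case
      using 2(1) jm by (intro exI[of _ "n - 1"] conjI) (auto simp: j_def elim!: ok_conseq)
  next
    case (3 n \<sigma>')
    then have "env l K i s f m \<sigma>'" using env env_unch[OF 3(2)] by auto
    then show ?case using 3 by (auto simp: env_def)
  qed (use B in auto)
  show ?thesis
    unfolding init_nxt_def
    apply (rule ok_Seq, rule ok_NAssign, simp)
    apply (rule ok_Seq, simp, rule ok_conseq[OF loop])
      apply simp_all
    apply (intro ok_intros)
    using env by (auto simp: cell env_def unch_def le_less)
qed

text \<open>Since \<open>j < N j\<close>, the continuation from \<open>(N j, j)\<close> consults
  only entries to the right of \<open>j\<close>, which a downward loop has already filled.
  \<open>advance\<close> leaves register 13 alone, so it can hold \<open>j\<close>.\<close>

lemma entry_loop_ok: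
  assumes env: "env l K i s f m \<sigma>" "succ_table K i s m \<sigma>" "nxt_table K i s f m \<sigma>" and m: "nreg \<sigma> 13 = m"
  shows "ok l (Suc K * (m + 2)) entry_loop \<sigma> (entries i s f m 0)"
  unfolding entry_loop_def
proof (rule ok_While[where n = m and B' = "Suc K" and I = "\<lambda>n \<sigma>'. n = nreg \<sigma>' 13 \<and> n \<le> m \<and> entries i s f m n \<sigma>'"],
    goal_cases)
  case 1
  then show ?case using m by (auto simp: entries_def)
next
  case (2 n \<sigma>')
  interpret block s f m using env by (simp add: env_def)
  note bounds = env_bounds[OF env(1)]
  have e: "env l K i s f m \<sigma>'" "succ_table K i s m \<sigma>'" "nxt_table K i s f m \<sigma>'"
    using env env_unch[OF 2(2)] succ_table_unch[OF 2(2)] nxt_table_unch[OF 2(2)] by auto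
  have "0 < n" "n \<le> m" using 2(1,3) by auto
  then obtain j where j: "n = Suc j" "j < m" by (cases n) auto
  have e6: "nreg \<sigma>' 6 = i" "len \<sigma>' i = m" "\<And>j. rm \<sigma>' 1 i 0 j = f j" using e by (auto simp: env_def)
  have Nj: "nm \<sigma>' 3 i 0 j = N j" using e(3) j by (auto simp: nxt_table_def table_def cell_def)
  let ?\<sigma> = "\<sigma>'\<lparr>nreg := (nreg \<sigma>')(13 := j, 7 := N j, 0 := 0), rreg := (rreg \<sigma>')(4 := f j)\<rparr>"
  have adv: "ok l (Suc K) (advance;;
       RST 4 (NConst 0) (NReg 13) (RReg 3);;
       RST 5 (NConst 0) (NReg 13) (RReg 4);;
       ST 5 (NConst 0) (NReg 13) (NReg 0)) \<tau> (\<lambda>\<sigma>'. nreg \<sigma>' 13 = j \<and> entries i s f m j \<sigma>')"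
    if N: "N j < m" and \<tau>: "env l K i s f m \<tau>" "succ_table K i s m \<tau>" "nxt_table K i s f m \<tau>"
      "entries i s f m n \<tau>" "nreg \<tau> 13 = j" "nreg \<tau> 7 = N j" "nreg \<tau> 0 = 0" "rreg \<tau> 4 = f j" for \<tau>
  proof (rule ok_Seq, rule ok_conseq[OF advance_ok])
    have jN: "j < N j" using nxt_gt j by simp
    show "entries i s f m (N j) \<tau>" using \<tau>(4) jN j by (auto elim: entries_mono)
    show "f j \<le> f (N j)" using incr[OF jN N] by simp
    fix \<rho> assume r: "result (G (Suc (N j)) (f (N j), f j, 0)) \<rho>" and u: "unch advance \<tau> \<rho>"
    have "nreg \<rho> 6 = i" "nreg \<rho> 13 = j" using u \<tau> by (auto simp: unch_def env_def)
    moreover have "entries i s f m n \<rho>" using entries_unch[OF u] \<tau> by simp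
    ultimately show "ok l (Suc K) (RST 4 (NConst 0) (NReg 13) (RReg 3);;
       RST 5 (NConst 0) (NReg 13) (RReg 4);;
       ST 5 (NConst 0) (NReg 13) (NReg 0)) \<rho> (\<lambda>\<sigma>'. nreg \<sigma>' 13 = j \<and> entries i s f m j \<sigma>')"
      apply (intro ok_intros)
      using r j by (auto simp: entries_def le_eq_less_or_eq[of j] Suc_le_eq)
  qed (use that bounds in auto)
  have skip: "entries i s f m j \<sigma>'" if "\<not> N j < m"
    using 2(1) j that by (auto simp: entries_def le_eq_less_or_eq[of j] Suc_le_eq)
  have r13: "nreg \<sigma>' 13 = Suc j" using 2(1) j by simp
  have en: "entries i s f m n \<sigma>'" using 2(1) by blast
  have "ok l (Suc K) entry_body \<sigma>' (\<lambda>\<sigma>'. nreg \<sigma>' 13 = j \<and> entries i s f m j \<sigma>')"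
    unfolding entry_body_def
    apply (rule ok_Seq, rule ok_NAssign, simp)
    apply (rule ok_Seq, rule ok_NAssign, simp)
    apply (rule ok_If)
     apply (rule ok_Seq, rule ok_RAssign)
     apply (rule ok_Seq, rule ok_NAssign, simp)
     apply (rule adv)
    using e en e6 Nj r13 j skip by (auto intro: ok_Skip)
  then show ?case using j by (intro exI[of _ j] conjI) (auto elim!: ok_conseq)
next
  case (3 n \<sigma>')
  then show ?case by auto
qed auto

lemma build_ok:
  assumes env: "env l K i s f m \<sigma>"
  shows "ok l (Suc K * (m + 2)) build \<sigma> (built K i s f m)"
proof -
  interpret block s f m using env by (simp add: env_def)
  note bounds = env_bounds[OF env]
  have K: "m \<le> 2 ^ K" "K < l" using env by (auto simp: env_def)
  show ?thesis
    unfolding build_def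
  proof (rule ok_Seq, rule ok_conseq[OF init_succ_ok[OF env]], goal_cases)
    case (3 \<sigma>1)
    have e1: "env l K i s f m \<sigma>1" using env_unch[OF 3(2)] env by simp
    show ?case
    proof (rule ok_Seq, rule ok_conseq[OF levels_ok[OF K jumps_Suc _ _ _ _ _ _ 3(1)]], goal_cases)
      case (9 \<sigma>2)
      have e2: "env l K i s f m \<sigma>2" using env_unch[OF 9(2)] e1 by simp
      have s2: "succ_table K i s m \<sigma>2" using 9(1) by (simp add: succ_table_def)
      show ?case
      proof (rule ok_Seq, rule ok_conseq[OF init_nxt_ok[OF e2 s2]], goal_cases)
        case (3 \<sigma>3)
        have e3: "env l K i s f m \<sigma>3" "succ_table K i s m \<sigma>3"
          using env_unch[OF 3(2)] succ_table_unch[OF 3(2)] e2 s2 by simp_all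
        show ?case
        proof (rule ok_Seq, rule ok_conseq[OF levels_ok[OF K jumps_nxt _ _ _ _ _ _ 3(1)]], goal_cases)
          case (9 \<sigma>4)
          have e4: "env l K i s f m \<sigma>4" "succ_table K i s m \<sigma>4"
            using env_unch[OF 9(2)] succ_table_unch[OF 9(2)] e3 by simp_all
          have n4: "nxt_table K i s f m \<sigma>4" using 9(1) by (simp add: nxt_table_def)
          show ?case
          proof (rule ok_Seq, rule ok_NAssign, goal_cases)
            case 2
            let ?\<sigma> = "\<sigma>4\<lparr>nreg := (nreg \<sigma>4)(13 := nval LEN \<sigma>4)\<rparr>"
            have e5: "env l K i s f m ?\<sigma>" "succ_table K i s m ?\<sigma>" "nxt_table K i s f m ?\<sigma>" "nreg ?\<sigma> 13 = m"
              using e4 n4 by (auto simp: env_def)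
            show ?case
              by (rule ok_conseq[OF entry_loop_ok[OF e5]])
                (use succ_table_unch nxt_table_unch e5 in \<open>auto simp: built_def\<close>)
          qed simp
        qed (use e3 in \<open>auto simp: env_def\<close>)
      qed auto
    qed (use e1 in \<open>auto simp: env_def\<close>)
  qed auto
qed

end

section \<open>Maintaining the blocks\<close>

definition blk :: "ram \<Rightarrow> nat \<Rightarrow> ival list" where
  "blk \<sigma> i = map (\<lambda>j. (start \<sigma> i j, fin \<sigma> i j)) [0..<len \<sigma> i]"

definition conts :: "ram \<Rightarrow> nat \<Rightarrow> ival list" where
  "conts \<sigma> n = concat (map (blk \<sigma>) [0..<n])"

definition bok :: "nat \<Rightarrow> ram \<Rightarrow> nat \<Rightarrow> bool" where
  "bok K \<sigma> i \<longleftrightarrow> built K i (start \<sigma> i) (fin \<sigma> i) (len \<sigma> i) \<sigma>"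

text \<open>Real arrays 6 and 7 are left out because they are scratch space and carry no information
  about a block.\<close>

definition same :: "nat \<Rightarrow> ram \<Rightarrow> ram \<Rightarrow> bool" where
  "same i \<sigma> \<sigma>' \<longleftrightarrow> (\<forall>v k a. nm \<sigma>' v i k a = nm \<sigma> v i k a) \<and>
     (\<forall>v k a. v < 6 \<longrightarrow> rm \<sigma>' v i k a = rm \<sigma> v i k a)"

lemma same_blk: "same i \<sigma> \<sigma>' \<Longrightarrow> blk \<sigma>' i = blk \<sigma> i"
  by (simp add: same_def blk_def)

lemma same_bok: "same i \<sigma> \<sigma>' \<Longrightarrow> bok K \<sigma>' i = bok K \<sigma> i"
  by (simp add: same_def bok_def built_def succ_table_def nxt_table_def entries_def table_def cell_def)

lemma unch_same: "unch c \<sigma> \<sigma>' \<Longrightarrow> nst c = {} \<and> rst c \<subseteq> {6, 7} \<or> local c \<and> i \<noteq> nreg \<sigma> 6 \<Longrightarrow> same i \<sigma> \<sigma>'"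
  unfolding unch_def same_def by fastforce

lemma conts_cong: "(\<And>i. i < n \<Longrightarrow> blk \<sigma>' i = blk \<sigma> i) \<Longrightarrow> conts \<sigma>' n = conts \<sigma> n"
  unfolding conts_def by (intro arg_cong[of _ _ concat] map_cong) auto

lemma conts_Suc: "conts \<sigma> (Suc n) = conts \<sigma> n @ blk \<sigma> n"
  by (simp add: conts_def)

lemma conts_split:
  "i \<le> n \<Longrightarrow> conts \<sigma> (Suc n) = conts \<sigma> i @ blk \<sigma> i @ concat (map (blk \<sigma>) [Suc i..<Suc n])"
proof -
  assume "i \<le> n"
  then have "[0..<Suc n] = [0..<i] @ i # [Suc i..<Suc n]"
    by (metis le_Suc_eq le_add_diff_inverse less_Suc_eq_le upt_add_eq_append upt_conv_Cons zero_le)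
  then show ?thesis unfolding conts_def by simp
qed

lemma length_blk [simp]: "length (blk \<sigma> i) = len \<sigma> i"
  by (simp add: blk_def)

lemma nth_blk [simp]: "j < len \<sigma> i \<Longrightarrow> blk \<sigma> i ! j = (start \<sigma> i j, fin \<sigma> i j)"
  by (simp add: blk_def)

lemma blk_reg [simp]: "blk (\<sigma>\<lparr>nreg := p\<rparr>) = blk \<sigma>" "blk (\<sigma>\<lparr>rreg := q\<rparr>) = blk \<sigma>"
  by (simp_all add: blk_def fun_eq_iff)

lemma conts_reg [simp]:
  "conts (\<sigma>\<lparr>nreg := p\<rparr>) = conts \<sigma>" "conts (\<sigma>\<lparr>rreg := q\<rparr>) = conts \<sigma>"
  "bok K (\<sigma>\<lparr>nreg := p\<rparr>) = bok K \<sigma>" "bok K (\<sigma>\<lparr>rreg := q\<rparr>) = bok K \<sigma>"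
  by (simp_all add: conts_def bok_def built_def fun_eq_iff)

section \<open>Locating, inserting and deleting an interval\<close>

definition locate_loop :: com where
  "locate_loop =
    While (And (NLess (NReg 6) (NReg 1))
        (Not (And (Not (NEq LEN (NConst 0)))
          (Not (RLess (RLD 1 (NConst 0) (Minus LEN (NConst 1))) (RReg 1))))))
      (NAssign 6 (Plus (NReg 6) (NConst 1)))"

text \<open>The scan stops at the last block at the latest, which thus receives finishing times
  beyond all present ones. It can be linear because there are only about \<open>q\<close>
  blocks.\<close>

definition locate :: com where
  "locate = NAssign 6 (NConst 0);; locate_loop"

definition shift_loop :: com where
  "shift_loop =
    While (And (NLess (NConst 0) (NReg 7)) (RLess (RReg 1) (RLD 1 (NConst 0) (Minus (NReg 7) (NConst 1)))))
      (RST 1 (NConst 0) (NReg 7) (RLD 1 (NConst 0) (Minus (NReg 7) (NConst 1)));;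
       RST 0 (NConst 0) (NReg 7) (RLD 0 (NConst 0) (Minus (NReg 7) (NConst 1)));;
       NAssign 7 (Minus (NReg 7) (NConst 1)))"

definition insert_blk :: com where
  "insert_blk =
    NAssign 7 LEN;; shift_loop;;
    RST 1 (NConst 0) (NReg 7) (RReg 1);; RST 0 (NConst 0) (NReg 7) (RReg 0);;
    ST 0 (NConst 0) (NConst 0) (Plus LEN (NConst 1))"

text \<open>Deletion needs no preliminary search: in one sweep, each cell whose finishing time is at
  least \<open>f\<close> is overwritten by its right neighbour. Cells from the current index on are
  still original, so the test stays meaningful.\<close>

definition unshift_step :: com where
  "unshift_step =
    If (RLess (RLD 1 (NConst 0) (NReg 7)) (RReg 1))
      Skip
      (RST 1 (NConst 0) (NReg 7) (RLD 1 (NConst 0) (Plus (NReg 7) (NConst 1)));;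
       RST 0 (NConst 0) (NReg 7) (RLD 0 (NConst 0) (Plus (NReg 7) (NConst 1))));;
    NAssign 7 (Plus (NReg 7) (NConst 1))"

definition unshift_loop :: com where
  "unshift_loop =
    While (NLess (Plus (NReg 7) (NConst 1)) LEN) unshift_step"

definition delete_blk :: com where
  "delete_blk =
    NAssign 7 (NConst 0);; unshift_loop;;
    ST 0 (NConst 0) (NConst 0) (Minus LEN (NConst 1))"

lemma edit_frame [simp]:
  "nwr locate_loop = {6}" "rwr locate_loop = {}" "nst locate_loop = {}" "rst locate_loop = {}"
  "nwr locate = {6}" "rwr locate = {}" "nst locate = {}" "rst locate = {}"
  "nwr shift_loop = {7}" "rwr shift_loop = {}" "nst shift_loop = {}" "rst shift_loop = {0, 1}"
    "local shift_loop"
  "nwr insert_blk = {7}" "rwr insert_blk = {}" "nst insert_blk = {0}" "rst insert_blk = {0, 1}"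
    "local insert_blk"
  "nwr unshift_step = {7}" "rwr unshift_step = {}" "nst unshift_step = {}" "rst unshift_step = {0, 1}"
    "local unshift_step"
  "nwr unshift_loop = {7}" "rwr unshift_loop = {}" "nst unshift_loop = {}" "rst unshift_loop = {0, 1}"
    "local unshift_loop"
  "nwr delete_blk = {7}" "rwr delete_blk = {}" "nst delete_blk = {0}" "rst delete_blk = {0, 1}"
    "local delete_blk"
  by (auto simp: locate_def locate_loop_def shift_loop_def insert_blk_def unshift_step_def unshift_loop_def delete_blk_def)

lemma locate_ok:
  assumes "Suc (nreg \<sigma> 1) \<le> 2 ^ l"
  shows "ok l (Suc (nreg \<sigma> 1)) locate \<sigma> (\<lambda>\<sigma>'. nreg \<sigma>' 6 \<le> nreg \<sigma> 1 \<and>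
    (\<forall>i<nreg \<sigma>' 6. len \<sigma> i = 0 \<or> fin \<sigma> i (len \<sigma> i - 1) < rreg \<sigma> 1) \<and>
    (nreg \<sigma>' 6 < nreg \<sigma> 1 \<longrightarrow> len \<sigma> (nreg \<sigma>' 6) \<noteq> 0 \<and>
      rreg \<sigma> 1 \<le> fin \<sigma> (nreg \<sigma>' 6) (len \<sigma> (nreg \<sigma>' 6) - 1)))"
proof -
  have "ok l (Suc (nreg \<sigma> 1)) locate_loop (\<sigma>\<lparr>nreg := (nreg \<sigma>)(6 := 0)\<rparr>) (\<lambda>\<sigma>'. nreg \<sigma>' 6 \<le> nreg \<sigma> 1 \<and>
    (\<forall>i<nreg \<sigma>' 6. len \<sigma> i = 0 \<or> fin \<sigma> i (len \<sigma> i - 1) < rreg \<sigma> 1) \<and>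
    (nreg \<sigma>' 6 < nreg \<sigma> 1 \<longrightarrow> len \<sigma> (nreg \<sigma>' 6) \<noteq> 0 \<and>
      rreg \<sigma> 1 \<le> fin \<sigma> (nreg \<sigma>' 6) (len \<sigma> (nreg \<sigma>' 6) - 1)))"
    unfolding locate_loop_def
  proof (rule ok_While[where n = "nreg \<sigma> 1" and B' = 1 and I = "\<lambda>n \<sigma>'. n = nreg \<sigma> 1 - nreg \<sigma>' 6 \<and>
      nreg \<sigma>' 6 \<le> nreg \<sigma> 1 \<and> (\<forall>i<nreg \<sigma>' 6. len \<sigma> i = 0 \<or> fin \<sigma> i (len \<sigma> i - 1) < rreg \<sigma> 1)"], goal_cases)
    case (2 n \<sigma>')
    then have fr: "nreg \<sigma>' 1 = nreg \<sigma> 1" "rreg \<sigma>' 1 = rreg \<sigma> 1" "\<And>v i k a. nm \<sigma>' v i k a = nm \<sigma> v i k a"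
      "\<And>v i k a. rm \<sigma>' v i k a = rm \<sigma> v i k a" by (auto simp: unch_def)
    show ?case
      apply (intro exI[of _ "n - 1"] conjI)
      using 2 fr apply (simp add: Suc_diff_Suc)
      apply (intro ok_intros)
      using 2 fr assms by (auto simp: less_Suc_eq)
  next
    case (3 n \<sigma>')
    then have fr: "nreg \<sigma>' 1 = nreg \<sigma> 1" "rreg \<sigma>' 1 = rreg \<sigma> 1" "\<And>v i k a. nm \<sigma>' v i k a = nm \<sigma> v i k a"
      "\<And>v i k a. rm \<sigma>' v i k a = rm \<sigma> v i k a" by (auto simp: unch_def)
    then show ?case using 3 by auto
  qed auto
  then show ?thesis
    unfolding locate_def by (intro ok_intros) auto
qed

lemma insert_blk_ok:
  assumes i: "nreg \<sigma> 6 = i" and m: "len \<sigma> i = m" "Suc m \<le> 2 ^ l"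
    and sorted: "sorted_wrt (<) (map snd (blk \<sigma> i))"
    and new: "\<forall>x\<in>set (blk \<sigma> i). snd x \<noteq> f" and sf: "rreg \<sigma> 0 = s" "rreg \<sigma> 1 = f"
  shows "ok l (Suc m) insert_blk \<sigma> (\<lambda>\<sigma>'. blk \<sigma>' i =
    filter (\<lambda>x. snd x < f) (blk \<sigma> i) @ (s, f) # filter (\<lambda>x. f < snd x) (blk \<sigma> i))"
proof -
  have incr: "fin \<sigma> i j < fin \<sigma> i k" if "j < k" "k < m" for j k
    using sorted that m by (auto simp: sorted_wrt_iff_nth_less)
  define old where "old j = (start \<sigma> i j, fin \<sigma> i j)" for j
  \<comment> \<open>Cell \<open>n\<close> is a hole moving to the left; nothing is claimed about its
    content.\<close>
  define I where "I n \<tau> \<longleftrightarrow> (n \<le> m \<and> nreg \<tau> 7 = n \<and> (\<forall>j<n. (rm \<tau> 0 i 0 j, rm \<tau> 1 i 0 j) = old j) \<and>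
      (\<forall>j. n < j \<and> j \<le> m \<longrightarrow> (rm \<tau> 0 i 0 j, rm \<tau> 1 i 0 j) = old (j - 1)) \<and> (n < m \<longrightarrow> f < fin \<sigma> i n))"
    for n and \<tau> :: ram
  have loop: "ok l (Suc m) shift_loop (\<sigma>\<lparr>nreg := (nreg \<sigma>)(7 := m)\<rparr>) (\<lambda>\<tau>. \<exists>n. I n \<tau> \<and>
      (0 < n \<longrightarrow> fin \<sigma> i (n - 1) < f))"
    unfolding shift_loop_def
  proof (rule ok_While[where n = m and B' = 1 and I = I], goal_cases)
    case 1
    then show ?case by (auto simp: I_def old_def)
  next
    case (2 n \<tau>)
    then have fr: "nreg \<tau> 6 = i" "rreg \<tau> 1 = f" using i sf by (auto simp: unch_def)
    obtain k where k: "n = Suc k" using 2 by (cases n) (auto simp: I_def)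
    have old: "rm \<tau> 0 i 0 k = start \<sigma> i k" "rm \<tau> 1 i 0 k = fin \<sigma> i k"
      using 2(1) k by (auto simp: I_def old_def)
    show ?case
      apply (intro exI[of _ k] conjI k)
      apply (intro ok_intros)
      using 2 k fr old by (auto simp: I_def old_def)
  next
    case (3 n \<tau>)
    then have fr: "nreg \<tau> 6 = i" "rreg \<tau> 1 = f" using i sf by (auto simp: unch_def)
    have "fin \<sigma> i (n - 1) < f" if "0 < n"
    proof -
      have "n - 1 < m" using 3(1) that by (auto simp: I_def)
      then have "fin \<sigma> i (n - 1) \<noteq> f" using new m by (auto simp: blk_def)
      moreover have "fin \<sigma> i (n - 1) \<le> f" using 3 fr that by (auto simp: I_def old_def)
      ultimately show ?thesis by simp
    qed
    then show ?case using 3 by blast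
  qed auto
  have fin: "blk \<tau>' i = filter (\<lambda>x. snd x < f) (blk \<sigma> i) @ (s, f) # filter (\<lambda>x. f < snd x) (blk \<sigma> i)"
    if I: "I n \<tau>" and stop: "0 < n \<longrightarrow> fin \<sigma> i (n - 1) < f" and len: "len \<tau>' i = Suc m"
      and at: "rm \<tau>' 0 i 0 n = s" "rm \<tau>' 1 i 0 n = f"
      and other: "\<And>j. j \<noteq> n \<Longrightarrow> rm \<tau>' 0 i 0 j = rm \<tau> 0 i 0 j \<and> rm \<tau>' 1 i 0 j = rm \<tau> 1 i 0 j"
    for n \<tau> \<tau>'
  proof -
    have n: "n \<le> m" using I by (simp add: I_def)
    have below: "fin \<sigma> i j < f" if "j < n" for j
    proof -
      have "fin \<sigma> i j \<le> fin \<sigma> i (n - 1)"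
      proof (cases "j = n - 1")
        case False
        then have "j < n - 1" "n - 1 < m" using that n by auto
        then show ?thesis using incr by (auto intro: less_imp_le)
      qed simp
      then show ?thesis using stop that by auto
    qed
    have above: "f < fin \<sigma> i j" if "n \<le> j" "j < m" for j
      using I incr[of n j] that by (cases "j = n") (auto simp: I_def)
    have split: "blk \<sigma> i = take n (blk \<sigma> i) @ drop n (blk \<sigma> i)" by simp
    have t: "\<forall>x\<in>set (take n (blk \<sigma> i)). snd x < f"
      using below n m by (auto simp: in_set_conv_nth)
    have d: "\<forall>x\<in>set (drop n (blk \<sigma> i)). f < snd x"
      using above n m by (auto simp: in_set_conv_nth)
    have "filter (\<lambda>x. snd x < f) (blk \<sigma> i) = take n (blk \<sigma> i)"
      by (subst split, subst filter_append) (use t d in \<open>auto simp: filter_id_conv filter_empty_conv\<close>)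
    moreover have "filter (\<lambda>x. f < snd x) (blk \<sigma> i) = drop n (blk \<sigma> i)"
      by (subst split, subst filter_append) (use t d in \<open>fastforce simp: filter_id_conv filter_empty_conv\<close>)
    moreover have "blk \<tau>' i = take n (blk \<sigma> i) @ (s, f) # drop n (blk \<sigma> i)"
    proof (rule nth_equalityI)
      show "length (blk \<tau>' i) = length (take n (blk \<sigma> i) @ (s, f) # drop n (blk \<sigma> i))"
        using len m n by simp
      fix j assume "j < length (blk \<tau>' i)"
      then have j: "j \<le> m" using len by simp
      consider "j < n" | "j = n" | "n < j" by linarith
      then show "blk \<tau>' i ! j = (take n (blk \<sigma> i) @ (s, f) # drop n (blk \<sigma> i)) ! j"
      proof cases
        case 1
        then show ?thesis using I j len n m other[of j] by (simp add: nth_append I_def old_def)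
      next
        case 2
        then show ?thesis using j len n m at by (simp add: nth_append)
      next
        case 3
        then obtain k where k: "j = Suc k" by (cases j) auto
        then show ?thesis using 3 I j len n m other[of j] by (simp add: nth_append I_def old_def Suc_diff_le)
      qed
    qed
    ultimately show ?thesis by simp
  qed
  show ?thesis
    unfolding insert_blk_def
    apply (rule ok_Seq, rule ok_NAssign, simp)
    apply (rule ok_Seq)
    apply (simp add: i m)
    apply (rule ok_conseq[OF loop], simp, simp)
    apply (elim exE conjE)
    apply (intro ok_intros)
    subgoal using m i by (simp add: unch_def)
    subgoal for \<tau> n
      apply (rule fin[of n \<tau>])
      using m i sf by (auto simp: unch_def I_def)
    done
qed

lemma delete_blk_ok:
  assumes i: "nreg \<sigma> 6 = i" and m: "len \<sigma> i = m" "Suc m \<le> 2 ^ l"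
    and sorted: "sorted_wrt (<) (map snd (blk \<sigma> i))"
    and mem: "(s, f) \<in> set (blk \<sigma> i)" and sf: "rreg \<sigma> 1 = f"
  shows "ok l (Suc m) delete_blk \<sigma> (\<lambda>\<sigma>'. blk \<sigma>' i = filter (\<lambda>x. snd x \<noteq> f) (blk \<sigma> i))"
proof -
  have incr: "fin \<sigma> i j < fin \<sigma> i k" if "j < k" "k < m" for j k
    using sorted that m by (auto simp: sorted_wrt_iff_nth_less)
  obtain p where p: "p < m" "fin \<sigma> i p = f"
    using mem m by (auto simp: blk_def)
  have less_iff: "fin \<sigma> i j < f \<longleftrightarrow> j < p" if "j < m" for j
    using incr[of j p] incr[of p j] that p by (cases j p rule: linorder_cases) auto
  define new where "new j = (if j < p then (start \<sigma> i j, fin \<sigma> i j) else (start \<sigma> i (Suc j), fin \<sigma> i (Suc j)))" for j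
  define I where "I n \<tau> \<longleftrightarrow> (\<exists>a. n = m - a - 1 \<and> Suc a \<le> m \<and> nreg \<tau> 7 = a \<and>
      (\<forall>j<a. (rm \<tau> 0 i 0 j, rm \<tau> 1 i 0 j) = new j) \<and>
      (\<forall>j\<ge>a. (rm \<tau> 0 i 0 j, rm \<tau> 1 i 0 j) = (start \<sigma> i j, fin \<sigma> i j)))" for n and \<tau> :: ram
  have loop: "ok l (Suc m) unshift_loop (\<sigma>\<lparr>nreg := (nreg \<sigma>)(7 := 0)\<rparr>) (I 0)"
    unfolding unshift_loop_def
  \<comment> \<open>The last cell has no right neighbour in the block; it vanishes when the length
    is decreased.\<close>
  proof (rule ok_While[where n = "m - 1" and B' = 1 and I = I], goal_cases)
    case 1
    then show ?case using p by (auto simp: I_def)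
  next
    case (2 n \<tau>)
    then have fr: "nreg \<tau> 6 = i" "rreg \<tau> 1 = f" "len \<tau> i = m" using i sf m by (auto simp: unch_def)
    obtain a where a: "n = m - a - 1" "Suc a \<le> m" "nreg \<tau> 7 = a"
      "\<And>j. j < a \<Longrightarrow> rm \<tau> 0 i 0 j = fst (new j) \<and> rm \<tau> 1 i 0 j = snd (new j)"
      "\<And>j. a \<le> j \<Longrightarrow> rm \<tau> 0 i 0 j = start \<sigma> i j \<and> rm \<tau> 1 i 0 j = fin \<sigma> i j"
      using 2(1) unfolding I_def by (metis fst_conv snd_conv)
    have am: "Suc a < m" using 2(3) fr a by simp
    have test: "fin \<sigma> i a < f \<longleftrightarrow> a < p" using less_iff am by simp
    have ok: "ok l 1 unshift_step \<tau> (\<lambda>\<tau>'. nreg \<tau>' 7 = Suc a \<and>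
         (\<forall>j. j < a \<or> Suc a \<le> j \<longrightarrow> rm \<tau>' 0 i 0 j = rm \<tau> 0 i 0 j \<and> rm \<tau>' 1 i 0 j = rm \<tau> 1 i 0 j) \<and>
         rm \<tau>' 0 i 0 a = fst (new a) \<and> rm \<tau>' 1 i 0 a = snd (new a))"
      unfolding unshift_step_def
      apply (intro ok_intros)
      using fr am m a(3,5) test by (auto simp: new_def)
    show ?case
      apply (intro exI[of _ "m - Suc a - 1"] conjI)
      using a am apply simp
      apply (rule ok_conseq[OF ok], simp, simp)
      using a am by (auto simp: I_def less_Suc_eq intro!: exI[of _ "Suc a"])
  next
    case (3 n \<tau>)
    then have "len \<tau> i = m" "nreg \<tau> 6 = i" using m i by (auto simp: unch_def)
    then show ?case using 3 by (auto simp: I_def)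
  qed (use p in auto)
  have fin: "blk \<tau>' i = filter (\<lambda>x. snd x \<noteq> f) (blk \<sigma> i)"
    if I: "I 0 \<tau>" and len: "len \<tau>' i = m - 1" and other: "rmem \<tau>' = rmem \<tau>" for \<tau> \<tau>'
  proof -
    have split: "blk \<sigma> i = take p (blk \<sigma> i) @ blk \<sigma> i ! p # drop (Suc p) (blk \<sigma> i)"
      using id_take_nth_drop[of p "blk \<sigma> i"] p m by simp
    have t: "\<forall>x\<in>set (take p (blk \<sigma> i)). snd x \<noteq> f"
    proof
      fix x assume "x \<in> set (take p (blk \<sigma> i))"
      then obtain j where "j < p" "x = blk \<sigma> i ! j" using m p by (auto simp: in_set_conv_nth)
      then show "snd x \<noteq> f" using less_iff[of j] p m by simp
    qed
    have d: "\<forall>x\<in>set (drop (Suc p) (blk \<sigma> i)). snd x \<noteq> f"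
    proof
      fix x assume "x \<in> set (drop (Suc p) (blk \<sigma> i))"
      then obtain j where "j < m - Suc p" "x = drop (Suc p) (blk \<sigma> i) ! j"
        unfolding in_set_conv_nth using m by (metis length_blk length_drop)
      then have "Suc p + j < m" "x = blk \<sigma> i ! (Suc p + j)" using m p by auto
      then show "snd x \<noteq> f" using incr[of p "Suc p + j"] p m by simp
    qed
    have "filter (\<lambda>x. snd x \<noteq> f) (blk \<sigma> i) = take p (blk \<sigma> i) @ drop (Suc p) (blk \<sigma> i)"
      by (subst split, subst filter_append) (use t d p m in \<open>auto simp: filter_id_conv\<close>)
    moreover have "blk \<tau>' i = take p (blk \<sigma> i) @ drop (Suc p) (blk \<sigma> i)"
    proof (rule nth_equalityI)
      show "length (blk \<tau>' i) = length (take p (blk \<sigma> i) @ drop (Suc p) (blk \<sigma> i))"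
        using len m p by simp
      fix j assume "j < length (blk \<tau>' i)"
      then have j: "j < m - 1" using len by simp
      then show "blk \<tau>' i ! j = (take p (blk \<sigma> i) @ drop (Suc p) (blk \<sigma> i)) ! j"
        using I len p m other by (auto simp: nth_append I_def new_def)
    qed
    ultimately show ?thesis by simp
  qed
  show ?thesis
    unfolding delete_blk_def
    apply (rule ok_Seq, rule ok_NAssign, simp)
    apply (rule ok_Seq)
    apply simp
    apply (rule ok_conseq[OF loop], simp, simp)
    apply (intro ok_intros)
    subgoal by simp
    subgoal for \<tau>
      apply (rule fin[of \<tau>])
      using m i by (auto simp: unch_def)
    done
qed

section \<open>Redistribution into even blocks\<close>

definition glist :: "ram \<Rightarrow> nat \<Rightarrow> ival list" where
  "glist \<sigma> n = map (\<lambda>j. (rm \<sigma> 6 0 0 j, rm \<sigma> 7 0 0 j)) [0..<n]"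

lemma glist_reg [simp]: "glist (\<sigma>\<lparr>nreg := p\<rparr>) = glist \<sigma>"
  by (simp add: glist_def fun_eq_iff)

definition gather_step :: com where
  "gather_step =
    RStore (adr 6 (NConst 0) (NConst 0) (NReg 16)) (RLD 0 (NConst 0) (NReg 7));;
    RStore (adr 7 (NConst 0) (NConst 0) (NReg 16)) (RLD 1 (NConst 0) (NReg 7));;
    NAssign 16 (Plus (NReg 16) (NConst 1));;
    NAssign 7 (Plus (NReg 7) (NConst 1))"

definition gather_blk :: com where
  "gather_blk =
    While (NLess (NReg 7) LEN) gather_step"

definition gather_loop :: com where
  "gather_loop =
    While (Not (NLess (NReg 1) (NReg 6)))
      (NAssign 7 (NConst 0);; gather_blk;; NAssign 6 (Plus (NReg 6) (NConst 1)))"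

text \<open>The contents move to scratch arrays first because the blocks are rewritten in place. The
  scratch arrays carry block number 0, whichever block is being read.\<close>

definition gather :: com where
  "gather = NAssign 16 (NConst 0);; NAssign 6 (NConst 0);; gather_loop"

definition resize :: com where
  "resize =
    NAssign 2 (Plus (NReg 2) (NConst 1));; NAssign 5 (NConst 0);;
    If (NLess (Plus (NReg 4) (NConst 1)) (Plus (NReg 2) (NReg 2)))
      (NAssign 4 (Plus (Plus (NReg 4) (NReg 4)) (NConst 1));; NAssign 3 (Plus (NReg 3) (NConst 1)))
      Skip;;
    NAssign 1 (Divide (NReg 16) (NReg 2))"

definition copy_step :: com where
  "copy_step =
    RST 0 (NConst 0) (NReg 7) (RLoad (adr 6 (NConst 0) (NConst 0) (Plus (Times (NReg 6) (NReg 2)) (NReg 7))));;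
    RST 1 (NConst 0) (NReg 7) (RLoad (adr 7 (NConst 0) (NConst 0) (Plus (Times (NReg 6) (NReg 2)) (NReg 7))));;
    NAssign 7 (Plus (NReg 7) (NConst 1))"

definition copy :: com where
  "copy =
    While (NLess (NReg 7) LEN) copy_step"

definition fill :: com where
  "fill =
    If (NLess (Minus (NReg 16) (Times (NReg 6) (NReg 2))) (NReg 2))
      (ST 0 (NConst 0) (NConst 0) (Minus (NReg 16) (Times (NReg 6) (NReg 2))))
      (ST 0 (NConst 0) (NConst 0) (NReg 2));;
    NAssign 7 (NConst 0);; copy;; build"

definition scatter_loop :: com where
  "scatter_loop =
    While (Not (NLess (NReg 1) (NReg 6))) (fill;; NAssign 6 (Plus (NReg 6) (NConst 1)))"

definition scatter :: com where
  "scatter = NAssign 6 (NConst 0);; scatter_loop"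

definition redistribute :: com where
  "redistribute = gather;; resize;; scatter"

lemma redistribute_frame [simp]:
  "nwr gather_step = {7, 16}" "rwr gather_step = {}" "nst gather_step = {}" "rst gather_step = {6, 7}"
  "nwr gather_blk = {7, 16}" "rwr gather_blk = {}" "nst gather_blk = {}" "rst gather_blk = {6, 7}"
  "nwr gather_loop = {6, 7, 16}" "rwr gather_loop = {}" "nst gather_loop = {}" "rst gather_loop = {6, 7}"
  "nwr gather = {6, 7, 16}" "rwr gather = {}" "nst gather = {}" "rst gather = {6, 7}"
  "nwr copy_step = {7}" "rwr copy_step = {}" "nst copy_step = {}" "rst copy_step = {0, 1}" "local copy_step"
  "nwr copy = {7}" "rwr copy = {}" "nst copy = {}" "rst copy = {0, 1}" "local copy"
  "nwr fill = {0, 7, 8, 9, 10, 11, 12, 13, 14, 15}" "rwr fill = {3, 4, 5}"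
  "nst fill = {0, 1, 2, 3, 4, 5}" "rst fill = {0, 1, 2, 3, 4, 5}" "local fill"
  "nwr scatter_loop = {0, 6, 7, 8, 9, 10, 11, 12, 13, 14, 15}" "rwr scatter_loop = {3, 4, 5}"
  "nst scatter_loop = {0, 1, 2, 3, 4, 5}" "rst scatter_loop = {0, 1, 2, 3, 4, 5}"
  "nwr scatter = {0, 6, 7, 8, 9, 10, 11, 12, 13, 14, 15}" "rwr scatter = {3, 4, 5}"
  "nst scatter = {0, 1, 2, 3, 4, 5}" "rst scatter = {0, 1, 2, 3, 4, 5}"
  "nwr redistribute = {0, 1, 2, 3, 4, 5, 6, 7, 8, 9, 10, 11, 12, 13, 14, 15, 16}"
    "rwr redistribute = {3, 4, 5}"
  by (auto simp: gather_step_def gather_blk_def gather_loop_def gather_def copy_step_def copy_def fill_def scatter_loop_def scatter_def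
      redistribute_def resize_def)

lemma gather_blk_ok:
  assumes i: "nreg \<sigma> 6 = i" and m: "len \<sigma> i = m" "m \<le> 2 ^ l" and g: "glist \<sigma> (nreg \<sigma> 16) = xs"
    and r: "nreg \<sigma> 16 = length xs" "nreg \<sigma> 7 = 0" "length xs + m \<le> 2 ^ l"
  shows "ok l (Suc m) gather_blk \<sigma> (\<lambda>\<tau>. glist \<tau> (nreg \<tau> 16) = xs @ blk \<sigma> i \<and> nreg \<tau> 16 = length xs + m)"
  unfolding gather_blk_def
proof (rule ok_While[where n = m and B' = 1 and I = "\<lambda>n \<tau>. n = m - nreg \<tau> 7 \<and> nreg \<tau> 7 \<le> m \<and>
    nreg \<tau> 16 = length xs + nreg \<tau> 7 \<and> glist \<tau> (nreg \<tau> 16) = xs @ take (nreg \<tau> 7) (blk \<sigma> i)"], goal_cases)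
  case (2 n \<tau>)
  then have fr: "nreg \<tau> 6 = i" "len \<tau> i = m" "\<And>j. rm \<tau> 0 i 0 j = rm \<sigma> 0 i 0 j"
    "\<And>j. rm \<tau> 1 i 0 j = rm \<sigma> 1 i 0 j"
    using i m by (auto simp: unch_def)
  have am: "nreg \<tau> 7 < m" using 2(3) fr by simp
  have "ok l 1 gather_step \<tau> (\<lambda>\<rho>. nreg \<rho> 7 = Suc (nreg \<tau> 7) \<and>
         nreg \<rho> 16 = Suc (nreg \<tau> 16) \<and>
         glist \<rho> (Suc (nreg \<tau> 16)) = glist \<tau> (nreg \<tau> 16) @ [blk \<sigma> i ! nreg \<tau> 7])"
    unfolding gather_step_def
    apply (intro ok_intros)
    using 2(1) fr am m r by (auto simp: glist_def)
  then show ?case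
    using 2(1) am m
    by (intro exI[of _ "n - 1"] conjI) (auto simp: take_Suc_conv_app_nth elim!: ok_conseq)
next
  case (3 n \<tau>)
  then have "nreg \<tau> 6 = i" "len \<tau> i = m" using i m by (auto simp: unch_def)
  then show ?case using 3 m by auto
qed (use r g in auto)

lemma gather_ok:
  assumes lb: "nreg \<sigma> 1 = lb" "lb + 2 \<le> 2 ^ l" and m: "\<forall>i\<le>lb. len \<sigma> i \<le> M"
    and t: "length (conts \<sigma> (Suc lb)) \<le> 2 ^ l"
  shows "ok l ((lb + 2) * Suc M) gather \<sigma> (\<lambda>\<tau>. glist \<tau> (nreg \<tau> 16) = conts \<sigma> (Suc lb) \<and>
    nreg \<tau> 16 = length (conts \<sigma> (Suc lb)))"
proof -
  have loop: "ok l ((lb + 2) * Suc M) gather_loop (\<sigma>\<lparr>nreg := (nreg \<sigma>)(16 := 0, 6 := 0)\<rparr>)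
      (\<lambda>\<tau>. glist \<tau> (nreg \<tau> 16) = conts \<sigma> (Suc lb) \<and> nreg \<tau> 16 = length (conts \<sigma> (Suc lb)))"
    unfolding gather_loop_def
  proof (rule ok_While[where n = "Suc lb" and B' = "Suc M" and I = "\<lambda>n \<tau>. n = Suc lb - nreg \<tau> 6 \<and>
      nreg \<tau> 6 \<le> Suc lb \<and> nreg \<tau> 16 = length (conts \<sigma> (nreg \<tau> 6)) \<and> glist \<tau> (nreg \<tau> 16) = conts \<sigma> (nreg \<tau> 6)"],
      goal_cases)
    case 1
    then show ?case by (simp add: glist_def conts_def)
  next
    case (2 n \<tau>)
    define i where "i = nreg \<tau> 6"
    have fr: "nreg \<tau> 1 = lb" "same i \<sigma> \<tau>"
      using 2(2) lb by (auto simp: unch_def same_def)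
    have il: "i \<le> lb" using 2(3) fr by (simp add: i_def)
    have len: "len \<tau> i = len \<sigma> i" "blk \<tau> i = blk \<sigma> i" using fr(2) same_blk by (auto simp: same_def)
    have "length (conts \<sigma> (Suc i)) \<le> length (conts \<sigma> (Suc lb))"
      using conts_split[OF il, of \<sigma>] by (simp add: conts_Suc)
    then have bound: "length (conts \<sigma> i) + len \<sigma> i \<le> 2 ^ l" using t by (simp add: conts_Suc)
    have mM: "len \<sigma> i \<le> M" using m il by simp
    show ?case
    proof (intro exI[of _ "n - 1"] conjI ok_Seq ok_NAssign, goal_cases)
      case 3
      show ?case
      proof (rule ok_conseq[OF gather_blk_ok[where i = i and m = "len \<sigma> i" and xs = "conts \<sigma> i"]], goal_cases)
        case (10 \<rho>)
        have "nreg \<rho> 6 = i" using 10(2) by (simp add: unch_def i_def)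
        then show ?case
          apply (intro ok_intros)
          using 10(1) 2(1) il lb len by (auto simp: i_def[symmetric] conts_Suc)
      qed (use 2(1) len bound mM in \<open>auto simp: i_def[symmetric] glist_def\<close>)
    qed (use 2 il in \<open>auto simp: i_def\<close>)
  next
    case (3 n \<tau>)
    have "nreg \<tau> 1 = lb" using 3(2) lb by (auto simp: unch_def)
    then have "nreg \<tau> 6 = Suc lb" using 3 by auto
    moreover from 3(1) have "nreg \<tau> 16 = length (conts \<sigma> (nreg \<tau> 6))"
      "glist \<tau> (nreg \<tau> 16) = conts \<sigma> (nreg \<tau> 6)" by auto
    ultimately show ?case by simp
  qed auto
  show ?thesis
    unfolding gather_def
    by (intro ok_intros) (use loop in auto)
qed

text \<open>One increment of \<open>q\<close> requires at most one doubling of \<open>2 ^ K\<close>.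
  The slack \<open>+ 1\<close> in the upper bound admits the initial state with \<open>q = 0\<close>
  and \<open>2 ^ K = 1\<close>; the lower bound makes the tables high enough for blocks that grow to
  \<open>2 * q\<close>.\<close>

lemma resize_ok:
  assumes q: "nreg \<sigma> 2 = q" "nreg \<sigma> 3 = K" "nreg \<sigma> 4 = 2 ^ K - 1" "2 * q \<le> 2 ^ K" "2 ^ K \<le> 4 * q + 1"
    and l: "8 * q + 16 \<le> 2 ^ l" and t: "nreg \<sigma> 16 = t"
  shows "ok l 1 resize \<sigma> (\<lambda>\<tau>. \<exists>K'. nreg \<tau> 1 = t div Suc q \<and> nreg \<tau> 2 = Suc q \<and> nreg \<tau> 3 = K' \<and>
    nreg \<tau> 4 = 2 ^ K' - 1 \<and> nreg \<tau> 5 = 0 \<and> nreg \<tau> 16 = t \<and> 2 * Suc q \<le> 2 ^ K' \<and> 2 ^ K' \<le> 4 * Suc q + 1 \<and>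
    rreg \<tau> = rreg \<sigma> \<and> nmem \<tau> = nmem \<sigma> \<and> rmem \<tau> = rmem \<sigma>)"
proof -
  have one: "Suc (2 ^ K - Suc 0) = 2 ^ K" by simp
  have twice: "(2::nat) ^ K - Suc 0 + (2 ^ K - Suc 0) + 1 = 2 ^ Suc K - 1"
    by (cases "(2::nat) ^ K") auto
  have big: "2 * Suc q \<le> 2 ^ Suc K"
  proof (cases q)
    case 0
    then show ?thesis by simp
  next
    case (Suc p)
    then show ?thesis using q(4) by simp
  qed
  have K: "Suc K \<le> 2 ^ l"
    using q(5) l less_exp[of K] by linarith
  have P: "2 ^ Suc K - 1 \<le> (2::nat) ^ l" using q(5) l by (simp)
  show ?thesis
    unfolding resize_def
    apply (intro ok_intros)
    using q l t one twice big K P by (auto simp del: power_Suc intro: exI[of _ "Suc K"])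
qed

lemma copy_ok:
  assumes i: "nreg \<sigma> 6 = i" and m: "len \<sigma> i = m" "m \<le> 2 ^ l" "i * nreg \<sigma> 2 + m \<le> length xs"
    and g: "glist \<sigma> (length xs) = xs" and r: "nreg \<sigma> 7 = 0"
  shows "ok l (Suc m) copy \<sigma> (\<lambda>\<tau>. blk \<tau> i = take m (drop (i * nreg \<sigma> 2) xs))"
proof -
  have xs: "xs ! j = (rm \<sigma> 6 0 0 j, rm \<sigma> 7 0 0 j)" if "j < length xs" for j
  proof -
    have "glist \<sigma> (length xs) ! j = (rm \<sigma> 6 0 0 j, rm \<sigma> 7 0 0 j)" using that by (simp add: glist_def)
    then show ?thesis unfolding g .
  qed
  show ?thesis
    unfolding copy_def
  proof (rule ok_While[where n = m and B' = 1 and I = "\<lambda>n \<tau>. n = m - nreg \<tau> 7 \<and> nreg \<tau> 7 \<le> m \<and>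
      (\<forall>j<nreg \<tau> 7. (rm \<tau> 0 i 0 j, rm \<tau> 1 i 0 j) = xs ! (i * nreg \<sigma> 2 + j))"], goal_cases)
    case (2 n \<tau>)
    then have fr: "nreg \<tau> 6 = i" "len \<tau> i = m" "nreg \<tau> 2 = nreg \<sigma> 2"
      "\<And>j. rm \<tau> 6 0 0 j = rm \<sigma> 6 0 0 j" "\<And>j. rm \<tau> 7 0 0 j = rm \<sigma> 7 0 0 j"
      using i m by (auto simp: unch_def)
    have am: "nreg \<tau> 7 < m" using 2(3) fr by simp
    define a where "a = nreg \<tau> 7"
    have "ok l 1 copy_step \<tau> (\<lambda>\<rho>. nreg \<rho> 7 = Suc a \<and>
         rm \<rho> 0 i 0 a = rm \<sigma> 6 0 0 (i * nreg \<sigma> 2 + a) \<and> rm \<rho> 1 i 0 a = rm \<sigma> 7 0 0 (i * nreg \<sigma> 2 + a) \<and>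
         (\<forall>j<a. rm \<rho> 0 i 0 j = rm \<tau> 0 i 0 j \<and> rm \<rho> 1 i 0 j = rm \<tau> 1 i 0 j))"
      unfolding copy_step_def
      apply (intro ok_intros)
      using fr am m(2) by (simp_all add: a_def)
    then have "ok l 1 copy_step \<tau> (\<lambda>\<rho>. n - 1 = m - nreg \<rho> 7 \<and> nreg \<rho> 7 \<le> m \<and>
         (\<forall>j<nreg \<rho> 7. (rm \<rho> 0 i 0 j, rm \<rho> 1 i 0 j) = xs ! (i * nreg \<sigma> 2 + j)))"
    proof (rule ok_conseq, goal_cases)
      case (3 \<rho>)
      have "(rm \<rho> 0 i 0 j, rm \<rho> 1 i 0 j) = xs ! (i * nreg \<sigma> 2 + j)" if "j < Suc a" for j
      proof (cases "j = a")
        case True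
        then show ?thesis using 3(1) xs[of "i * nreg \<sigma> 2 + a"] am m(3) by (simp add: a_def)
      next
        case False
        then have "j < a" using that by simp
        then show ?thesis using 3(1) 2(1) by (simp add: a_def)
      qed
      then show ?case using 3(1) 2(1) am by (simp add: a_def)
    qed simp_all
    then show ?case using 2(1) am by (intro exI[of _ "n - 1"] conjI) simp_all
  next
    case (3 n \<tau>)
    then have len: "nreg \<tau> 6 = i" "len \<tau> i = m" using i m(1) by (simp_all add: unch_def)
    then have "nreg \<tau> 7 = m" using 3(1,3) by simp
    then have "\<forall>j<m. (rm \<tau> 0 i 0 j, rm \<tau> 1 i 0 j) = xs ! (i * nreg \<sigma> 2 + j)" using 3(1) by simp
    then show ?case by (intro nth_equalityI) (use len m(3) in simp_all)
  qed (use r in auto)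
qed

lemma env_blk:
  assumes "nreg \<sigma> 6 = i" "nreg \<sigma> 3 = K" "nreg \<sigma> 4 = 2 ^ K - 1" "len \<sigma> i \<le> 2 ^ K" "K < l"
    and "sorted_wrt (<) (map snd (blk \<sigma> i))"
  shows "env l K i (start \<sigma> i) (fin \<sigma> i) (len \<sigma> i) \<sigma>"
  using assms by (simp add: env_def block_def sorted_wrt_iff_nth_less)

lemma build_blk_ok:
  assumes "nreg \<sigma> 6 = i" "nreg \<sigma> 3 = K" "nreg \<sigma> 4 = 2 ^ K - 1" "len \<sigma> i \<le> 2 ^ K" "K < l"
    and "sorted_wrt (<) (map snd (blk \<sigma> i))" "len \<sigma> i \<le> M"
  shows "ok l (Suc K * (M + 2)) build \<sigma> (\<lambda>\<tau>. bok K \<tau> i \<and> blk \<tau> i = blk \<sigma> i)"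
proof (rule ok_conseq[OF build_ok[OF env_blk[OF assms(1-6)]]])
  fix \<tau> assume "built K i (start \<sigma> i) (fin \<sigma> i) (len \<sigma> i) \<tau>" and u: "unch build \<sigma> \<tau>"
  moreover have "\<And>j. rm \<tau> 0 i 0 j = rm \<sigma> 0 i 0 j" "\<And>j. rm \<tau> 1 i 0 j = rm \<sigma> 1 i 0 j" "len \<tau> i = len \<sigma> i"
    using u by (auto simp: unch_def)
  ultimately show "bok K \<tau> i \<and> blk \<tau> i = blk \<sigma> i" by (simp add: bok_def blk_def)
next
  show "Suc K * (len \<sigma> i + 2) \<le> Suc K * (M + 2)" using assms(7) by (intro mult_le_mono) auto
qed simp

lemma fill_ok:
  assumes i: "nreg \<sigma> 6 = i" and K: "nreg \<sigma> 3 = K" "nreg \<sigma> 4 = 2 ^ K - 1" "q \<le> 2 ^ K" "K < l"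
    and q: "nreg \<sigma> 2 = q" and t: "nreg \<sigma> 16 = length xs"
    and g: "glist \<sigma> (length xs) = xs" and sorted: "sorted_wrt (<) (map snd xs)"
    and iq: "i * q \<le> length xs"
  shows "ok l (Suc K * (q + 2)) fill \<sigma> (\<lambda>\<tau>. blk \<tau> i = take q (drop (i * q) xs) \<and> bok K \<tau> i)"
proof -
  define m where "m = min q (length xs - i * q)"
  have mq: "m \<le> q" "i * q + m \<le> length xs" using iq by (auto simp: m_def)
  have ml: "m \<le> 2 ^ l" using mq K by (meson le_trans less_imp_le power_increasing one_le_numeral)
  have B: "Suc m \<le> Suc K * (q + 2)" using mq by simp
  have take: "take m (drop (i * q) xs) = take q (drop (i * q) xs)" by (simp add: m_def min_def)
  have main: "ok l (Suc K * (q + 2)) copy \<tau> (\<lambda>\<tau>. ok l (Suc K * (q + 2)) build \<tau>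
      (\<lambda>\<tau>. blk \<tau> i = take q (drop (i * q) xs) \<and> bok K \<tau> i))"
    if \<tau>: "\<tau> = \<sigma>\<lparr>nmem := (nmem \<sigma>)(addr 0 i 0 0 := m), nreg := (nreg \<sigma>)(7 := 0)\<rparr>" for \<tau>
  proof (rule ok_conseq[OF copy_ok[of \<tau> i m l xs]], goal_cases)
    case (9 \<rho>)
    have b: "blk \<rho> i = take q (drop (i * q) xs)" using 9(1) q take \<tau> by simp
    have len: "len \<rho> i = m" using 9(2) \<tau> by (simp add: unch_def)
    have "sorted_wrt (<) (map snd (blk \<rho> i))"
      unfolding b using sorted by (simp add: take_map[symmetric] drop_map[symmetric] sorted_wrt_take sorted_wrt_drop)
    then show ?case
      by (intro ok_conseq[OF build_blk_ok[of \<rho> i K l q]])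
        (use 9(2) \<tau> i K mq b len in \<open>auto simp: unch_def\<close>)
  qed (use i q g mq ml B \<tau> in \<open>auto simp: glist_def\<close>)
  show ?thesis
    unfolding fill_def
  proof (intro ok_intros, goal_cases)
    case 3
    show ?case by (rule main) (use 3 i q t in \<open>simp add: m_def\<close>)
  next
    case 6
    show ?case by (rule main) (use 6 i q t in \<open>simp add: m_def\<close>)
  qed simp_all
qed

lemma concat_chunks: "concat (map (\<lambda>i. take q (drop (i * q) xs)) [0..<n]) = take (n * q) xs"
proof (induction n)
  case (Suc n)
  have "take (Suc n * q) xs = take (n * q) xs @ take q (drop (n * q) xs)"
    by (metis add.commute mult_Suc take_add)
  with Suc show ?case by simp
qed simp

text \<open>With \<open>lb = length xs div q\<close> the last block takes the remainder and is empty
  if \<open>q\<close> divides the length. In particular an empty list still occupies one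
  block.\<close>

lemma scatter_ok:
  assumes K: "nreg \<sigma> 3 = K" "nreg \<sigma> 4 = 2 ^ K - 1" "q \<le> 2 ^ K" "K < l"
    and q: "nreg \<sigma> 2 = q" "0 < q" and t: "nreg \<sigma> 16 = length xs" "length xs + 2 \<le> 2 ^ l"
    and g: "glist \<sigma> (length xs) = xs" and sorted: "sorted_wrt (<) (map snd xs)"
    and lb: "nreg \<sigma> 1 = lb" "lb = length xs div q"
  shows "ok l ((lb + 2) * (Suc K * (q + 2))) scatter \<sigma> (\<lambda>\<tau>. conts \<tau> (Suc lb) = xs \<and>
    (\<forall>i\<le>lb. bok K \<tau> i \<and> len \<tau> i \<le> q))"
proof -
  have loop: "ok l ((lb + 2) * (Suc K * (q + 2))) scatter_loop (\<sigma>\<lparr>nreg := (nreg \<sigma>)(6 := 0)\<rparr>)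
    (\<lambda>\<tau>. \<forall>i<Suc lb. bok K \<tau> i \<and> blk \<tau> i = take q (drop (i * q) xs))"
    unfolding scatter_loop_def
  proof (rule ok_While[where n = "Suc lb" and B' = "Suc K * (q + 2)" and I = "\<lambda>n \<tau>. n = Suc lb - nreg \<tau> 6 \<and>
      nreg \<tau> 6 \<le> Suc lb \<and> (\<forall>i<nreg \<tau> 6. bok K \<tau> i \<and> blk \<tau> i = take q (drop (i * q) xs))"], goal_cases)
    case (2 n \<tau>)
    note inv = 2(1)
    define i where "i = nreg \<tau> 6"
    have fr: "nreg \<tau> 1 = lb" "nreg \<tau> 2 = q" "nreg \<tau> 3 = K" "nreg \<tau> 4 = 2 ^ K - 1" "nreg \<tau> 16 = length xs"
      "\<And>j. rm \<tau> 6 0 0 j = rm \<sigma> 6 0 0 j" "\<And>j. rm \<tau> 7 0 0 j = rm \<sigma> 7 0 0 j"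
      using 2(2) lb(1) q(1) K(1,2) t(1) by (simp_all add: unch_def)
    have il: "i \<le> lb" using 2(3) fr(1) by (simp add: i_def)
    then have "i * q \<le> lb * q" by simp
    also have "\<dots> \<le> length xs" unfolding lb(2) by (rule div_times_less_eq_dividend)
    finally have iq: "i * q \<le> length xs" .
    have "lb \<le> length xs" unfolding lb(2) by (rule div_le_dividend)
    then have il2: "Suc i \<le> 2 ^ l" using il t(2) by linarith
    have gt: "glist \<tau> (length xs) = xs" using g fr by (simp add: glist_def)
    show ?case
    proof (intro exI[of _ "n - 1"] conjI ok_Seq, goal_cases)
      case 2
      show ?case
      proof (rule ok_conseq[OF fill_ok[of \<tau> i K q l xs]], goal_cases)
        case (13 \<rho>)
        have "bok K \<rho> i' = bok K \<tau> i' \<and> blk \<rho> i' = blk \<tau> i'" if "i' < i" for i'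
          using unch_same[OF 13(2), of i'] same_bok same_blk that by (simp add: i_def)
        moreover have "nreg \<rho> 6 = i" using 13(2) by (simp add: unch_def i_def)
        moreover from calculation have "\<forall>i'<Suc i. bok K \<rho> i' \<and> blk \<rho> i' = take q (drop (i' * q) xs)"
          using 13(1) inv by (simp add: i_def[symmetric] less_Suc_eq)
        ultimately show ?case
          using inv il il2 by (intro ok_intros) (simp_all add: i_def[symmetric])
      qed (simp_all add: fr K gt sorted iq i_def[symmetric])
    qed (use inv il in \<open>simp add: i_def[symmetric]\<close>)
  next
    case (3 n \<tau>)
    have "nreg \<tau> 1 = lb" using 3(2) lb(1) by (simp add: unch_def)
    then have "nreg \<tau> 6 = Suc lb" using 3(1,3) by simp
    then show ?case using 3(1) by simp
  qed auto
  have fin: "conts \<tau> (Suc lb) = xs \<and> (\<forall>i\<le>lb. bok K \<tau> i \<and> len \<tau> i \<le> q)"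
    if blks: "\<forall>i<Suc lb. bok K \<tau> i \<and> blk \<tau> i = take q (drop (i * q) xs)" for \<tau>
  proof -
    have "conts \<tau> (Suc lb) = take (Suc lb * q) xs"
      unfolding concat_chunks[symmetric] conts_def using that
      by (intro arg_cong[of _ _ concat] map_cong) auto
    moreover have "length xs \<le> Suc lb * q"
      unfolding lb(2) using q(2) dividend_less_div_times[of q "length xs"] by simp
    moreover have "len \<tau> i \<le> q" if "i \<le> lb" for i
    proof -
      have "blk \<tau> i = take q (drop (i * q) xs)" using blks that by simp
      then have "length (blk \<tau> i) \<le> q" by simp
      then show ?thesis by simp
    qed
    ultimately show ?thesis using that by simp
  qed
  show ?thesis
    unfolding scatter_def
    apply (rule ok_Seq, rule ok_NAssign, simp)
    apply simp
    apply (rule ok_conseq[OF loop], simp, simp)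
    apply (rule fin, assumption)
    done
qed

text \<open>Since the queries start from the lower bound \<open>r\<close> in real register 2 in place of \<open>-\<infinity>\<close>, the greedy
  rule compares starting times by \<open>\<le>\<close>. After \<open>q\<close> rounds of \<open>1, 2, \<dots>, q\<close> updates there are at most \<open>q * q\<close>
  intervals.\<close>

definition invar :: "nat \<Rightarrow> nat \<Rightarrow> ival set \<Rightarrow> ram \<Rightarrow> bool" where
  "invar q e S \<sigma> \<longleftrightarrow> (\<exists>K lb. nreg \<sigma> 1 = lb \<and> nreg \<sigma> 2 = q \<and> nreg \<sigma> 3 = K \<and> nreg \<sigma> 4 = 2 ^ K - 1 \<and> nreg \<sigma> 5 = e \<and>
     2 * q \<le> 2 ^ K \<and> 2 ^ K \<le> 4 * q + 1 \<and> lb \<le> q \<and> (e < q \<or> q = 0 \<and> e = 0) \<and>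
     sorted_wrt (<) (map snd (conts \<sigma> (Suc lb))) \<and> set (conts \<sigma> (Suc lb)) = S \<and>
     length (conts \<sigma> (Suc lb)) \<le> q * q + e \<and> (\<forall>i\<le>lb. bok K \<sigma> i \<and> len \<sigma> i \<le> q + e) \<and>
     (\<forall>x\<in>S. rreg \<sigma> 2 \<le> fst x))"

lemma invar_low: "invar q e S \<sigma> \<Longrightarrow> \<forall>x\<in>S. rreg \<sigma> 2 \<le> fst x"
  unfolding invar_def by blast

lemma invar_lower:
  assumes "invar q e S \<sigma>" "r \<le> rreg \<sigma> 2"
  shows "invar q e S (\<sigma>\<lparr>rreg := (rreg \<sigma>)(2 := r)\<rparr>)"
proof -
  have "\<forall>x\<in>S. r \<le> fst x" using invar_low[OF assms(1)] assms(2) by fastforce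
  then show ?thesis using assms(1) unfolding invar_def by simp
qed

text \<open>One inequality with enough slack for the sums and products that are stored, such as
  positions in the scratch arrays, the counter of a query plus twice a block length, and the new
  \<open>2 ^ K - 1\<close>.\<close>

definition roomy :: "nat \<Rightarrow> nat \<Rightarrow> bool" where
  "roomy q l \<longleftrightarrow> 4 * ((q + 4) * (q + 4)) \<le> 2 ^ l"

lemma roomyD:
  assumes "roomy q l"
  shows "4 * (q * q) + 32 * q + 64 \<le> 2 ^ l"
  using assms by (simp add: roomy_def algebra_simps)

lemma roomy_K: "roomy q l \<Longrightarrow> 2 ^ K \<le> 4 * q + 5 \<Longrightarrow> K < l"
proof -
  assume "roomy q l" "2 ^ K \<le> 4 * q + 5"
  then have "(2::nat) ^ K < 2 ^ l" using roomyD[of q l] by linarith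
  then show ?thesis by (rule power_less_imp_less_exp[rotated]) simp
qed

lemma le_pos_mult: "0 < l \<Longrightarrow> n \<le> l * (n::nat)"
  by (cases l) auto

section \<open>Completion of an update and the three operations\<close>

definition finish :: com where
  "finish =
    build;; NAssign 5 (Plus (NReg 5) (NConst 1));;
    If (NLess (NReg 5) (NReg 2)) Skip redistribute"

lemma sorted_blk:
  assumes "sorted_wrt (<) (map snd (conts \<sigma> (Suc n)))" "i \<le> n"
  shows "sorted_wrt (<) (map snd (blk \<sigma> i))"
  using assms(1) unfolding conts_split[OF assms(2)] by (simp add: sorted_wrt_append)

lemma redistribute_ok:
  assumes r: "nreg \<sigma> 1 = lb" "nreg \<sigma> 2 = q" "nreg \<sigma> 3 = K" "nreg \<sigma> 4 = 2 ^ K - 1"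
    and q: "2 * q \<le> 2 ^ K" "2 ^ K \<le> 4 * q + 1" "lb \<le> q" and l: "roomy q l"
    and sorted: "sorted_wrt (<) (map snd (conts \<sigma> (Suc lb)))" and set: "set (conts \<sigma> (Suc lb)) = S"
    and length: "length (conts \<sigma> (Suc lb)) \<le> Suc q * Suc q" and len: "\<forall>i\<le>lb. len \<sigma> i \<le> 2 * q + 1"
    and low: "\<forall>x\<in>S. rreg \<sigma> 2 \<le> fst x"
  shows "ok l ((q + 4) * (l * (2 * q + 4))) redistribute \<sigma> (invar (Suc q) 0 S)"
proof -
  define xs where "xs = conts \<sigma> (Suc lb)"
  note bound = roomyD[OF l]
  have xl: "length xs + 2 \<le> 2 ^ l"
    using length bound by (simp add: xs_def algebra_simps)
  have Kl: "K < l" using roomy_K[OF l, of K] q(2) by simp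
  have B1: "(lb + 2) * Suc (2 * q + 1) \<le> (q + 4) * (l * (2 * q + 4))"
  proof (rule mult_le_mono)
    have "2 * q + 4 \<le> l * (2 * q + 4)" using Kl by (intro le_pos_mult) auto
    then show "Suc (2 * q + 1) \<le> l * (2 * q + 4)" by (rule le_trans[rotated]) simp
  qed (use q in simp)
  have B3: "0 < (q + 4) * (l * (2 * q + 4))" using Kl by simp
  show ?thesis
    unfolding redistribute_def
  proof (rule ok_Seq, rule ok_conseq[OF gather_ok[OF r(1) _ len]], goal_cases)
    case (5 \<sigma>1)
    have s1: "nreg \<sigma>1 1 = lb" "nreg \<sigma>1 2 = q" "nreg \<sigma>1 3 = K" "nreg \<sigma>1 4 = 2 ^ K - 1" "rreg \<sigma>1 2 = rreg \<sigma> 2"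
      using 5(2) r by (simp_all add: unch_def)
    have g0: "glist \<sigma>1 (nreg \<sigma>1 16) = xs" "nreg \<sigma>1 16 = length xs" using 5(1) unfolding xs_def by blast+
    then have g1: "glist \<sigma>1 (length xs) = xs" "nreg \<sigma>1 16 = length xs" by simp_all
    have ql: "8 * q + 16 \<le> 2 ^ l" using bound by linarith
    show ?case
    proof (rule ok_Seq, rule ok_conseq[OF resize_ok[OF s1(2-4) q(1,2) ql g1(2)]], goal_cases)
      case (3 \<sigma>2)
      then obtain K' where s2: "nreg \<sigma>2 1 = length xs div Suc q" "nreg \<sigma>2 2 = Suc q" "nreg \<sigma>2 3 = K'"
        "nreg \<sigma>2 4 = 2 ^ K' - 1" "nreg \<sigma>2 5 = 0" "nreg \<sigma>2 16 = length xs" "2 * Suc q \<le> 2 ^ K'"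
        "2 ^ K' \<le> 4 * Suc q + 1" "rreg \<sigma>2 = rreg \<sigma>1" "nmem \<sigma>2 = nmem \<sigma>1" "rmem \<sigma>2 = rmem \<sigma>1"
        by blast
      have K': "K' < l" using roomy_K[OF l, of K'] s2(8) by simp
      have g2: "glist \<sigma>2 (length xs) = xs" using g1 s2 by (simp add: glist_def)
      have lb': "length xs div Suc q \<le> Suc q"
      proof -
        have "length xs div Suc q \<le> (Suc q * Suc q) div Suc q"
          unfolding xs_def by (rule div_le_mono[OF length])
        also have "\<dots> = Suc q" by (rule nonzero_mult_div_cancel_right) simp
        finally show ?thesis .
      qed
      show ?case
      proof (rule ok_conseq[OF scatter_ok[OF s2(3,4) _ K' s2(2) _ s2(6) xl g2 _ s2(1) refl]], goal_cases)
        case (5)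
        have "(length xs div Suc q + 2) * (Suc K' * (Suc q + 2)) \<le> (q + 4) * (l * (2 * q + 4))"
          using lb' K' by (intro mult_le_mono) auto
        then show ?case .
      next
        case (6 \<sigma>3)
        have "nreg \<sigma>3 1 = length xs div Suc q" "nreg \<sigma>3 2 = Suc q" "nreg \<sigma>3 3 = K'"
          "nreg \<sigma>3 4 = 2 ^ K' - 1" "nreg \<sigma>3 5 = 0" "rreg \<sigma>3 2 = rreg \<sigma> 2"
          using 6(2) s2 s1 by (simp_all add: unch_def)
        then show ?case
          unfolding invar_def
          using 6(1) s2(7,8) lb' sorted set length low
          by (intro exI[of _ K'] exI[of _ "length xs div Suc q"]) (simp add: xs_def[symmetric])
      qed (use s2 sorted in \<open>simp_all add: xs_def[symmetric]\<close>)
    qed (use B3 in simp_all)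
  next
    case 1
    show ?case using bound q by linarith
  next
    case 2
    show ?case using xl by (simp add: xs_def)
  next
    case 4
    show ?case by (rule B1)
  qed simp
qed

text \<open>A redistribution costs about \<open>q\<close> times as much as an ordinary update, and happens when
  \<open>e\<close>, the number of updates since the last one, reaches \<open>q\<close>.\<close>

definition op_bound :: "nat \<Rightarrow> nat \<Rightarrow> nat \<Rightarrow> nat" where
  "op_bound l q e = (if Suc e < q then 1 else q + 4) * (l * (2 * q + 4))"

definition tick :: "nat \<Rightarrow> nat \<Rightarrow> ival set \<Rightarrow> ram \<Rightarrow> bool" where
  "tick q e S \<sigma> \<longleftrightarrow> (if Suc e < q then invar q (Suc e) S \<sigma> else invar (Suc q) 0 S \<sigma>)"

lemma finish_ok:
  assumes r: "nreg \<sigma> 1 = lb" "nreg \<sigma> 2 = q" "nreg \<sigma> 3 = K" "nreg \<sigma> 4 = 2 ^ K - 1" "nreg \<sigma> 5 = e"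
    and q: "2 * q \<le> 2 ^ K" "2 ^ K \<le> 4 * q + 1" "lb \<le> q" "e < q \<or> q = 0 \<and> e = 0" and l: "roomy q l"
    and sorted: "sorted_wrt (<) (map snd (conts \<sigma> (Suc lb)))" and set: "set (conts \<sigma> (Suc lb)) = S"
    and length: "length (conts \<sigma> (Suc lb)) \<le> Suc (q * q + e)"
    and i: "nreg \<sigma> 6 = i" "i \<le> lb" and others: "\<forall>j\<le>lb. j \<noteq> i \<longrightarrow> bok K \<sigma> j"
    and len: "\<forall>j\<le>lb. len \<sigma> j \<le> Suc (q + e)"
    and low: "\<forall>x\<in>S. rreg \<sigma> 2 \<le> fst x"
  shows "ok l (op_bound l q e) finish \<sigma> (tick q e S)"
proof -
  note bound = roomyD[OF l]
  have Kl: "K < l" using roomy_K[OF l, of K] q(2) by simp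
  have one: "l * (2 * q + 4) \<le> op_bound l q e" by (simp add: op_bound_def)
  have B: "Suc K * (2 * q + 1 + 2) \<le> op_bound l q e"
    by (rule le_trans[OF _ one]) (use Kl in \<open>intro mult_le_mono, auto\<close>)
  have B0: "0 < op_bound l q e" using Kl by (simp add: op_bound_def)
  \<comment> \<open>For \<open>0 < q\<close> this follows from \<open>e < q\<close>. For
    \<open>q = 0\<close> the first update yields a block of at most one interval, which fits exactly
    as \<open>2 ^ K = 1\<close>.\<close>
  have qe: "Suc (q + e) \<le> 2 ^ K" "Suc (q + e) \<le> 2 * q + 1" using q by auto
  have "len \<sigma> i \<le> Suc (q + e)" using len i by blast
  then have len_i: "len \<sigma> i \<le> 2 ^ K" "len \<sigma> i \<le> 2 * q + 1" using qe by linarith+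
  show ?thesis
    unfolding finish_def
  proof (rule ok_Seq, rule ok_conseq[OF build_blk_ok[of \<sigma> i K l "2 * q + 1"]], goal_cases)
    case (10 \<tau>)
    have t: "nreg \<tau> 1 = lb" "nreg \<tau> 2 = q" "nreg \<tau> 3 = K" "nreg \<tau> 4 = 2 ^ K - 1" "nreg \<tau> 5 = e" "rreg \<tau> 2 = rreg \<sigma> 2"
      using 10(2) r by (simp_all add: unch_def)
    have other: "bok K \<tau> j = bok K \<sigma> j" "blk \<tau> j = blk \<sigma> j" if "j \<noteq> i" for j
      using unch_same[OF 10(2), of j] same_bok[of j \<sigma> \<tau>] same_blk[of j \<sigma> \<tau>] that i by simp_all
    then have b: "blk \<tau> j = blk \<sigma> j" for j using 10(1) by (cases "j = i") auto
    then have c: "conts \<tau> (Suc lb) = conts \<sigma> (Suc lb)" by (intro conts_cong) simp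
    have lens: "len \<tau> j = len \<sigma> j" for j using b[of j] length_blk by metis
    have all: "\<forall>j\<le>lb. bok K \<tau> j" using others other(1) 10(1) by metis
    have e1: "Suc e \<le> 2 ^ l" using qe(2) bound by linarith
    let ?\<tau> = "\<tau>\<lparr>nreg := (nreg \<tau>)(5 := Suc e)\<rparr>"
    show ?case
    proof (rule ok_Seq, rule ok_NAssign, goal_cases)
      case 1
      then show ?case using t e1 by simp
    next
      case 2
      show ?case
      proof (rule ok_If, goal_cases)
        case 1
        then have lt: "Suc e < q" using t by simp
        have "invar q (Suc e) S ?\<tau>"
          unfolding invar_def
          using t q lt all sorted set length low lens len c
          by (intro exI[of _ K] exI[of _ lb]) simp
        then show ?case using lt t by (intro ok_Skip) (simp add: tick_def)
      next
        case 2
        then have ge: "\<not> Suc e < q" using t by simp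
        have "ok l ((q + 4) * (l * (2 * q + 4))) redistribute ?\<tau> (invar (Suc q) 0 S)"
        proof (rule redistribute_ok[OF _ _ _ _ q(1-3) l])
          show "length (conts ?\<tau> (Suc lb)) \<le> Suc q * Suc q"
          proof -
            have "Suc (q * q + e) \<le> Suc q * Suc q" using q(4) by auto
            from le_trans[OF length this] show ?thesis by (simp only: conts_reg c)
          qed
          show "\<forall>j\<le>lb. len ?\<tau> j \<le> 2 * q + 1"
          proof (intro allI impI)
            fix j assume "j \<le> lb"
            then have "len \<sigma> j \<le> Suc (q + e)" using len by blast
            then show "len ?\<tau> j \<le> 2 * q + 1" using lens[of j] qe(2) by simp
          qed
        qed (use t c sorted set low in simp_all)
        moreover have "tick q e S = invar (Suc q) 0 S" using ge by (simp add: tick_def fun_eq_iff)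
        ultimately show ?case using t ge by (simp add: op_bound_def)
      qed
    qed
  next
    case 9
    show ?case by (rule B)
  qed (use r i Kl len_i B0 sorted_blk[OF sorted i(2)] in simp_all)
qed

definition insert_prog :: com where
  "insert_prog =
    If (RLess (RReg 0) (RReg 2)) (RAssign 2 (RReg 0)) Skip;;
    locate;; insert_blk;; finish"

definition delete_prog :: com where
  "delete_prog = locate;; delete_blk;; finish"

definition query_loop :: com where
  "query_loop = While (Not (NLess (NReg 1) (NReg 6))) (cross;; NAssign 6 (Plus (NReg 6) (NConst 1)))"

definition query_prog :: com where
  "query_prog =
    NAssign 0 (NConst 0);; RAssign 3 (RReg 2);; RAssign 4 (RReg 2);; NAssign 6 (NConst 0);; query_loop"

lemma insert_sorted:
  fixes s f :: real
  assumes "sorted_wrt (<) (map snd (P @ X @ Q))" "\<forall>x\<in>set P. snd x < f" "\<forall>x\<in>set Q. f < snd x"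
    "\<forall>x\<in>set X. snd x \<noteq> f"
  defines "X' \<equiv> filter (\<lambda>x. snd x < f) X @ (s, f) # filter (\<lambda>x. f < snd x) X"
  shows "sorted_wrt (<) (map snd (P @ X' @ Q))" "set (P @ X' @ Q) = insert (s, f) (set (P @ X @ Q))"
    "length X' = Suc (length X)"
proof -
  show "sorted_wrt (<) (map snd (P @ X' @ Q))"
    using assms(1-4) unfolding X'_def
    by (auto simp: sorted_wrt_map sorted_wrt_append sorted_wrt_filter simp del: map_append)
  show "set (P @ X' @ Q) = insert (s, f) (set (P @ X @ Q))"
    using assms(4) unfolding X'_def by (auto simp: neq_iff)
  have "filter (\<lambda>x. f < snd x) X = filter (\<lambda>x. \<not> snd x < f) X"
    using assms(4) by (intro filter_cong) auto
  then show "length X' = Suc (length X)"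
    unfolding X'_def using sum_length_filter_compl[of "\<lambda>x. snd x < f" X] by simp
qed

lemma delete_sorted:
  fixes s f :: real
  assumes "sorted_wrt (<) (map snd (P @ X @ Q))" "\<forall>x\<in>set P. snd x < f" "\<forall>x\<in>set Q. f < snd x"
    "(s, f) \<in> set X"
  defines "X' \<equiv> filter (\<lambda>x. snd x \<noteq> f) X"
  shows "sorted_wrt (<) (map snd (P @ X' @ Q))" "set (P @ X' @ Q) = set (P @ X @ Q) - {(s, f)}"
proof -
  show "sorted_wrt (<) (map snd (P @ X' @ Q))"
    using assms(1-3) unfolding X'_def
    by (auto simp: sorted_wrt_map sorted_wrt_append sorted_wrt_filter simp del: map_append)
  have "sorted_wrt (<) (map snd X)" using assms(1) by (simp add: sorted_wrt_append)
  then have "distinct (map snd X)" by (simp add: strict_sorted_iff)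
  then have uniq: "x = (s, f)" if "x \<in> set X" "snd x = f" for x
    using that assms(4) inj_onD[of snd "set X" x "(s, f)"] by (simp add: distinct_map)
  have "set X' = set X - {(s, f)}"
    unfolding X'_def set_filter by (rule set_eqI, rule iffI) (auto dest: uniq)
  moreover have "(s, f) \<notin> set P" "(s, f) \<notin> set Q" using assms(2,3) by auto
  ultimately show "set (P @ X' @ Q) = set (P @ X @ Q) - {(s, f)}" by auto
qed

text \<open>The scan inspects only the last finishing time of each block; sortedness of the
  concatenation extends the comparison to all elements of earlier and later blocks.\<close>

lemma locate_split:
  assumes sorted: "sorted_wrt (<) (map snd (conts \<sigma> (Suc lb)))" and i: "i \<le> lb"
    and before: "\<forall>j<i. len \<sigma> j = 0 \<or> fin \<sigma> j (len \<sigma> j - 1) < f"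
    and here: "i < lb \<longrightarrow> len \<sigma> i \<noteq> 0 \<and> f \<le> fin \<sigma> i (len \<sigma> i - 1)"
  shows "\<forall>x\<in>set (conts \<sigma> i). snd x < f"
    "\<forall>x\<in>set (concat (map (blk \<sigma>) [Suc i..<Suc lb])). f < snd x"
proof -
  have last: "snd x \<le> fin \<sigma> j (len \<sigma> j - 1)" "len \<sigma> j \<noteq> 0" if jl: "j \<le> lb" and x: "x \<in> set (blk \<sigma> j)" for j x
  proof -
    obtain k where k: "k < len \<sigma> j" "x = blk \<sigma> j ! k"
      using x by (auto simp: in_set_conv_nth)
    then show "len \<sigma> j \<noteq> 0" by auto
    have "fin \<sigma> j k < fin \<sigma> j (len \<sigma> j - 1)" if "k < len \<sigma> j - 1"
      using sorted_blk[OF sorted jl] that by (simp add: sorted_wrt_iff_nth_less)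
    then show "snd x \<le> fin \<sigma> j (len \<sigma> j - 1)"
    proof (cases "k < len \<sigma> j - 1")
      case False
      then have "k = len \<sigma> j - 1" using k by linarith
      then show ?thesis using k by simp
    qed (use k in simp)
  qed
  show "\<forall>x\<in>set (conts \<sigma> i). snd x < f"
  proof
    fix x assume "x \<in> set (conts \<sigma> i)"
    then obtain j where j: "j < i" "x \<in> set (blk \<sigma> j)" by (auto simp: conts_def)
    then have "snd x \<le> fin \<sigma> j (len \<sigma> j - 1)" "len \<sigma> j \<noteq> 0" using last[of j x] i by simp_all
    then show "snd x < f" using before j(1) by (meson le_less_trans)
  qed
  show "\<forall>x\<in>set (concat (map (blk \<sigma>) [Suc i..<Suc lb])). f < snd x"
  proof (cases "i < lb")
    case True
    let ?y = "blk \<sigma> i ! (len \<sigma> i - 1)"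
    have "?y \<in> set (blk \<sigma> i)" by (rule nth_mem) (use here True in simp)
    moreover have "f \<le> snd ?y" using here True by simp
    moreover have "snd ?y < snd x" if "x \<in> set (concat (map (blk \<sigma>) [Suc i..<Suc lb]))" for x
    proof -
      have "\<forall>u\<in>set (map snd (blk \<sigma> i)). \<forall>v\<in>set (map snd (concat (map (blk \<sigma>) [Suc i..<Suc lb]))). u < v"
        using sorted unfolding conts_split[OF i] map_append sorted_wrt_append by blast
      then show ?thesis using that calculation(1) unfolding set_map by blast
    qed
    ultimately show ?thesis by (meson le_less_trans)
  next
    case False
    then have "[Suc i..<Suc lb] = []" using i by simp
    then show ?thesis by simp
  qed
qed

text \<open>Insertion and deletion differ only in how they edit one block. \<open>P\<close> and
  \<open>Q\<close> are the contents before and after it, so that sortedness and the resulting set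
  can be judged on the whole list.\<close>

lemma update_ok:
  assumes inv: "invar q e S \<sigma>" and l: "roomy q l" and low: "\<forall>x\<in>S'. rreg \<sigma> 2 \<le> fst x"
    and unch: "nwr c = {7}" "rwr c = {}" "local c"
    and edit: "\<And>\<tau> i P Q. nreg \<tau> 6 = i \<Longrightarrow> rreg \<tau> 0 = rreg \<sigma> 0 \<Longrightarrow> rreg \<tau> 1 = rreg \<sigma> 1 \<Longrightarrow>
      len \<tau> i \<le> 2 * q \<Longrightarrow> sorted_wrt (<) (map snd (P @ blk \<tau> i @ Q)) \<Longrightarrow> set (P @ blk \<tau> i @ Q) = S \<Longrightarrow>
      \<forall>x\<in>set P. snd x < rreg \<sigma> 1 \<Longrightarrow> \<forall>x\<in>set Q. rreg \<sigma> 1 < snd x \<Longrightarrow>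
      ok l (Suc (len \<tau> i)) c \<tau> (\<lambda>\<rho>. sorted_wrt (<) (map snd (P @ blk \<rho> i @ Q)) \<and>
        set (P @ blk \<rho> i @ Q) = S' \<and> len \<rho> i \<le> Suc (len \<tau> i))"
  shows "ok l (op_bound l q e) (locate;; c;; finish) \<sigma> (tick q e S')"
proof -
  obtain K lb where I: "nreg \<sigma> 1 = lb" "nreg \<sigma> 2 = q" "nreg \<sigma> 3 = K" "nreg \<sigma> 4 = 2 ^ K - 1" "nreg \<sigma> 5 = e"
     "2 * q \<le> 2 ^ K" "2 ^ K \<le> 4 * q + 1" "lb \<le> q" "e < q \<or> q = 0 \<and> e = 0"
     "sorted_wrt (<) (map snd (conts \<sigma> (Suc lb)))" "set (conts \<sigma> (Suc lb)) = S"
     "length (conts \<sigma> (Suc lb)) \<le> q * q + e" "\<forall>i\<le>lb. bok K \<sigma> i \<and> len \<sigma> i \<le> q + e"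
    using inv unfolding invar_def by blast
  note bound = roomyD[OF l]
  have Kl: "K < l" using roomy_K[OF l, of K] I by simp
  have one: "l * (2 * q + 4) \<le> op_bound l q e" by (simp add: op_bound_def)
  have two: "2 * q + 4 \<le> op_bound l q e"
    by (rule le_trans[OF le_pos_mult one]) (use Kl in simp)
  have lbl: "Suc (nreg \<sigma> 1) \<le> 2 ^ l" using I(1,8) bound by linarith
  show ?thesis
  proof (rule ok_Seq, rule ok_conseq[OF locate_ok[OF lbl]], goal_cases)
    case (3 \<tau>)
    define i where "i = nreg \<tau> 6"
    have t: "nreg \<tau> 1 = lb" "nreg \<tau> 2 = q" "nreg \<tau> 3 = K" "nreg \<tau> 4 = 2 ^ K - 1" "nreg \<tau> 5 = e"
      "rreg \<tau> 2 = rreg \<sigma> 2" "rreg \<tau> 0 = rreg \<sigma> 0" "rreg \<tau> 1 = rreg \<sigma> 1"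
      using 3(2) I by (simp_all add: unch_def)
    have same: "same j \<sigma> \<tau>" for j using unch_same[OF 3(2)] by simp
    have b: "blk \<tau> j = blk \<sigma> j" "bok K \<tau> j = bok K \<sigma> j" "len \<tau> j = len \<sigma> j" for j
      using same same_blk same_bok by (auto simp: same_def)
    have il: "i \<le> lb" using 3(1) I by (simp add: i_def)
    define P Q where "P = conts \<sigma> i" and "Q = concat (map (blk \<sigma>) [Suc i..<Suc lb])"
    have split: "conts \<sigma> (Suc lb) = P @ blk \<tau> i @ Q" using conts_split[OF il, of \<sigma>] by (simp add: P_def Q_def b)
    have PQ: "\<forall>x\<in>set P. snd x < rreg \<sigma> 1" "\<forall>x\<in>set Q. rreg \<sigma> 1 < snd x"
      using locate_split[OF I(10) il, of "rreg \<sigma> 1"] 3(1) I(1) by (simp_all add: P_def Q_def i_def)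
    have "len \<sigma> i \<le> q + e" using I(13) il by blast
    then have len: "len \<tau> i \<le> 2 * q" using I(9) b by auto
    show ?case
    proof (rule ok_Seq, rule ok_conseq[OF edit[of \<tau> i P Q]], goal_cases)
      case (11 \<rho>)
      have r: "nreg \<rho> 1 = lb" "nreg \<rho> 2 = q" "nreg \<rho> 3 = K" "nreg \<rho> 4 = 2 ^ K - 1" "nreg \<rho> 5 = e"
        "nreg \<rho> 6 = i" "rreg \<rho> 2 = rreg \<sigma> 2"
        using 11(2) t unch by (simp_all add: unch_def i_def)
      have other: "bok K \<rho> j = bok K \<sigma> j" "blk \<rho> j = blk \<sigma> j" if "j \<noteq> i" for j
        using unch_same[OF 11(2), of j] same_bok[of j \<tau> \<rho>] same_blk[of j \<tau> \<rho>] that unch b by (simp_all add: i_def)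
      have lens: "len \<rho> j = len \<sigma> j" if "j \<noteq> i" for j using other(2)[OF that] length_blk by metis
      have "conts \<rho> i = P" unfolding P_def by (intro conts_cong other) simp
      moreover have "concat (map (blk \<rho>) [Suc i..<Suc lb]) = Q"
        unfolding Q_def by (intro arg_cong[of _ _ concat] map_cong refl other) auto
      ultimately have c: "conts \<rho> (Suc lb) = P @ blk \<rho> i @ Q" using conts_split[OF il, of \<rho>] by simp
      show ?case
      proof (rule finish_ok[OF r(1-5) I(6-9) l _ _ _ r(6) il])
        have "length (P @ blk \<rho> i @ Q) \<le> Suc (length (P @ blk \<tau> i @ Q))" using 11(1) by simp
        then show "length (conts \<rho> (Suc lb)) \<le> Suc (q * q + e)" unfolding c using I(12) split by simp
        show "\<forall>j\<le>lb. len \<rho> j \<le> Suc (q + e)"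
        proof (intro allI impI)
          fix j assume "j \<le> lb"
          then show "len \<rho> j \<le> Suc (q + e)" using I(13) lens[of j] 11(1) b(3)[of i]
            by (cases "j = i") (auto intro: le_SucI le_trans)
        qed
      qed (use 11(1) c I(13) other low r in auto)
    next
      case 10
      then show ?case using len two by linarith
    next
      case 5
      show ?case using I(10) unfolding split .
    next
      case 6
      show ?case using I(11) unfolding split .
    next
      case 4
      show ?case by (rule len)
    qed (use t(7,8) PQ in \<open>simp_all add: i_def[symmetric]\<close>)
  next
    case 2
    show ?case using two I(1,8) by linarith
  qed simp
qed

text \<open>Real register 2 starts at 0 and is only ever lowered, so it remains a lower bound under
  deletions too.\<close>

lemma insert_ok:
  assumes inv: "invar q e S \<sigma>" and l: "roomy q l" and I: "rreg \<sigma> 0 = s" "rreg \<sigma> 1 = f"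
    and new: "\<forall>x\<in>S. snd x \<noteq> f"
  shows "ok l (op_bound l q e) insert_prog \<sigma> (tick q e (insert (s, f) S))"
proof -
  have ins: "ok l (op_bound l q e) (locate;; insert_blk;; finish) \<tau> (tick q e (insert (s, f) S))"
    if inv: "invar q e S \<tau>" and low: "\<forall>x\<in>insert (s, f) S. rreg \<tau> 2 \<le> fst x"
      and r: "rreg \<tau> 0 = s" "rreg \<tau> 1 = f" for \<tau>
  proof (rule update_ok[OF inv l low], goal_cases)
    case (4 \<rho> i P Q)
    have m: "Suc (len \<rho> i) \<le> 2 ^ l" using roomyD[OF l] 4(4) by linarith
    have sorted: "sorted_wrt (<) (map snd (blk \<rho> i))" using 4(5) by (simp add: sorted_wrt_append)
    have new': "\<forall>x\<in>set (blk \<rho> i). snd x \<noteq> f" using 4(6) new by auto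
    note o = 4
    have PQ: "\<forall>x\<in>set P. snd x < f" "\<forall>x\<in>set Q. f < snd x" using 4(7,8) r by simp_all
    show ?case
    proof (rule ok_conseq[OF insert_blk_ok[OF 4(1) refl m sorted new', where s = s]], goal_cases)
      case (5 \<pi>)
      note * = insert_sorted[OF o(5) PQ new', where s = s, folded 5(1)]
      have "set (P @ blk \<pi> i @ Q) = insert (s, f) S" using *(2) unfolding o(6) .
      moreover have "len \<pi> i \<le> Suc (len \<rho> i)" using *(3) by simp
      ultimately show ?case using *(1) by blast
    qed (use o(2,3) r in simp_all)
  qed simp_all
  note low = invar_low[OF inv]
  show ?thesis
    unfolding insert_prog_def
  proof (rule ok_Seq, intro ok_If ok_RAssign ok_Skip, goal_cases)
    case 1
    then have lt: "s \<le> rreg \<sigma> 2" using I by simp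
    let ?\<sigma> = "\<sigma>\<lparr>rreg := (rreg \<sigma>)(2 := s)\<rparr>"
    have "\<forall>x\<in>insert (s, f) S. rreg ?\<sigma> 2 \<le> fst x" using low lt by fastforce
    then have "ok l (op_bound l q e) (locate;; insert_blk;; finish) ?\<sigma> (tick q e (insert (s, f) S))"
      by (rule ins[OF invar_lower[OF inv lt]]) (use I in simp_all)
    then show ?case using I by simp
  next
    case 2
    show ?case by (rule ins[OF inv]) (use 2 I low in auto)
  qed
qed

lemma delete_ok:
  assumes inv: "invar q e S \<sigma>" and l: "roomy q l" and I: "rreg \<sigma> 1 = f" and mem: "(s, f) \<in> S"
  shows "ok l (op_bound l q e) delete_prog \<sigma> (tick q e (S - {(s, f)}))"
proof -
  have low: "\<forall>x\<in>S - {(s, f)}. rreg \<sigma> 2 \<le> fst x" using invar_low[OF inv] by blast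
  show ?thesis
    unfolding delete_prog_def
  proof (rule update_ok[OF inv l low], goal_cases)
    case (4 \<rho> i P Q)
    have m: "Suc (len \<rho> i) \<le> 2 ^ l" using roomyD[OF l] 4(4) by linarith
    have sorted: "sorted_wrt (<) (map snd (blk \<rho> i))" using 4(5) by (simp add: sorted_wrt_append)
    have mem': "(s, f) \<in> set (blk \<rho> i)" using 4(6-8) mem I by auto
    have PQ: "\<forall>x\<in>set P. snd x < f" "\<forall>x\<in>set Q. f < snd x" using 4(7,8) I by simp_all
    note o = 4
    show ?case
    proof (rule ok_conseq[OF delete_blk_ok[OF 4(1) refl m sorted mem']], goal_cases)
      case (4 \<pi>)
      have "length (blk \<pi> i) \<le> length (blk \<rho> i)" unfolding 4(1) by (rule length_filter_le)
      then have "len \<pi> i \<le> Suc (len \<rho> i)" by simp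
      moreover note * = delete_sorted[OF o(5) PQ mem', folded 4(1)]
      have "set (P @ blk \<pi> i @ Q) = S - {(s, f)}" using *(2) unfolding o(6) .
      ultimately show ?case using *(1) by blast
    qed (use o(3) I in simp_all)
  qed simp_all
qed

section \<open>Queries and the amortized cost\<close>

text \<open>\<open>A\<close> is the initial value or a finishing time already seen; quantifying over
  upper bounds \<open>F\<close> avoids the maximum of a possibly empty list. With \<open>F\<close>
  the first finishing time of the next block this yields the hypothesis \<open>A \<le> f 0\<close>
  of \<open>cross_ok\<close>.\<close>

lemma foldl_step_bounds:
  "foldl step (a, b, c) xs = (A, B, C) \<Longrightarrow> b \<le> a \<Longrightarrow> sorted_wrt (<) (map snd xs) \<Longrightarrow>
    \<forall>x\<in>set xs. a \<le> snd x \<Longrightarrow> B \<le> A \<and> (\<forall>F. a \<le> F \<longrightarrow> (\<forall>x\<in>set xs. snd x \<le> F) \<longrightarrow> A \<le> F)"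
proof (induction xs arbitrary: a b c)
  case (Cons x xs)
  obtain s f where x: "x = (s, f)" by force
  have sorted: "sorted_wrt (<) (map snd xs)" and later: "\<forall>x\<in>set xs. f \<le> snd x" "a \<le> f" "\<forall>x\<in>set xs. a \<le> snd x"
    using Cons.prems by (auto simp: x less_imp_le)
  consider "a \<le> s" | "b \<le> s" "s < a" | "s < b" by linarith
  then show ?case
  proof cases
    case 1
    then have "B \<le> A \<and> (\<forall>F. f \<le> F \<longrightarrow> (\<forall>x\<in>set xs. snd x \<le> F) \<longrightarrow> A \<le> F)"
      using Cons.prems(1,2) later sorted by (intro Cons.IH[of f b "Suc c"]) (auto simp: x)
    then show ?thesis by (simp add: x)
  next
    case 2
    then have "B \<le> A \<and> (\<forall>F. f \<le> F \<longrightarrow> (\<forall>x\<in>set xs. snd x \<le> F) \<longrightarrow> A \<le> F)"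
      using Cons.prems(1,2) later sorted by (intro Cons.IH[of f a "Suc c"]) (auto simp: x)
    then show ?thesis by (simp add: x)
  next
    case 3
    then have "B \<le> A \<and> (\<forall>F. a \<le> F \<longrightarrow> (\<forall>x\<in>set xs. snd x \<le> F) \<longrightarrow> A \<le> F)"
      using Cons.prems(1,2) later sorted by (intro Cons.IH[of a b c]) (auto simp: x)
    then show ?thesis by (simp add: x)
  qed
qed simp

lemma query_frame [simp]:
  "nwr query_loop = {0, 6, 7, 8, 9, 10, 11, 12, 14, 15}" "rwr query_loop = {3, 4, 5}"
  "nst query_loop = {}" "rst query_loop = {}"
  "nwr query_prog = {0, 6, 7, 8, 9, 10, 11, 12, 14, 15}" "rwr query_prog = {3, 4, 5}"
  "nst query_prog = {}" "rst query_prog = {}"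
  by (auto simp: query_loop_def query_prog_def)

lemma invar_unch:
  assumes "invar q e S \<sigma>" "unch c \<sigma> \<tau>" "nst c = {}" "rst c = {}" "{1, 2, 3, 4, 5} \<inter> nwr c = {}" "2 \<notin> rwr c"
  shows "invar q e S \<tau>"
proof -
  have regs: "nreg \<tau> 1 = nreg \<sigma> 1" "nreg \<tau> 2 = nreg \<sigma> 2" "nreg \<tau> 3 = nreg \<sigma> 3" "nreg \<tau> 4 = nreg \<sigma> 4"
    "nreg \<tau> 5 = nreg \<sigma> 5" "rreg \<tau> 2 = rreg \<sigma> 2"
    using assms(2,5,6) by (auto simp: unch_def)
  have "same i \<sigma> \<tau>" for i using unch_same[OF assms(2)] assms(3,4) by simp
  then have "blk \<tau> i = blk \<sigma> i" "bok K \<tau> i = bok K \<sigma> i" "len \<tau> i = len \<sigma> i" for i K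
    using same_blk same_bok by (auto simp: same_def)
  moreover from this have "conts \<tau> n = conts \<sigma> n" for n by (intro conts_cong)
  ultimately show ?thesis using assms(1) unfolding invar_def regs by simp
qed

lemma query_ok:
  assumes inv: "invar q e S \<sigma>" and l: "roomy q l" and S: "\<forall>x\<in>S. fst x < snd x" "distinct_ends S"
  shows "ok l (l * (2 * q + 4)) query_prog \<sigma> (\<lambda>\<tau>. invar q e S \<tau> \<and> nreg \<tau> 0 = opt2 S)"
proof -
  obtain K lb where I: "nreg \<sigma> 1 = lb" "nreg \<sigma> 2 = q" "nreg \<sigma> 3 = K" "nreg \<sigma> 4 = 2 ^ K - 1" "nreg \<sigma> 5 = e"
     "2 * q \<le> 2 ^ K" "2 ^ K \<le> 4 * q + 1" "lb \<le> q" "e < q \<or> q = 0 \<and> e = 0"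
     "sorted_wrt (<) (map snd (conts \<sigma> (Suc lb)))" "set (conts \<sigma> (Suc lb)) = S"
     "length (conts \<sigma> (Suc lb)) \<le> q * q + e" "\<forall>i\<le>lb. bok K \<sigma> i \<and> len \<sigma> i \<le> q + e"
     "\<forall>x\<in>S. rreg \<sigma> 2 \<le> fst x"
    using inv unfolding invar_def by blast
  note bound = roomyD[OF l]
  have Kl: "K < l" using roomy_K[OF l, of K] I by simp
  define r where "r = rreg \<sigma> 2"
  let ?\<sigma> = "\<sigma>\<lparr>nreg := (nreg \<sigma>)(0 := 0, 6 := 0), rreg := (rreg \<sigma>)(3 := r, 4 := r)\<rparr>"
  have B: "Suc (Suc lb) * Suc K \<le> l * (2 * q + 4)"
  proof -
    have "Suc (Suc lb) * Suc K \<le> (2 * q + 4) * l" using I(8) Kl by (intro mult_le_mono) auto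
    then show ?thesis by (simp only: mult.commute)
  qed
  have loop: "ok l (l * (2 * q + 4)) query_loop \<sigma>0 (\<lambda>\<tau>. nreg \<tau> 0 = opt2 S)"
    if \<sigma>0: "nreg \<sigma>0 0 = 0" "nreg \<sigma>0 6 = 0" "rreg \<sigma>0 3 = r" "rreg \<sigma>0 4 = r" "nreg \<sigma>0 1 = lb"
      "nreg \<sigma>0 3 = K" "nreg \<sigma>0 4 = 2 ^ K - 1" "nmem \<sigma>0 = nmem \<sigma>" "rmem \<sigma>0 = rmem \<sigma>" for \<sigma>0
    unfolding query_loop_def
  proof (rule ok_While[where n = "Suc lb" and B' = "Suc K" and I = "\<lambda>n \<tau>. n = Suc lb - nreg \<tau> 6 \<and>
      nreg \<tau> 6 \<le> Suc lb \<and> result (foldl step (r, r, 0) (conts \<sigma> (nreg \<tau> 6))) \<tau>"], goal_cases)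
    case 1
    show ?case using \<sigma>0 by (simp add: conts_def)
  next
    case (2 n \<tau>)
    define i where "i = nreg \<tau> 6"
    have t: "nreg \<tau> 1 = lb" "nreg \<tau> 3 = K" "nreg \<tau> 4 = 2 ^ K - 1"
      "\<And>v i k a. nm \<tau> v i k a = nm \<sigma> v i k a" "\<And>v i k a. rm \<tau> v i k a = rm \<sigma> v i k a"
      using 2(2) \<sigma>0 by (simp_all add: unch_def)
    have same: "same i \<sigma> \<tau>" using t by (simp add: same_def)
    have b: "blk \<tau> i = blk \<sigma> i" "bok K \<tau> i = bok K \<sigma> i" "len \<tau> i = len \<sigma> i"
      using same same_blk same_bok by (auto simp: same_def)
    have il: "i \<le> lb" using 2(3) t(1) by (simp add: i_def)
    have "len \<sigma> i \<le> q + e" using I(13) il by blast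
    then have m: "len \<tau> i \<le> 2 * q" "len \<tau> i \<le> 2 ^ K" using I(6,9) b(3) by auto
    obtain A B c where st: "foldl step (r, r, 0) (conts \<sigma> i) = (A, B, c)" by (cases "foldl step (r, r, 0) (conts \<sigma> i)")
    have regs: "rreg \<tau> 3 = A" "rreg \<tau> 4 = B" "nreg \<tau> 0 = c" using 2(1) st by (simp_all add: i_def)
    note split = conts_split[OF il, of \<sigma>]
    have sorted: "sorted_wrt (<) (map snd (conts \<sigma> i))" "\<forall>x\<in>set (conts \<sigma> i). \<forall>y\<in>set (blk \<sigma> i). snd x < snd y"
      using I(10) unfolding split by (simp_all add: sorted_wrt_append)
    have r_le: "r \<le> snd x" if "x \<in> set (conts \<sigma> i) \<union> set (blk \<sigma> i)" for x
    proof -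
      have "x \<in> S" using that I(11) unfolding split by auto
      then show ?thesis using I(14) S(1) by (fastforce simp: r_def)
    qed
    have AB: "B \<le> A" "\<forall>F. r \<le> F \<longrightarrow> (\<forall>x\<in>set (conts \<sigma> i). snd x \<le> F) \<longrightarrow> A \<le> F"
      using foldl_step_bounds[OF st _ sorted(1)] r_le by simp_all
    have A0: "0 < len \<tau> i \<longrightarrow> A \<le> fin \<tau> i 0"
    proof
      assume "0 < len \<tau> i"
      then have y: "blk \<sigma> i ! 0 \<in> set (blk \<sigma> i)" "snd (blk \<sigma> i ! 0) = fin \<tau> i 0"
        using b(3) t(5) by (simp_all add: nth_mem del: nth_blk) simp
      then show "A \<le> fin \<tau> i 0" using AB(2) r_le[of "blk \<sigma> i ! 0"] sorted(2) by (metis UnCI less_imp_le)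
    qed
    have "c \<le> length (conts \<sigma> i)" using foldl_step_le[of r r 0 "conts \<sigma> i"] st by simp
    also have "\<dots> \<le> q * q + e" using I(12) unfolding split by simp
    finally have c: "c + 2 * len \<tau> i < 2 ^ l" using m bound I(9) by auto
    have env: "env l K i (start \<tau> i) (fin \<tau> i) (len \<tau> i) \<tau>"
      using t m Kl sorted_blk[OF I(10) il] b by (intro env_blk) (simp_all add: i_def[symmetric])
    have bok: "built K i (start \<tau> i) (fin \<tau> i) (len \<tau> i) \<tau>"
      using I(13) il b(2) by (simp add: bok_def)
    have tables: "succ_table K i (start \<tau> i) (len \<tau> i) \<tau>" "nxt_table K i (start \<tau> i) (fin \<tau> i) (len \<tau> i) \<tau>"
      "entries i (start \<tau> i) (fin \<tau> i) (len \<tau> i) 0 \<tau>"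
      using bok by (simp_all add: built_def)
    have after: "rest (start \<tau> i) (fin \<tau> i) (len \<tau> i) 0 (A, B, c) = foldl step (r, r, 0) (conts \<sigma> (Suc i))"
    proof -
      have "rest (start \<tau> i) (fin \<tau> i) (len \<tau> i) 0 (A, B, c) = foldl step (A, B, c) (blk \<tau> i)"
        by (simp only: rest_def blk_def)
      then show ?thesis using b(1) st by (simp add: conts_Suc)
    qed
    have i1: "Suc i \<le> 2 ^ l" using il I(8) bound by linarith
    note inv = 2(1)
    show ?case
    proof (intro exI[of _ "n - 1"] conjI ok_Seq, goal_cases)
      case 2
      show ?case
      proof (rule ok_conseq[OF cross_ok[OF env tables regs(1,2) AB(1) A0 regs(3) c]], goal_cases)
        case (3 \<rho>)
        have "nreg \<rho> 6 = i" using 3(2) by (simp add: unch_def i_def)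
        then show ?case
          using 3(1) inv il i1 unfolding after by (intro ok_intros) (simp_all add: i_def[symmetric])
      qed simp_all
    qed (use inv il in \<open>simp add: i_def[symmetric]\<close>)
  next
    case (3 n \<tau>)
    have "nreg \<tau> 1 = lb" using 3(2) \<sigma>0(5) by (simp add: unch_def)
    then have "nreg \<tau> 6 = Suc lb" using 3(1,3) by simp
    then have "nreg \<tau> 0 = snd (snd (foldl step (r, r, 0) (conts \<sigma> (Suc lb))))"
      using 3(1) by (metis snd_conv)
    also have "\<dots> = opt2 (set (conts \<sigma> (Suc lb)))"
      using I(10,11,14) S by (intro greedy_opt2) (simp_all add: r_def)
    finally show ?case using I(11) by simp
  qed (use B in simp_all)
  have "ok l (l * (2 * q + 4)) query_prog \<sigma> (\<lambda>\<tau>. nreg \<tau> 0 = opt2 S)"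
    unfolding query_prog_def
    apply (intro ok_Seq ok_NAssign ok_RAssign)
      apply (simp, simp)
    apply (rule loop)
    using I by (simp_all add: r_def)
  then show ?thesis
  proof (rule ok_conseq, goal_cases)
    case 1
    show ?case using Kl by simp
  next
    case (3 \<tau>)
    then show ?case using invar_unch[OF inv 3(2)] by simp
  qed simp
qed

section \<open>Amortization over a sequence of operations\<close>

definition two_machine_ds :: data_structure where
  "two_machine_ds = DS insert_prog delete_prog query_prog"

definition ds_cost :: nat where
  "ds_cost = ccost insert_prog + ccost delete_prog + ccost query_prog"

lemma invar_pass [simp]: "invar q e S (pass I \<sigma>) = invar q e S \<sigma>"
  by (simp add: invar_def pass_def)

lemma bnd_pass [simp]: "bnd l (pass I \<sigma>) = bnd l \<sigma>"
  by (simp add: bnd_def pass_def)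

text \<open>For an empty block with \<open>K = 0\<close> the tables consist of the cell of the end
  marker, whose jump leads to 0, as the zeroed memory says.\<close>

lemma invar_initial: "invar 0 0 {} initial"
proof -
  have "conts initial (Suc 0) = []" by (simp add: conts_def blk_def initial_def)
  moreover have "bok 0 initial 0"
    by (simp add: bok_def built_def succ_table_def nxt_table_def entries_def table_def cell_def initial_def)
  ultimately show ?thesis by (simp add: invar_def) (simp add: initial_def)
qed

definition well_formed :: "ival set \<Rightarrow> bool" where
  "well_formed S \<longleftrightarrow> (\<forall>x\<in>S. fst x < snd x) \<and> distinct_ends S"

lemma well_formed_update: "well_formed S \<Longrightarrow> admissible p S \<Longrightarrow> well_formed (update p S)"
  by (cases p) (auto simp: well_formed_def distinct_ends_def)

text \<open>Two potentials are at work. \<open>q * (q - 1) + 2 * e\<close> grows by at most 2 per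
  update, which ties \<open>q\<close> to the square root of the number of updates. In units of an
  ordinary update a redistribution costs \<open>q + 4 \<le> e + 5\<close>, so it is paid from the
  potential \<open>e\<close>, and the amortized cost is at most 6.\<close>

lemma update_exec:
  assumes ok: "ok l (op_bound l q e) c \<sigma> (tick q e S)" and bnd: "bnd l \<sigma>" and l: "0 < l"
    and c: "ccost c \<le> C" and q: "q \<le> Q"
  shows "\<exists>t \<sigma>' q' e' w. exec c \<sigma> t \<sigma>' \<and> bnd l \<sigma>' \<and> invar q' e' S \<sigma>' \<and>
    q' * (q' - 1) + 2 * e' \<le> q * (q - 1) + 2 * e + 2 \<and>
    t \<le> C * (l * (2 * Q + 4)) * Suc l * w \<and> w + e' \<le> 6 + e"
proof -
  define w where "w = (if Suc e < q then 1 else q + 4)"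
  have "0 < op_bound l q e" using l by (simp add: op_bound_def)
  then obtain t \<sigma>' where t: "exec c \<sigma> t \<sigma>'" "t \<le> ccost c * op_bound l q e * Suc l" "bnd l \<sigma>'" "tick q e S \<sigma>'"
    using ok bnd unfolding ok_def by blast
  have "ccost c * op_bound l q e * Suc l \<le> C * (w * (l * (2 * Q + 4))) * Suc l"
    unfolding op_bound_def w_def[symmetric] using c q by (intro mult_le_mono) auto
  then have tw: "t \<le> C * (l * (2 * Q + 4)) * Suc l * w" using t(2) by (simp only: mult_ac)
  show ?thesis
  proof (cases "Suc e < q")
    case True
    then have "invar q (Suc e) S \<sigma>'" using t(4) by (simp add: tick_def)
    then show ?thesis using t tw True
      by (intro exI[of _ t] exI[of _ \<sigma>'] exI[of _ q] exI[of _ "Suc e"] exI[of _ w]) (simp add: w_def)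
  next
    case False
    then have "invar (Suc q) 0 S \<sigma>'" using t(4) by (simp add: tick_def)
    moreover have "Suc q * (Suc q - 1) + 2 * 0 \<le> q * (q - 1) + 2 * e + 2"
      using False by (cases q) auto
    ultimately show ?thesis using t tw False
      by (intro exI[of _ t] exI[of _ \<sigma>'] exI[of _ "Suc q"] exI[of _ 0] exI[of _ w]) (simp add: w_def)
  qed
qed

text \<open>\<open>Q\<close> and \<open>l\<close> are chosen once for the entire sequence; the bound
  on \<open>q * (q - 1)\<close> ensures that \<open>q\<close> never outgrows \<open>Q\<close>. The
  updates already made in the current round enter the budget as the saved potential
  \<open>e\<close>.\<close>

lemma serve_ok:
  assumes Q: "\<And>q. q * (q - 1) \<le> 2 * n \<Longrightarrow> q \<le> Q" and l: "roomy Q l" "0 < l"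
  defines "X \<equiv> ds_cost * (l * (2 * Q + 4)) * Suc l"
  shows "invar q e S \<sigma> \<Longrightarrow> bnd l \<sigma> \<Longrightarrow> well_formed S \<Longrightarrow> valid_ops S ps \<Longrightarrow>
    q * (q - 1) + 2 * e + 2 * length ps \<le> 2 * n \<Longrightarrow>
    \<exists>t. serve two_machine_ds \<sigma> ps t (answers S ps) \<and> t \<le> X * (6 * length ps + e)"
proof (induction ps arbitrary: q e S \<sigma>)
  case Nil
  then show ?case using serve.none by (intro exI[of _ 0]) simp
next
  case (Cons p ps)
  have qQ: "q \<le> Q" using Cons.prems(5) by (intro Q) simp
  have "(q + 4) * (q + 4) \<le> (Q + 4) * (Q + 4)" using qQ by (intro mult_le_mono) auto
  then have room: "roomy q l" using l(1) unfolding roomy_def by linarith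
  have adm: "admissible p S" and valid: "valid_ops (update p S) ps" using Cons.prems(4) by auto
  have wf: "well_formed (update p S)" using Cons.prems(3) adm by (rule well_formed_update)
  have upd: "\<exists>t \<sigma>' u. exec c \<tau> t \<sigma>' \<and> serve two_machine_ds \<sigma>' ps u (answers (update p S) ps) \<and>
      t + u \<le> X * (6 * length (p # ps) + e)"
    if ok: "ok l (op_bound l q e) c \<tau> (tick q e (update p S))" and c: "ccost c \<le> ds_cost" and \<tau>: "bnd l \<tau>" for c \<tau>
  proof -
    obtain t \<sigma>' q' e' w where t: "exec c \<tau> t \<sigma>'" "bnd l \<sigma>'" "invar q' e' (update p S) \<sigma>'"
      "q' * (q' - 1) + 2 * e' \<le> q * (q - 1) + 2 * e + 2" "t \<le> X * w" "w + e' \<le> 6 + e"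
      using update_exec[OF ok \<tau> l(2) c qQ] unfolding X_def by blast
    have "q' * (q' - 1) + 2 * e' + 2 * length ps \<le> 2 * n" using t(4) Cons.prems(5) by simp
    then obtain u where u: "serve two_machine_ds \<sigma>' ps u (answers (update p S) ps)"
        "u \<le> X * (6 * length ps + e')"
      using Cons.IH[OF t(3,2) wf valid] by blast
    have "t + u \<le> X * w + X * (6 * length ps + e')" using t(5) u(2) by simp
    also have "\<dots> = X * (w + e' + 6 * length ps)" by (simp add: distrib_left)
    also have "\<dots> \<le> X * (6 * length (p # ps) + e)" using t(6) by (intro mult_le_mono) auto
    finally show ?thesis using t(1) u(1) by blast
  qed
  show ?case
  proof (cases p)
    case (Insert I)
    have "ok l (op_bound l q e) insert_prog (pass I \<sigma>) (tick q e (insert (fst I, snd I) S))"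
    proof (rule insert_ok[OF _ room])
      show "\<forall>x\<in>S. snd x \<noteq> snd I" using adm by (auto simp: Insert)
    qed (use Cons.prems(1) in \<open>simp_all, simp_all add: pass_def\<close>)
    then have "ok l (op_bound l q e) insert_prog (pass I \<sigma>) (tick q e (update p S))" by (simp add: Insert)
    from upd[OF this] obtain t \<sigma>' u where "exec insert_prog (pass I \<sigma>) t \<sigma>'"
        "serve two_machine_ds \<sigma>' ps u (answers (update p S) ps)" "t + u \<le> X * (6 * length (p # ps) + e)"
      using Cons.prems(2) by (auto simp: ds_cost_def)
    then show ?thesis using serve.ins[of two_machine_ds I \<sigma> t \<sigma>' ps u]
      by (intro exI[of _ "t + u"]) (simp add: Insert two_machine_ds_def)
  next
    case (Delete I)
    have "ok l (op_bound l q e) delete_prog (pass I \<sigma>) (tick q e (S - {(fst I, snd I)}))"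
      by (rule delete_ok[OF _ room]) (use Cons.prems(1) adm in \<open>simp_all add: Delete, simp_all add: pass_def\<close>)
    then have "ok l (op_bound l q e) delete_prog (pass I \<sigma>) (tick q e (update p S))" by (simp add: Delete)
    from upd[OF this] obtain t \<sigma>' u where "exec delete_prog (pass I \<sigma>) t \<sigma>'"
        "serve two_machine_ds \<sigma>' ps u (answers (update p S) ps)" "t + u \<le> X * (6 * length (p # ps) + e)"
      using Cons.prems(2) by (auto simp: ds_cost_def)
    then show ?thesis using serve.del[of two_machine_ds I \<sigma> t \<sigma>' ps u]
      by (intro exI[of _ "t + u"]) (simp add: Delete two_machine_ds_def)
  next
    case Query
    have "ok l (l * (2 * q + 4)) query_prog \<sigma> (\<lambda>\<tau>. invar q e S \<tau> \<and> nreg \<tau> 0 = opt2 S)"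
      using query_ok[OF Cons.prems(1) room] Cons.prems(3) by (simp add: well_formed_def)
    then obtain t \<sigma>' where t: "exec query_prog \<sigma> t \<sigma>'" "t \<le> ccost query_prog * (l * (2 * q + 4)) * Suc l"
        "bnd l \<sigma>'" "invar q e S \<sigma>'" "nreg \<sigma>' 0 = opt2 S"
      using Cons.prems(2) l(2) unfolding ok_def by auto
    have "ccost query_prog * (l * (2 * q + 4)) * Suc l \<le> X"
      unfolding X_def using qQ by (intro mult_le_mono) (auto simp: ds_cost_def)
    then have tX: "t \<le> X" using t(2) by linarith
    obtain u where u: "serve two_machine_ds \<sigma>' ps u (answers S ps)" "u \<le> X * (6 * length ps + e)"
      using Cons.IH[OF t(4,3) Cons.prems(3)] valid Cons.prems(5) by (auto simp: Query)
    have "t + u \<le> X * (6 * length (p # ps) + e)" using tX u(2) by (simp add: distrib_left)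
    then show ?thesis using serve.qry[of two_machine_ds \<sigma> t \<sigma>' ps u "answers S ps"] t(1,5) u(1)
      by (intro exI[of _ "t + u"]) (simp add: Query two_machine_ds_def)
  qed
qed

text \<open>\<open>side n\<close> bounds the block parameter \<open>q\<close> and \<open>width n\<close> the bit length of all numbers during \<open>n\<close> operations.\<close>

definition side :: "nat \<Rightarrow> nat" where
  "side n = nat \<lceil>sqrt (2 * real n)\<rceil> + 1"

definition width :: "nat \<Rightarrow> nat" where
  "width n = floorlog 2 (4 * ((side n + 4) * (side n + 4)))"

definition op_time :: "nat \<Rightarrow> real" where
  "op_time n = 6 * real (ds_cost * (width n * (2 * side n + 4)) * Suc (width n))"

section \<open>Growth of the time bound\<close>

lemma le_side: "q * (q - 1) \<le> 2 * n \<Longrightarrow> q \<le> side n"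
proof (cases q)
  case (Suc p)
  assume "q * (q - 1) \<le> 2 * n"
  then have "p * p \<le> 2 * n" using Suc by simp
  then have "real p ^ 2 \<le> 2 * real n" unfolding power2_eq_square by (metis of_nat_le_iff of_nat_mult of_nat_numeral)
  then have "real p \<le> sqrt (2 * real n)" by (rule real_le_rsqrt)
  then have "p \<le> nat \<lceil>sqrt (2 * real n)\<rceil>" by linarith
  then show ?thesis by (simp add: side_def Suc)
qed simp

lemma roomy_width: "roomy (side n) (width n)" "0 < width n"
proof -
  let ?x = "4 * ((side n + 4) * (side n + 4))"
  have "?x < 2 ^ width n" unfolding width_def using floorlog_bounds[of ?x 2] by simp
  then show "roomy (side n) (width n)" by (simp add: roomy_def)
  show "0 < width n" using \<open>?x < 2 ^ width n\<close> by (cases "width n") auto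
qed

lemma supports_op_time: "supports_in_amortized two_machine_ds op_time"
  unfolding supports_in_amortized_def
proof (intro allI impI)
  fix ps assume valid: "valid_ops {} ps"
  let ?n = "length ps"
  have "bnd (width ?n) initial" by (simp add: bnd_def initial_def)
  moreover have "well_formed {}" by (simp add: well_formed_def distinct_ends_def)
  ultimately obtain t where "serve two_machine_ds initial ps t (answers {} ps)"
      "t \<le> ds_cost * (width ?n * (2 * side ?n + 4)) * Suc (width ?n) * (6 * ?n + 0)"
    using serve_ok[OF le_side roomy_width invar_initial _ _ valid, of ?n] by auto
  moreover have "real (ds_cost * (width ?n * (2 * side ?n + 4)) * Suc (width ?n) * (6 * ?n + 0)) =
      real ?n * op_time ?n"
    by (simp add: op_time_def)
  ultimately show "\<exists>t. serve two_machine_ds initial ps t (answers {} ps) \<and> real t \<le> real ?n * op_time ?n"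
    by (metis of_nat_le_iff)
qed

text \<open>Two logarithmic factors arise: one from the height of the jump tables, one from the bit
  lengths charged for every elementary operation.\<close>

lemma op_time_soft_O: "op_time \<in> soft_O (\<lambda>n. real n powr (1/2))"
proof -
  \<comment> \<open>For \<open>3 \<le> n\<close> the logarithm is at least 1 and absorbs constants.
    With \<open>r\<close> the square root of \<open>n\<close>, \<open>side n \<le> 4 * r\<close>
    gives the 12 in \<open>2 * side n + 4 \<le> 12 * r\<close>, and
    \<open>width n \<le> 19 * ln n\<close> gives the 19 and, for \<open>Suc (width n)\<close>, the
    20; the 6 is the amortized number of units.\<close>
  have bound: "norm (op_time n) \<le> 6 * real ds_cost * 19 * 12 * 20 * norm (real n powr (1/2) * ln (real n) ^ 2)"
    if n: "3 \<le> n" for n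
  proof -
    define r where "r = sqrt (real n)"
    have r: "1 \<le> r" "r * r = real n" using n by (simp_all add: r_def)
    have ln1: "1 \<le> ln (real n)"
    proof -
      have "exp 1 \<le> real n" using exp_le n by linarith
      then show ?thesis using n by (simp add: ln_ge_iff)
    qed
    have "sqrt (2 * real n) \<le> 2 * r" unfolding r_def by (simp add: real_sqrt_mult sqrt2_less_2 less_imp_le mult_right_mono)
    then have "real (side n) \<le> 2 * r + 2" using real_sqrt_ge_zero[of "2 * real n"] unfolding side_def by linarith
    then have side: "real (side n) \<le> 4 * r" using r(1) by linarith
    let ?x = "4 * ((side n + 4) * (side n + 4))"
    have "2 ^ (width n - 1) \<le> ?x" unfolding width_def using floorlog_bounds[of ?x 2] by simp
    then have "real (2 ^ (width n - 1)) \<le> real ?x" by (simp only: of_nat_le_iff)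
    also have "\<dots> = 4 * ((real (side n) + 4) * (real (side n) + 4))" by simp
    also have "\<dots> \<le> 4 * ((8 * r) * (8 * r))" using side r(1) by (intro mult_left_mono mult_mono) auto
    also have "\<dots> = 2 ^ 8 * real n" using r(2) by simp
    finally have "ln (2 ^ (width n - 1)) \<le> ln (2 ^ 8 * real n)" using n by simp
    also have "ln (2 ^ 8 * real n) = ln (2 ^ 8) + ln (real n)"
      using n by (subst ln_mult_pos) simp_all
    also have "ln (2 ^ (width n - 1)) = real (width n - 1) * ln 2" by (simp add: ln_realpow)
    also have "ln ((2::real) ^ 8) = 8 * ln 2"
      using ln_realpow[of "2::real" 8] by (simp only: of_nat_numeral zero_less_numeral)
    finally have "real (width n - 1) * ln 2 \<le> 8 * ln 2 + ln (real n)" .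
    moreover have "1 / 2 \<le> ln (2::real)" "ln (2::real) \<le> 1"
    proof -
      have "1 \<le> ln (4::real)" using exp_le by (simp add: ln_ge_iff)
      moreover have "ln (4::real) = 2 * ln 2" using ln_realpow[of 2 2] by simp
      ultimately show "1 / 2 \<le> ln (2::real)" by simp
      show "ln (2::real) \<le> 1" using ln_le_minus_one[of 2] by simp
    qed
    moreover have "real (width n - 1) * (1 / 2) \<le> real (width n - 1) * ln 2"
      using calculation(2) by (intro mult_left_mono) auto
    ultimately have "real (width n - 1) \<le> 16 + 2 * ln (real n)" by linarith
    then have w: "real (width n) \<le> 19 * ln (real n)" using ln1 by linarith
    have "op_time n = 6 * real ds_cost * (real (width n) * (2 * real (side n) + 4) * (real (width n) + 1))"
      by (simp add: op_time_def algebra_simps)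
    also have "\<dots> \<le> 6 * real ds_cost * ((19 * ln (real n)) * (12 * r) * (20 * ln (real n)))"
      using w side r(1) ln1 by (intro mult_left_mono mult_mono) auto
    also have "\<dots> = 6 * real ds_cost * 19 * 12 * 20 * (r * ln (real n) ^ 2)"
      by (simp add: power2_eq_square)
    also have "r = real n powr (1/2)" using n by (simp add: r_def powr_half_sqrt)
    finally show ?thesis using ln1 by (simp add: op_time_def)
  qed
  have "op_time \<in> O(\<lambda>n. real n powr (1/2) * ln (real n) ^ 2)"
    by (rule bigoI[where c = "6 * real ds_cost * 19 * 12 * 20"])
      (use bound in \<open>auto simp: eventually_at_top_linorder\<close>)
  then show ?thesis unfolding soft_O_def by blast
qed

theorem theorem18:
  shows "\<exists>D f. f \<in> soft_O (\<lambda>n. real n powr (1/2)) \<and> supports_in_amortized D f"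
  using op_time_soft_O supports_op_time by blast

end
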